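(* Let $A\in\mathscr{R}$ be a fixed set. In the risk model described in the context, suppose that the claim vectors $\{\mathbf{X}^{(i)}, i\in\mathbb{N}\}$ are identically distributed with common distribution $F$ supported on the nonnegative quadrant; that $\{\mathbf{X}^{(i)}, i\in\mathbb{N}\}$, $\{N(t), t\ge 0\}$ and $\{\xi(t), t\ge 0\}$ are mutually independent; that $\{\mathbf{X}^{(i)}, i\in\mathbb{N}\}$ are regression dependent on $A$ ($RD_A$); that $F\in\mathcal{S}_A$; and that $\{\xi(t), t\ge 0\}$ has non-decreasing sample paths. Then for any fixed $T\in\varLambda\setminus\{\infty\}$, $$\lim_{x\to\infty}\frac{\mathbf{P}\left[\mathbf{D}(T)\in xA\right]}{\int_0^T \mathbf{P}\left[\mathbf{X}\,e^{-\xi(s)}\in xA\right]\lambda(ds)}=1 .$$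
   Context: Risk model. Fix $d\in\mathbb{N}$. The claim vectors $\mathbf{X}^{(i)}=(X^{(i)}_1,\dots,X^{(i)}_d)^\top$, $i\in\mathbb{N}$, are identically distributed copies of a random vector $\mathbf{X}$ with distribution $F$ supported on $[0,\infty)^d$; a claim vector may have zero components but is not the zero vector. They are not assumed independent of each other, and the components of each vector may be arbitrarily dependent. Claims arrive at random times $\{\tau_i, i\in\mathbb{N}\}$ forming a renewal counting process $N(t)=\sup\{i\in\mathbb{N}:\tau_i\le t\}$, $t\ge 0$ (with $\sup\emptyset=0$), i.e. $\tau_i$ are the partial sums of i.i.d. nonnegative inter-arrival times (not a.s. zero). Its renewal function $\lambda(t)=\mathbf{E}[N(t)]=\sum_{i\ge1}\mathbf{P}[\tau_i\le t]$ is finite for finite $t$, and $\lambda(ds)=\sum_{i\ge 1}\mathbf{P}[\tau_i\in ds]$ is the renewal measure. Put $\varLambda=\{t\ge 0: 0<\lambda(t)\le\infty\}$ (allowing $t=\infty$). $\{\xi(t),t\ge0\}$ is a real-valued càdlàg stochastic process with $\xi(0)=0$. The discounted aggregate claim vector is $\mathbf{D}(T)=\sum_{i=1}^{N(T)}\mathbf{X}^{(i)}e^{-\xi(\tau_i)}$. Sets. A set $B\subset\mathbb{R}^d$ is increasing if $\mathbf{x}+\mathbf{y}\in B$ for all $\mathbf{x}\in B$ and $\mathbf{y}\in[0,\infty)^d$. $\mathscr{R}$ is the family of all $A\subset\mathbb{R}^d$ that are open, increasing, with convex complement $A^c$, and with $\mathbf{0}\notin\overline{A}$. Reduction to one dimension.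 For a random vector $\mathbf{Z}$ supported on $[0,\infty)^d$ with distribution $V$ and $A\in\mathscr{R}$, put $Z_A=\sup\{u:\mathbf{Z}\in uA\}$ (with $\sup\emptyset=0$); its distribution $V_A$ satisfies $\overline{V_A}(x)=\mathbf{P}[Z_A>x]=\mathbf{P}[\mathbf{Z}\in xA]$ for $x>0$. Here $\overline{G}=1-G$ denotes the tail of a distribution $G$. Class $\mathcal{S}_A$. A distribution $G$ on $[0,\infty)$ with $\overline G(x)>0$ for all $x\ge0$ is subexponential, $G\in\mathcal{S}$, if for any (equivalently, some) integer $n\ge2$, $\overline{G^{n*}}(x)\sim n\overline{G}(x)$ as $x\to\infty$, where $G^{n*}$ is the $n$-fold convolution. $V\in\mathcal{S}_A$ means $V_A\in\mathcal{S}$. Dependence. Nonnegative random variables $\{Z_i,i\ge1\}$ with distributions $V_1,V_2,\dots$ are regression dependent (RD) if there exist constants $x_0>0$ and $K>0$ such that $\mathbf{P}[Z_i>x_i\mid Z_j=x_j,\ j\in J]\le K\,\overline{V_i}(x_i)$ for any $i\in\mathbb{N}$, any nonempty $J\subsetneq\mathbb{N}\setminus\{i\}$, and all $x_i$, $x_j$ ($j\in J$) with $x_i\wedge x_j>x_0$. Nonnegative random vectors $\{\mathbf{Z}^{(i)},i\in\mathbb{N}\}$ are $RD_A$ if the random variables $Z_A^{(i)}=\sup\{u:\mathbf{Z}^{(i)}\in uA\}$, $i\in\mathbb{N}$, are RD. *)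

theory Defs
  imports "HOL-Probability.Probability" "HOL-Library.Landau_Symbols"
begin

section \<open>Sets and the reduction to one dimension\<close>

definition increasing_set :: "(real ^ 'd) set \<Rightarrow> bool" where
  "increasing_set B \<longleftrightarrow> (\<forall>x\<in>B. \<forall>y. (\<forall>k. 0 \<le> y $ k) \<longrightarrow> x + y \<in> B)"

definition ruin_sets :: "(real ^ 'd) set set" where
  "ruin_sets = {A. open A \<and> increasing_set A \<and> convex (- A) \<and> 0 \<notin> closure A}"

text \<open>The case distinction is needed because \<open>Sup {}\<close> is unspecified on the reals.\<close>

definition radial :: "(real ^ 'd) set \<Rightarrow> real ^ 'd \<Rightarrow> real" where
  "radial A z =
     (if {u. z \<in> (*\<^sub>R) u ` A} = {} then 0 else Sup {u. z \<in> (*\<^sub>R) u ` A})"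

section \<open>Subexponentiality\<close>

primrec conv_power :: "nat \<Rightarrow> real measure \<Rightarrow> real measure" where
  "conv_power 0 G = return borel 0"
| "conv_power (Suc n) G = convolution G (conv_power n G)"

definition tail :: "real measure \<Rightarrow> real \<Rightarrow> real" where
  "tail G x = 1 - cdf G x"

definition subexponential :: "real measure \<Rightarrow> bool" where
  "subexponential G \<longleftrightarrow>
     real_distribution G \<and> (AE x in G. 0 \<le> x) \<and> (\<forall>x\<ge>0. 0 < tail G x) \<and>
     (\<forall>n\<ge>2. tail (conv_power n G) \<sim>[at_top] (\<lambda>x. real n * tail G x))"

definition subexponential_on :: "(real ^ 'd) set \<Rightarrow> (real ^ 'd) measure \<Rightarrow> bool" where
  "subexponential_on A V \<longleftrightarrow> subexponential (distr V borel (radial A))"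

section \<open>Regression dependence\<close>

definition process_algebra ::
    "'a measure \<Rightarrow> 'i set \<Rightarrow> 'b measure \<Rightarrow> ('i \<Rightarrow> 'a \<Rightarrow> 'b) \<Rightarrow> 'a measure" where
  "process_algebra M I S Y =
     vimage_algebra (space M) (\<lambda>\<omega>. \<lambda>i\<in>I. Y i \<omega>) (Pi\<^sub>M I (\<lambda>_. S))"

text \<open>
  The conditional probability of \<open>Z i > y\<close> given \<open>Z j = z j\<close>, \<open>j \<in> J\<close>, is determined only up to
  null sets of the law of \<open>(Z j)\<^sub>j\<^sub>\<in>\<^sub>J\<close>; accordingly the bound is imposed for almost
  every value \<open>(z j)\<^sub>j\<^sub>\<in>\<^sub>J\<close> all of whose components exceed \<open>x0\<close>.
\<close>

definition regression_dependent :: "'a measure \<Rightarrow> nat set \<Rightarrow> (nat \<Rightarrow> 'a \<Rightarrow> real) \<Rightarrow> bool" where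
  "regression_dependent M I Z \<longleftrightarrow>
     (\<exists>x0>0. \<exists>K>0. \<forall>i\<in>I. \<forall>J. J \<noteq> {} \<longrightarrow> J \<subset> I - {i} \<longrightarrow>
        (\<forall>y>x0. AE \<omega> in M. (\<forall>j\<in>J. x0 < Z j \<omega>) \<longrightarrow>
           real_cond_exp M (process_algebra M J borel Z)
             (indicator {\<omega> \<in> space M. y < Z i \<omega>}) \<omega>
           \<le> K * tail (distr M borel (Z i)) y))"

definition regression_dependent_on ::
    "(real ^ 'd) set \<Rightarrow> 'a measure \<Rightarrow> nat set \<Rightarrow> (nat \<Rightarrow> 'a \<Rightarrow> real ^ 'd) \<Rightarrow> bool" where
  "regression_dependent_on A M I Z \<longleftrightarrow> regression_dependent M I (\<lambda>i \<omega>. radial A (Z i \<omega>))"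

section \<open>Arrivals, discounting and aggregate claims\<close>

text \<open>All sequences are indexed from 1; the values at index 0 are never used.\<close>

definition arrival :: "(nat \<Rightarrow> 'a \<Rightarrow> real) \<Rightarrow> nat \<Rightarrow> 'a \<Rightarrow> real" where
  "arrival \<theta> i \<omega> = (\<Sum>j=1..i. \<theta> j \<omega>)"

definition counting :: "(nat \<Rightarrow> 'a \<Rightarrow> real) \<Rightarrow> real \<Rightarrow> 'a \<Rightarrow> enat" where
  "counting \<theta> t \<omega> = Sup {enat i | i. 1 \<le> i \<and> arrival \<theta> i \<omega> \<le> t}"

definition renewal_interarrivals :: "'a measure \<Rightarrow> (nat \<Rightarrow> 'a \<Rightarrow> real) \<Rightarrow> bool" where
  "renewal_interarrivals M \<theta> \<longleftrightarrow>
     prob_space.indep_vars M (\<lambda>_. borel) \<theta> {1..} \<and>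
     (\<forall>i\<ge>1. distr M borel (\<theta> i) = distr M borel (\<theta> 1)) \<and>
     (\<forall>i\<ge>1. \<forall>\<omega>\<in>space M. 0 \<le> \<theta> i \<omega>) \<and>
     \<not> (AE \<omega> in M. \<theta> 1 \<omega> = 0)"

definition renewal_function :: "'a measure \<Rightarrow> (nat \<Rightarrow> 'a \<Rightarrow> real) \<Rightarrow> real \<Rightarrow> ennreal" where
  "renewal_function M \<theta> t = (\<integral>\<^sup>+ \<omega>. ennreal_of_enat (counting \<theta> t \<omega>) \<partial>M)"

definition renewal_measure :: "'a measure \<Rightarrow> (nat \<Rightarrow> 'a \<Rightarrow> real) \<Rightarrow> real measure" where
  "renewal_measure M \<theta> =
     measure_of UNIV (sets borel)
       (\<lambda>B. \<Sum>i. emeasure (distr M borel (arrival \<theta> (Suc i))) B)"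

lemma sets_renewal_measure [simp, measurable_cong]: "sets (renewal_measure M \<theta>) = sets borel"
  using sigma_algebra.sigma_sets_eq[OF sets.sigma_algebra_axioms[of "borel :: real measure"]]
  by (simp add: renewal_measure_def)

lemma emeasure_renewal_measure:
  assumes "B \<in> sets borel"
  shows "emeasure (renewal_measure M \<theta>) B =
    (\<Sum>i. emeasure (distr M borel (arrival \<theta> (Suc i))) B)"
proof -
  have "countably_additive (sets borel)
      (\<lambda>B. \<Sum>i. emeasure (distr M borel (arrival \<theta> (Suc i))) B)"
  proof (rule countably_additiveI)
    fix C :: "nat \<Rightarrow> real set"
    assume C: "range C \<subseteq> sets borel" "disjoint_family C"
    have "(\<Sum>k. \<Sum>i. emeasure (distr M borel (arrival \<theta> (Suc i))) (C k)) =
        (\<Sum>i. \<Sum>k. emeasure (distr M borel (arrival \<theta> (Suc i))) (C k))"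
      by (simp flip: nn_integral_count_space_nat) (rule pair_sigma_finite.Fubini',
          auto intro!: pair_sigma_finite.intro sigma_finite_measure_count_space
               simp: pair_measure_countable)
    also have "\<dots> = (\<Sum>i. emeasure (distr M borel (arrival \<theta> (Suc i))) (\<Union> (range C)))"
      using C by (intro suminf_cong suminf_emeasure) auto
    finally show "(\<Sum>k. \<Sum>i. emeasure (distr M borel (arrival \<theta> (Suc i))) (C k)) =
        (\<Sum>i. emeasure (distr M borel (arrival \<theta> (Suc i))) (\<Union> (range C)))" .
  qed
  then show ?thesis
    using assms sets.sigma_algebra_axioms[of "borel :: real measure"]
    unfolding renewal_measure_def
    by (intro emeasure_measure_of_sigma) (auto simp: positive_def)
qed

definition cadlag :: "(real \<Rightarrow> real) \<Rightarrow> bool" where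
  "cadlag f \<longleftrightarrow> (\<forall>t\<ge>0. continuous (at_right t) f) \<and> (\<forall>t>0. \<exists>l. (f \<longlongrightarrow> l) (at_left t))"

definition cadlag_process :: "'a measure \<Rightarrow> (real \<Rightarrow> 'a \<Rightarrow> real) \<Rightarrow> bool" where
  "cadlag_process M \<xi> \<longleftrightarrow>
     (\<forall>t\<ge>0. \<xi> t \<in> borel_measurable M) \<and>
     (\<forall>\<omega>\<in>space M. \<xi> 0 \<omega> = 0 \<and> cadlag (\<lambda>t. \<xi> t \<omega>))"

text \<open>
  \<open>counting \<theta> T\<close> is infinite only on a null event; there the sum ranges over an infinite set and
  is \<open>0\<close>.
\<close>

definition aggregate_claims ::
    "(nat \<Rightarrow> 'a \<Rightarrow> real ^ 'd) \<Rightarrow> (nat \<Rightarrow> 'a \<Rightarrow> real) \<Rightarrow> (real \<Rightarrow> 'a \<Rightarrow> real) \<Rightarrow>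
      real \<Rightarrow> 'a \<Rightarrow> real ^ 'd" where
  "aggregate_claims X \<theta> \<xi> T \<omega> =
     (\<Sum>i | 1 \<le> i \<and> enat i \<le> counting \<theta> T \<omega>. exp (- \<xi> (arrival \<theta> i \<omega>) \<omega>) *\<^sub>R X i \<omega>)"

definition mutually_independent ::
    "'a measure \<Rightarrow> 'a measure \<Rightarrow> 'a measure \<Rightarrow> 'a measure \<Rightarrow> bool" where
  "mutually_independent M A B C \<longleftrightarrow>
     prob_space.indep_sets M (\<lambda>k. [sets A, sets B, sets C] ! k) {..<3}"

end

theory Submission
  imports Defs
begin

text \<open>
  By convexity of the complement, \<open>radial A\<close> is subadditive on the positive orthant, so with
  \<open>Y i = radial A (X i)\<close> and weights \<open>w i = exp (- \<xi> (\<tau> i))\<close> the event \<open>D(T) \<in> xA\<close> lies between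
  \<open>max (w i * Y i) > x\<close> and \<open>\<Sum> w i * Y i > x\<close>. The denominator is the sum of the \<open>P(w i * Y i > x)\<close>.
  For a fixed number of summands both probabilities are asymptotic to this sum: the \<open>Y i\<close> share one
  subexponential law, and regression dependence makes two large claims as unlikely as under
  independence, up to a constant. A uniform estimate over all weights in \<open>(0, 1]\<close> is false, because
  passing from \<open>x - L\<close> to \<open>x\<close> in \<open>P(w * Y > x)\<close> is not uniform as \<open>w \<rightarrow> 0\<close>; it holds after averaging
  over the weights. Late claims are negligible by a Kesten bound \<open>C q^n\<close> with \<open>q\<close> close to 1, which
  beats the geometric decay of \<open>P(\<tau> n \<le> T)\<close>; as \<open>\<xi>\<close> is non-decreasing, \<open>w 1\<close> dominates all weights
  and everything is compared with the first claim.
\<close>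

section \<open>The radial function\<close>

text \<open>Regression dependence controls one claim given others, and only where those others
  exceed \<open>x0\<close>. A sum is therefore split until the conditioning claims are large:
  \<open>S + Y > y\<close> forces \<open>Y > y - a\<close>, or \<open>S > y - a\<close>, or both
  above a fixed \<open>a > x0\<close>. Only the last event involves \<open>S\<close> and
  \<open>Y\<close> together; conditioning twice compares it, up to a constant factor, with the same
  event for two independent copies of law \<open>G\<close>. For those its probability is a small
  multiple of \<open>tail G y\<close> when \<open>a\<close> is large, so the constant does no harm.
  Independence enters in two groupings. Freezing arrivals and discounting together makes the weights
  deterministic, and the estimates on sums apply. Freezing the arrivals alone turns the
  \<open>i\<close>-th term of the denominator into the mean of \<open>psi x\<close> at the
  \<open>i\<close>-th arrival time, which is what the renewal measure integrates, and makes the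
  first claim comparable under the extra condition of \<open>n\<close> arrivals.\<close>

lemma ruin_setD:
  assumes "A \<in> ruin_sets"
  shows ruin_set_open: "open A"
    and ruin_set_increasing: "\<And>x y. x \<in> A \<Longrightarrow> (\<And>k. 0 \<le> y $ k) \<Longrightarrow> x + y \<in> A"
    and ruin_set_convex: "convex (- A)"
    and ruin_set_zero: "0 \<notin> closure A"
  using assms by (auto simp: ruin_sets_def increasing_set_def)

lemma in_scaleR_image_iff:
  fixes z :: "'v::real_vector"
  assumes "u \<noteq> 0"
  shows "z \<in> (*\<^sub>R) u ` A \<longleftrightarrow> z /\<^sub>R u \<in> A"
proof
  assume "z /\<^sub>R u \<in> A"
  then show "z \<in> (*\<^sub>R) u ` A"
    using assms by (intro image_eqI[of _ _ "z /\<^sub>R u"]) auto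
qed (use assms in auto)

text \<open>If rescalings of \<open>z\<close> by arbitrarily large \<open>u\<close> stayed in
  \<open>A\<close>, the origin would be a limit of points of \<open>A\<close>.\<close>

lemma radial_set_bdd_above:
  assumes "A \<in> ruin_sets"
  shows "bdd_above {u. z \<in> (*\<^sub>R) u ` A}"
proof (rule ccontr)
  assume *: "\<not> bdd_above {u. z \<in> (*\<^sub>R) u ` A}"
  have "0 \<in> closure A"
    unfolding closure_approachable
  proof (intro allI impI)
    fix e :: real assume e: "0 < e"
    obtain u where u: "z \<in> (*\<^sub>R) u ` A" "max 1 (norm z / e) < u"
      using * unfolding bdd_above_def by (metis mem_Collect_eq linorder_not_less)
    have "norm z < e * u"
      using u(2) e by (simp add: field_simps)
    then have "dist (z /\<^sub>R u) 0 < e"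
      using u(2) by (simp add: field_simps)
    moreover have "z /\<^sub>R u \<in> A"
      using u by (subst (asm) in_scaleR_image_iff) auto
    ultimately show "\<exists>y\<in>A. dist y 0 < e" by blast
  qed
  then show False using ruin_set_zero[OF assms] by simp
qed

lemma less_radial_iff_ex:
  assumes "A \<in> ruin_sets" "0 \<le> x"
  shows "x < radial A z \<longleftrightarrow> (\<exists>u>x. z \<in> (*\<^sub>R) u ` A)"
proof (cases "{u. z \<in> (*\<^sub>R) u ` A} = {}")
  case False
  then show ?thesis
    using less_cSup_iff[OF False radial_set_bdd_above[OF assms(1)], of x] by (auto simp: radial_def)
qed (use assms in \<open>auto simp: radial_def\<close>)

text \<open>Monotonicity of \<open>A\<close> carries membership from a larger scale down to
  \<open>x\<close>; openness pushes it from \<open>x\<close> to a slightly larger scale, which is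
  why the inequality is strict.\<close>

lemma less_radial_iff:
  assumes A: "A \<in> ruin_sets" and x: "0 < x" and z: "\<And>k. 0 \<le> z $ k"
  shows "x < radial A z \<longleftrightarrow> z \<in> (*\<^sub>R) x ` A"
proof
  assume "x < radial A z"
  then obtain u where u: "x < u" "z \<in> (*\<^sub>R) u ` A"
    using less_radial_iff_ex[OF A] x by auto
  then have "z /\<^sub>R u \<in> A"
    using x by (subst (asm) in_scaleR_image_iff) auto
  then have "z /\<^sub>R u + (1/x - 1/u) *\<^sub>R z \<in> A"
    using u(1) x z by (intro ruin_set_increasing[OF A]) (auto intro!: mult_nonneg_nonneg simp: frac_le)
  also have "z /\<^sub>R u + (1/x - 1/u) *\<^sub>R z = z /\<^sub>R x"
    by (simp add: algebra_simps divide_inverse)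
  finally show "z \<in> (*\<^sub>R) x ` A"
    using x by (subst in_scaleR_image_iff) auto
next
  assume "z \<in> (*\<^sub>R) x ` A"
  then have *: "z /\<^sub>R x \<in> A" using x by (subst (asm) in_scaleR_image_iff) auto
  have "((\<lambda>u. z /\<^sub>R u) \<longlongrightarrow> z /\<^sub>R x) (at_right x)"
    using x by (intro tendsto_intros tendsto_ident_at) auto
  then have "\<forall>\<^sub>F u in at_right x. z /\<^sub>R u \<in> A"
    using ruin_set_open[OF A] * by (rule topological_tendstoD)
  moreover have "\<forall>\<^sub>F u in at_right x. x < u"
    by (simp add: eventually_at_right_less)
  ultimately have "\<forall>\<^sub>F u in at_right x. z /\<^sub>R u \<in> A \<and> x < u"
    by eventually_elim simp
  then obtain u where "z /\<^sub>R u \<in> A" "x < u"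
    using eventually_happens by fastforce
  then show "x < radial A z"
    using x less_radial_iff_ex[OF A, of x z] by (auto simp: in_scaleR_image_iff intro!: exI[of _ u])
qed

lemma radial_nonneg:
  assumes A: "A \<in> ruin_sets" and z: "\<And>k. 0 \<le> z $ k"
  shows "0 \<le> radial A z"
proof (cases "{u. z \<in> (*\<^sub>R) u ` A} = {}")
  case False
  then obtain u where u: "z \<in> (*\<^sub>R) u ` A" by auto
  \<comment> \<open>The defining set also admits negative scales. Dividing \<open>z\<close> by such
    a \<open>u\<close> gives nonpositive coordinates, so adding the negative of that point would put
    the origin into \<open>A\<close>.\<close>
  have "0 \<le> u"
  proof (rule ccontr)
    assume "\<not> 0 \<le> u"
    then have "z /\<^sub>R u \<in> A" using u by (subst (asm) in_scaleR_image_iff) auto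
    then have "z /\<^sub>R u + - (z /\<^sub>R u) \<in> A"
      using z \<open>\<not> 0 \<le> u\<close> by (intro ruin_set_increasing[OF A]) (auto simp: mult_nonpos_nonneg)
    then show False using ruin_set_zero[OF A] closure_subset[of A] by auto
  qed
  then show ?thesis
    using False u cSup_upper2[OF _ \<open>0 \<le> u\<close> radial_set_bdd_above[OF A, of z]]
    by (simp add: radial_def)
qed (auto simp: radial_def)

lemma le_radialI:
  assumes "A \<in> ruin_sets" "\<And>k. 0 \<le> z $ k"
    and "\<And>x. 0 < x \<Longrightarrow> x < a \<Longrightarrow> z \<in> (*\<^sub>R) x ` A"
  shows "a \<le> radial A z"
proof (rule ccontr)
  assume "\<not> a \<le> radial A z"
  then obtain x where "radial A z < x" "x < a" using dense[of "radial A z" a] by auto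
  moreover have "0 < x"
    using radial_nonneg[OF assms(1,2)] \<open>radial A z < x\<close> by simp
  ultimately show False
    using assms(3)[of x] less_radial_iff[OF assms(1) \<open>0 < x\<close> assms(2)] by simp
qed

text \<open>Both sides are nonnegative and exceed the same positive levels.\<close>

lemma radial_scaleR:
  assumes A: "A \<in> ruin_sets" and z: "\<And>k. 0 \<le> z $ k" and c: "0 < c"
  shows "radial A (c *\<^sub>R z) = c * radial A z"
proof -
  have *: "x < radial A (c *\<^sub>R z) \<longleftrightarrow> x < c * radial A z" if "0 < x" for x
  proof -
    have "c *\<^sub>R z \<in> (*\<^sub>R) x ` A \<longleftrightarrow> z \<in> (*\<^sub>R) (x / c) ` A"
      using that c by (simp add: in_scaleR_image_iff divide_inverse mult.commute)
    then show ?thesis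
      using that c z less_radial_iff[OF A, of x "c *\<^sub>R z"] less_radial_iff[OF A, of "x / c" z]
      by (auto simp: field_simps)
  qed
  have nn: "0 \<le> radial A (c *\<^sub>R z)" "0 \<le> c * radial A z"
    using radial_nonneg[OF A] z c by auto
  show ?thesis
  proof (rule ccontr)
    assume "radial A (c *\<^sub>R z) \<noteq> c * radial A z"
    then have "min (radial A (c *\<^sub>R z)) (c * radial A z) < max (radial A (c *\<^sub>R z)) (c * radial A z)"
      by auto
    then obtain x where x: "min (radial A (c *\<^sub>R z)) (c * radial A z) < x"
        "x < max (radial A (c *\<^sub>R z)) (c * radial A z)"
      using dense by blast
    then have "0 < x" using nn by linarith
    then show False using *[of x] x by linarith
  qed
qed

lemma radial_mono:
  assumes A: "A \<in> ruin_sets" and z: "\<And>k. 0 \<le> z $ k" and w: "\<And>k. z $ k \<le> w $ k"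
  shows "radial A z \<le> radial A w"
proof (rule le_radialI[OF A])
  fix x assume x: "0 < x" "x < radial A z"
  then have "z /\<^sub>R x \<in> A"
    using less_radial_iff[OF A, of x z] z by (auto simp: in_scaleR_image_iff)
  then have "z /\<^sub>R x + (w - z) /\<^sub>R x \<in> A"
    using x w by (intro ruin_set_increasing[OF A]) auto
  then show "w \<in> (*\<^sub>R) x ` A"
    using x by (simp add: in_scaleR_image_iff algebra_simps)
qed (use z w order_trans in blast)

text \<open>On the orthant \<open>radial A\<close> acts as the Minkowski gauge of the convex set
  \<open>- A\<close>. Levels slightly above the two values put the rescaled points outside
  \<open>A\<close>, and a convex combination of these points is the rescaled sum.\<close>

lemma radial_add_le:
  assumes A: "A \<in> ruin_sets" and z: "\<And>k. 0 \<le> z $ k" and w: "\<And>k. 0 \<le> w $ k"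
  shows "radial A (z + w) \<le> radial A z + radial A w"
proof (rule field_le_epsilon)
  fix e :: real assume e: "0 < e"
  define a b where "a = radial A z + e / 2" and "b = radial A w + e / 2"
  have ab: "0 < a" "0 < b"
    using radial_nonneg[OF A z] radial_nonneg[OF A w] e by (auto simp: a_def b_def)
  have "z /\<^sub>R a \<in> - A"
    using less_radial_iff[OF A, of a z] ab z e by (simp add: in_scaleR_image_iff a_def)
  moreover have "w /\<^sub>R b \<in> - A"
    using less_radial_iff[OF A, of b w] ab w e by (simp add: in_scaleR_image_iff b_def)
  ultimately have "(a / (a + b)) *\<^sub>R (z /\<^sub>R a) + (b / (a + b)) *\<^sub>R (w /\<^sub>R b) \<in> - A"
    using ab by (intro convexD[OF ruin_set_convex[OF A]]) (auto simp flip: add_divide_distrib)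
  also have "(a / (a + b)) *\<^sub>R (z /\<^sub>R a) + (b / (a + b)) *\<^sub>R (w /\<^sub>R b) = (z + w) /\<^sub>R (a + b)"
    using ab by (simp add: scaleR_add_right field_simps)
  finally have "\<not> a + b < radial A (z + w)"
    using less_radial_iff[OF A, of "a + b" "z + w"] ab z w by (simp add: in_scaleR_image_iff)
  then show "radial A (z + w) \<le> radial A z + radial A w + e"
    by (simp add: a_def b_def)
qed

lemma radial_zero:
  assumes A: "A \<in> ruin_sets" shows "radial A 0 = 0"
  using radial_scaleR[OF A, of 0 2] by simp

lemma radial_sum_le:
  assumes A: "A \<in> ruin_sets" and z: "\<And>i k. i \<in> I \<Longrightarrow> 0 \<le> z i $ k"
  shows "radial A (\<Sum>i\<in>I. z i) \<le> (\<Sum>i\<in>I. radial A (z i))"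
  using z
proof (induction I rule: infinite_finite_induct)
  case (insert i I)
  then have "radial A (z i + sum z I) \<le> radial A (z i) + radial A (sum z I)"
    by (intro radial_add_le[OF A]) (auto intro!: sum_nonneg)
  then show ?case using insert by force
qed (auto simp: radial_zero[OF A])

text \<open>Superlevel sets are uncountable unions of scaled copies of \<open>A\<close>. Copies at
  nonzero scale are open, so only scale 0 has to be split off; negative levels add the points lying
  in no copy, whose value is 0 by convention.\<close>

lemma measurable_radial [measurable]:
  assumes A: "A \<in> ruin_sets"
  shows "radial A \<in> borel_measurable borel"
proof -
  have op: "open (\<Union>u\<in>U - {0}. (*\<^sub>R) u ` A)" for U
    using ruin_set_open[OF A] by (intro open_UN ballI open_scaling) auto
  have *: "(\<Union>u\<in>U. (*\<^sub>R) u ` A) \<in> sets borel" for U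
  proof -
    have "(*\<^sub>R) 0 ` A = (if A = {} then {} else {0})" by auto
    then have "(*\<^sub>R) 0 ` A \<in> sets borel" by auto
    moreover have "(\<Union>u\<in>U. (*\<^sub>R) u ` A) =
        (\<Union>u\<in>U - {0}. (*\<^sub>R) u ` A) \<union> (if 0 \<in> U then (*\<^sub>R) 0 ` A else {})"
      by (cases "0 \<in> U") auto
    ultimately show ?thesis using borel_open[OF op[of U]] by (simp add: sets.Un)
  qed
  have "{z. x < radial A z} \<in> sets borel" for x
  proof -
    have "x < radial A z \<longleftrightarrow>
        z \<in> (\<Union>u\<in>{x<..}. (*\<^sub>R) u ` A) \<union> (if x < 0 then - (\<Union>u. (*\<^sub>R) u ` A) else {})" for z
    proof (cases "{u. z \<in> (*\<^sub>R) u ` A} = {}")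
      case False
      then show ?thesis
        using less_cSup_iff[OF False radial_set_bdd_above[OF A], of x] by (auto simp: radial_def)
    qed (auto simp: radial_def)
    then have "{z. x < radial A z} =
        (\<Union>u\<in>{x<..}. (*\<^sub>R) u ` A) \<union> (if x < 0 then - (\<Union>u. (*\<^sub>R) u ` A) else {})"
      by blast
    then show ?thesis
      using *[of "{x<..}"] borel_comp[OF *[of UNIV]] by (simp add: sets.Un del: Compl_UN)
  qed
  then show ?thesis by (simp add: borel_measurable_iff_greater)
qed

section \<open>Subexponential laws\<close>

lemma tail_eq_measure:
  assumes "real_distribution G"
  shows "tail G x = measure G {x<..}"
proof -
  interpret real_distribution G by fact
  have "prob (UNIV - {..x}) = 1 - prob {..x}"
    using prob_compl[of "{..x}"] by simp
  moreover have "UNIV - {..x} = {x<..}" by auto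
  ultimately show ?thesis by (simp add: tail_def cdf_def)
qed

lemma measure_pair_Times:
  assumes "finite_measure M" "finite_measure N" "A \<in> sets M" "B \<in> sets N"
  shows "measure (M \<Otimes>\<^sub>M N) (A \<times> B) = measure M A * measure N B"
proof -
  interpret M: finite_measure M by fact
  interpret N: finite_measure N by fact
  show ?thesis
    using assms(3,4) by (simp add: measure_def N.emeasure_pair_measure_Times enn2real_mult)
qed

text \<open>\<open>conv_power\<close> starts from the point mass at 0, so
  \<open>conv_power 2 G\<close> contains this extra factor.\<close>

lemma convolution_return_zero:
  assumes "real_distribution G"
  shows "convolution G (return borel 0) = G"
proof (rule measure_eqI)
  interpret real_distribution G by fact
  interpret R: prob_space "return borel (0::real)" by (rule prob_space_return) simp
  show "sets (convolution G (return borel 0)) = sets G" by simp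
  fix B assume "B \<in> sets (convolution G (return borel 0))"
  then have B: "B \<in> sets borel" by simp
  have "emeasure (convolution G (return borel 0)) B = (\<integral>\<^sup>+x. emeasure (return borel 0) {a. a + x \<in> B} \<partial>G)"
    using B by (intro convolution_emeasure) (auto simp: finite_measure_axioms R.finite_measure_axioms)
  also have "\<dots> = (\<integral>\<^sup>+x. indicator B x \<partial>G)"
  proof (rule nn_integral_cong)
    fix x
    have "{a. a + x \<in> B} \<in> sets borel"
      using measurable_sets[of "\<lambda>a. a + x" borel borel B] B by (auto simp: vimage_def)
    then show "emeasure (return borel 0) {a. a + x \<in> B} = indicator B x"
      by (simp add: indicator_def)
  qed
  finally show "emeasure (convolution G (return borel 0)) B = emeasure G B"
    using B by simp
qed

text \<open>The benchmark for dependent pairs: \<open>both_large_bound\<close> compares them with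
  two independent copies of law \<open>G\<close>.\<close>

definition joint_tail :: "real measure \<Rightarrow> real \<Rightarrow> real \<Rightarrow> real" where
  "joint_tail G a y = measure (G \<Otimes>\<^sub>M G) {p. a < fst p \<and> a < snd p \<and> y < fst p + snd p}"

locale subexponential_law =
  fixes G :: "real measure"
  assumes subexp: "subexponential G"
begin

sublocale real_distribution G
  using subexp by (simp add: subexponential_def)

sublocale GG: pair_prob_space G G ..

lemma AE_nonneg: "AE x in G. 0 \<le> x"
  and tail_pos_nonneg: "0 \<le> x \<Longrightarrow> 0 < tail G x"
  using subexp by (simp_all add: subexponential_def)

lemma tail_alt: "tail G x = prob {x<..}"
  by (rule tail_eq_measure) (rule real_distribution_axioms)

lemma tail_mono: "x \<le> y \<Longrightarrow> tail G y \<le> tail G x"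
  unfolding tail_alt by (intro finite_measure_mono) auto

lemma tail_nonneg: "0 \<le> tail G x"
  by (simp add: tail_alt)

lemma tail_pos: "0 < tail G x"
  using tail_pos_nonneg[of "max x 0"] tail_mono[of x "max x 0"] by simp

lemma tail_tendsto_0: "(tail G \<longlongrightarrow> 0) at_top"
  using tendsto_diff[OF tendsto_const cdf_lim_at_top_prob, of 1] by (simp add: tail_def [abs_def])

lemma prob_atMost: "prob {..x} = 1 - tail G x"
  by (simp add: tail_def cdf_def)

lemma prob_atLeastAtMost: "prob {0..x} = 1 - tail G x"
  unfolding prob_atMost[symmetric] using AE_nonneg
  by (intro finite_measure_eq_AE) auto

lemma prob_nonneg: "prob {0..} = 1"
  using AE_nonneg by (subst prob_eq_1) auto

definition tail2 :: "real \<Rightarrow> real" where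
  "tail2 y = measure (G \<Otimes>\<^sub>M G) {p. y < fst p + snd p}"

lemma sum_less_in_sets [simp]: "{p. y < fst p + snd p} \<in> sets (borel \<Otimes>\<^sub>M (borel :: real measure))"
proof -
  have "{p \<in> space (borel \<Otimes>\<^sub>M borel). y < fst p + snd p} \<in> sets (borel \<Otimes>\<^sub>M (borel :: real measure))"
    by measurable
  then show ?thesis by (simp add: space_pair_measure)
qed

lemma joint_in_sets [simp]:
  "{p. a < fst p \<and> a < snd p \<and> y < fst p + snd p} \<in> sets (borel \<Otimes>\<^sub>M (borel :: real measure))"
proof -
  have "{p \<in> space (borel \<Otimes>\<^sub>M borel). a < fst p \<and> a < snd p \<and> y < fst p + snd p}
      \<in> sets (borel \<Otimes>\<^sub>M (borel :: real measure))"
    by measurable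
  then show ?thesis by (simp add: space_pair_measure)
qed

lemma tail2_conv: "tail (conv_power 2 G) = tail2"
proof
  fix y
  have eq: "conv_power 2 G = convolution G G"
    by (simp add: numeral_2_eq_2 convolution_return_zero real_distribution_axioms)
  have m: "(\<lambda>(x, y). x + y) \<in> measurable (G \<Otimes>\<^sub>M G) borel"
    by measurable
  have rd: "real_distribution (convolution G G)"
    unfolding convolution_def by (intro real_distribution.intro GG.prob_space_distr m)
       (auto simp: real_distribution_axioms_def)
  have "tail (conv_power 2 G) y = measure (convolution G G) {y<..}"
    using rd by (simp add: eq tail_eq_measure)
  also have "\<dots> = measure (G \<Otimes>\<^sub>M G) ((\<lambda>(x, y). x + y) -` {y<..} \<inter> space (G \<Otimes>\<^sub>M G))"
    unfolding convolution_def by (intro measure_distr m) auto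
  also have "(\<lambda>(x, y). x + y) -` {y<..} \<inter> space (G \<Otimes>\<^sub>M G) = {p. y < fst p + snd p}"
    by (auto simp: space_pair_measure)
  finally show "tail (conv_power 2 G) y = tail2 y"
    by (simp add: tail2_def)
qed

lemma tail2_ratio: "((\<lambda>y. tail2 y / tail G y) \<longlongrightarrow> 2) at_top"
proof -
  have "tail2 \<sim>[at_top] (\<lambda>x. 2 * tail G x)"
    using subexp unfolding subexponential_def tail2_conv[symmetric] by force
  then have "((\<lambda>y. tail2 y / (2 * tail G y)) \<longlongrightarrow> 1) at_top"
    using tail_pos less_imp_neq[OF tail_pos, symmetric]
    by (intro asymp_equivD_strong) (auto intro: always_eventually)
  from tendsto_mult[OF tendsto_const this, of 2] show ?thesis
    by simp
qed

lemma measure_Times: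
  "A \<in> sets borel \<Longrightarrow> B \<in> sets borel \<Longrightarrow> measure (G \<Otimes>\<^sub>M G) (A \<times> B) = prob A * prob B"
  by (intro measure_pair_Times finite_measure_axioms) auto

text \<open>Three disjoint rectangles lie inside the event that two copies sum to more than
  \<open>x\<close>: second copy above \<open>x\<close>; first above \<open>x\<close> and second at
  most \<open>L\<close>; first above \<open>x - L\<close> and second between \<open>L\<close> and
  \<open>x\<close>.\<close>

lemma long_tail_bound:
  assumes L: "0 \<le> L" "L < x"
  shows "tail G (x - L) * (tail G L - tail G x) \<le> tail2 x - (2 - tail G L) * tail G x"
proof -
  let ?E1 = "{0..} \<times> {x<..}" and ?E2 = "{x<..} \<times> {0..L}" and ?E3 = "{x - L<..} \<times> {L<..x}"
  have s: "?E1 \<in> sets (G \<Otimes>\<^sub>M G)" "?E2 \<in> sets (G \<Otimes>\<^sub>M G)" "?E3 \<in> sets (G \<Otimes>\<^sub>M G)"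
    by auto
  have "prob {L<..x} = prob ({L<..} - {x<..})"
    by (intro arg_cong[of _ _ prob]) auto
  also have "\<dots> = tail G L - tail G x"
    unfolding tail_alt using L by (intro finite_measure_Diff) auto
  finally have m3: "prob {L<..x} = tail G L - tail G x" .
  have "measure (G \<Otimes>\<^sub>M G) (?E1 \<union> ?E2 \<union> ?E3) =
      measure (G \<Otimes>\<^sub>M G) ?E1 + measure (G \<Otimes>\<^sub>M G) ?E2 + measure (G \<Otimes>\<^sub>M G) ?E3"
    using s L by (subst GG.P.finite_measure_Union; (subst GG.P.finite_measure_Union)?) auto
  also have "\<dots> = tail G x + tail G x * (1 - tail G L) + tail G (x - L) * (tail G L - tail G x)"
    by (simp add: measure_Times prob_nonneg prob_atLeastAtMost m3 flip: tail_alt)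
  finally have "tail G x + tail G x * (1 - tail G L) + tail G (x - L) * (tail G L - tail G x)
      = measure (G \<Otimes>\<^sub>M G) (?E1 \<union> ?E2 \<union> ?E3)" by simp
  also have "\<dots> \<le> tail2 x"
    unfolding tail2_def by (intro GG.P.finite_measure_mono) auto
  finally show ?thesis by (simp add: algebra_simps)
qed

text \<open>After division of \<open>long_tail_bound\<close> by \<open>tail G x\<close>, the limit 2
  in \<open>tail2_ratio\<close> leaves \<open>tail G L / tail G L\<close> as upper limit of the
  ratio; the lower bound 1 is monotonicity.\<close>

lemma long_tail:
  assumes L: "0 \<le> L"
  shows "((\<lambda>x. tail G (x - L) / tail G x) \<longlongrightarrow> 1) at_top"
proof (rule tendsto_sandwich)
  show "\<forall>\<^sub>F x in at_top. 1 \<le> tail G (x - L) / tail G x"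
    using tail_pos tail_mono L by (intro always_eventually) (auto simp: field_simps)
  have "((\<lambda>x. (tail2 x / tail G x - (2 - tail G L)) / (tail G L - tail G x)) \<longlongrightarrow>
      (2 - (2 - tail G L)) / (tail G L - 0)) at_top"
    using tail_pos[of L] by (intro tendsto_intros tail2_ratio tail_tendsto_0) auto
  then show "((\<lambda>x. (tail2 x / tail G x - (2 - tail G L)) / (tail G L - tail G x)) \<longlongrightarrow> 1) at_top"
    using tail_pos[of L] by simp
  have "\<forall>\<^sub>F x in at_top. tail G x < tail G L"
    using order_tendstoD(2)[OF tail_tendsto_0 tail_pos[of L]] .
  then show "\<forall>\<^sub>F x in at_top. tail G (x - L) / tail G x \<le>
      (tail2 x / tail G x - (2 - tail G L)) / (tail G L - tail G x)"
    using eventually_gt_at_top[of L]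
  proof eventually_elim
    case (elim x)
    have "tail G (x - L) * (tail G L - tail G x) / tail G x
        \<le> (tail2 x - (2 - tail G L) * tail G x) / tail G x"
      using long_tail_bound[of L x] L elim tail_nonneg by (intro divide_right_mono) auto
    also have "\<dots> = tail2 x / tail G x - (2 - tail G L)"
      using tail_pos[of x] by (simp add: field_simps)
    finally show ?case using elim by (simp add: field_simps)
  qed
qed auto

lemma long_tail_le:
  assumes "0 \<le> L" "0 < e"
  shows "\<forall>\<^sub>F x in at_top. tail G (x - L) \<le> (1 + e) * tail G x"
  using order_tendstoD(2)[OF long_tail[OF assms(1)], of "1 + e"] assms(2)
  by (auto elim!: eventually_mono simp: pos_divide_less_eq[OF tail_pos])

text \<open>Two disjoint strips, with one copy above \<open>y\<close> and the other at most
  \<open>a\<close>, already use up most of \<open>tail2 y\<close> when \<open>a\<close> is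
  large.\<close>

lemma joint_tail_bound:
  assumes "0 \<le> a" "a \<le> y"
  shows "joint_tail G a y \<le> tail2 y - 2 * (1 - tail G a) * tail G y"
proof -
  let ?E1 = "{y<..} \<times> {0..a}" and ?E2 = "{0..a} \<times> {y<..}"
    and ?E3 = "{p. a < fst p \<and> a < snd p \<and> y < fst p + snd p}"
  have s: "?E1 \<in> sets (G \<Otimes>\<^sub>M G)" "?E2 \<in> sets (G \<Otimes>\<^sub>M G)" "?E3 \<in> sets (G \<Otimes>\<^sub>M G)"
    by auto
  have "measure (G \<Otimes>\<^sub>M G) (?E1 \<union> ?E2 \<union> ?E3) =
      measure (G \<Otimes>\<^sub>M G) ?E1 + measure (G \<Otimes>\<^sub>M G) ?E2 + measure (G \<Otimes>\<^sub>M G) ?E3"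
    using s assms by (subst GG.P.finite_measure_Union; (subst GG.P.finite_measure_Union)?) auto
  also have "\<dots> = 2 * (1 - tail G a) * tail G y + joint_tail G a y"
    by (simp add: measure_Times prob_atLeastAtMost joint_tail_def flip: tail_alt)
  finally have "2 * (1 - tail G a) * tail G y + joint_tail G a y
      = measure (G \<Otimes>\<^sub>M G) (?E1 \<union> ?E2 \<union> ?E3)" by simp
  also have "\<dots> \<le> tail2 y"
    unfolding tail2_def by (intro GG.P.finite_measure_mono) auto
  finally show ?thesis by (simp add: algebra_simps)
qed

text \<open>Relative to \<open>tail G\<close>, the joint tail is asymptotically at most
  \<open>2 * tail G a\<close>. The free bound \<open>m\<close> lets \<open>a\<close> be taken above
  the regression threshold.\<close>

lemma joint_tail_small:
  assumes "0 < d"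
  shows "\<exists>a>m. \<forall>\<^sub>F y in at_top. joint_tail G a y \<le> d * tail G y"
proof -
  have "\<forall>\<^sub>F a in at_top. 2 * tail G a < d \<and> max m 0 < a"
    using order_tendstoD(2)[OF tail_tendsto_0 half_gt_zero[OF assms]] eventually_gt_at_top[of "max m 0"]
    by eventually_elim auto
  then obtain a where a: "2 * tail G a < d" "max m 0 < a"
    using eventually_happens by force
  have "((\<lambda>y. tail2 y / tail G y - 2 * (1 - tail G a)) \<longlongrightarrow> 2 - 2 * (1 - tail G a)) at_top"
    by (intro tendsto_intros tail2_ratio)
  then have "\<forall>\<^sub>F y in at_top. tail2 y / tail G y - 2 * (1 - tail G a) < d"
    using a by (intro order_tendstoD(2)) auto
  then have "\<forall>\<^sub>F y in at_top. joint_tail G a y \<le> d * tail G y"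
    using eventually_ge_at_top[of a]
  proof eventually_elim
    case (elim y)
    have "joint_tail G a y \<le> (tail2 y / tail G y - 2 * (1 - tail G a)) * tail G y"
      using joint_tail_bound[of a y] elim a tail_pos[of y] by (simp add: algebra_simps)
    also have "\<dots> \<le> d * tail G y"
      using elim tail_nonneg by (intro mult_right_mono) auto
    finally show ?case .
  qed
  then show ?thesis using a by auto
qed

lemma joint_tail_mono:
  "y \<le> z \<Longrightarrow> joint_tail G a z \<le> joint_tail G a y"
  unfolding joint_tail_def by (intro GG.P.finite_measure_mono) auto

lemma joint_tail_nonneg: "0 \<le> joint_tail G a y"
  by (simp add: joint_tail_def)

text \<open>The tail of \<open>w Z\<close>, which for \<open>w = 0\<close> differs from \<open>tail G (x / w)\<close> since \<open>x / 0 = 0\<close>.\<close>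

definition scaled_tail :: "real \<Rightarrow> real \<Rightarrow> real" where
  "scaled_tail w x = prob {z. x < w * z}"

lemma scaled_tail_eq: "0 < w \<Longrightarrow> scaled_tail w x = tail G (x / w)"
  unfolding scaled_tail_def tail_alt by (intro arg_cong[of _ _ prob]) (auto simp: field_simps)

lemma scaled_tail_zero: "0 \<le> x \<Longrightarrow> scaled_tail 0 x = 0"
  by (simp add: scaled_tail_def)

lemma scaled_tail_nonneg: "0 \<le> scaled_tail w x"
  by (simp add: scaled_tail_def)

lemma scaled_tail_le_1: "scaled_tail w x \<le> 1"
  by (simp add: scaled_tail_def)

lemma scaled_tail_mono: "w \<le> w' \<Longrightarrow> scaled_tail w x \<le> scaled_tail w' x"
  unfolding scaled_tail_def using AE_nonneg
  by (intro finite_measure_mono_AE)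
    (auto elim!: eventually_mono intro: less_le_trans mult_right_mono)

lemma scaled_tail_antimono: "x \<le> y \<Longrightarrow> scaled_tail w y \<le> scaled_tail w x"
  unfolding scaled_tail_def by (intro finite_measure_mono) auto

lemma scaled_tail_measurable [measurable]:
  assumes "w \<in> borel_measurable N"
  shows "(\<lambda>\<omega>. scaled_tail (w \<omega>) x) \<in> borel_measurable N"
proof -
  have "(\<lambda>w. scaled_tail w x) \<in> borel_measurable borel"
    by (intro borel_measurable_mono) (auto simp: mono_def scaled_tail_mono)
  from measurable_compose[OF assms this] show ?thesis .
qed

end

section \<open>Process algebras and random thresholds\<close>

lemma space_process_algebra [simp]: "space (process_algebra M I S Y) = space M"
  by (simp add: process_algebra_def)

lemma measurable_process_algebra_coord:
  assumes "i \<in> I" "\<And>i. i \<in> I \<Longrightarrow> Y i \<in> space M \<rightarrow> space S"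
  shows "Y i \<in> measurable (process_algebra M I S Y) S"
proof -
  have "(\<lambda>\<omega>. \<lambda>i\<in>I. Y i \<omega>) \<in> measurable (process_algebra M I S Y) (Pi\<^sub>M I (\<lambda>_. S))"
    unfolding process_algebra_def using assms(2)
    by (intro measurable_vimage_algebra1) (fastforce simp: space_PiM intro: PiE_I)
  from measurable_compose[OF this measurable_component_singleton[OF assms(1)]] show ?thesis
    using assms(1) by simp
qed

lemma measurable_ident_process_algebra:
  assumes "space N = space M" "\<And>i. i \<in> I \<Longrightarrow> Y i \<in> measurable N S"
  shows "(\<lambda>\<omega>. \<omega>) \<in> measurable N (process_algebra M I S Y)"
  unfolding process_algebra_def using assms
  by (intro measurable_vimage_algebra2 measurable_restrict) auto

lemma sets_process_algebra_subset:
  assumes "space N = space M" "\<And>i. i \<in> I \<Longrightarrow> Y i \<in> measurable N S"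
  shows "sets (process_algebra M I S Y) \<subseteq> sets N"
proof
  fix B assume B: "B \<in> sets (process_algebra M I S Y)"
  have "(\<lambda>\<omega>. \<omega>) -` B \<inter> space N \<in> sets N"
    by (rule measurable_sets[OF measurable_ident_process_algebra B]) (use assms in auto)
  moreover have "(\<lambda>\<omega>. \<omega>) -` B \<inter> space N = B"
    using sets.sets_into_space[OF B] assms(1) by auto
  ultimately show "B \<in> sets N" by simp
qed

section \<open>Dyadic approximation from above\<close>

lemma floor_double_le: "\<lfloor>2 * a\<rfloor> \<le> 2 * \<lfloor>a\<rfloor> + 1" for a :: real
proof -
  have "a < of_int \<lfloor>a\<rfloor> + 1" by linarith
  then have "2 * a < of_int (2 * \<lfloor>a\<rfloor> + 2)"
    unfolding of_int_add of_int_mult of_int_numeral by linarith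
  then have "\<lfloor>2 * a\<rfloor> < 2 * \<lfloor>a\<rfloor> + 2"
    by (simp only: floor_less_iff)
  then show ?thesis by simp
qed

text \<open>Strictly above \<open>t\<close>, so that it serves for limits from the right; its
  countably many values reduce a random argument to deterministic ones.\<close>

definition dyadic_above :: "nat \<Rightarrow> real \<Rightarrow> real" where
  "dyadic_above k t = (of_int \<lfloor>2 ^ k * t\<rfloor> + 1) / 2 ^ k"

lemma dyadic_above_gt: "t < dyadic_above k t"
  unfolding dyadic_above_def by (simp add: pos_less_divide_eq mult.commute)

lemma dyadic_above_le: "dyadic_above k t \<le> t + (1 / 2) ^ k"
proof -
  have "dyadic_above k t \<le> (2 ^ k * t + 1) / 2 ^ k"
    unfolding dyadic_above_def by (intro divide_right_mono) (auto simp: of_int_floor_le)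
  also have "\<dots> = t + (1 / 2) ^ k" by (simp add: field_simps power_divide)
  finally show ?thesis .
qed

lemma dyadic_above_tendsto: "(\<lambda>k. dyadic_above k t) \<longlonglongrightarrow> t"
proof -
  have "(\<lambda>k. t + (1 / 2) ^ k) \<longlonglongrightarrow> t + 0"
    by (intro tendsto_intros LIMSEQ_realpow_zero) auto
  then have "(\<lambda>k. t + (1 / 2) ^ k) \<longlonglongrightarrow> t" by simp
  then show ?thesis
  proof (rule tendsto_sandwich[OF _ _ tendsto_const, rotated 2])
    show "\<forall>\<^sub>F k in sequentially. t \<le> dyadic_above k t"
      by (simp add: less_imp_le[OF dyadic_above_gt])
    show "\<forall>\<^sub>F k in sequentially. dyadic_above k t \<le> t + (1 / 2) ^ k"
      by (simp only: dyadic_above_le eventually_True)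
  qed
qed

lemma dyadic_above_decseq: "decseq (\<lambda>k. dyadic_above k t)"
proof (rule decseq_SucI)
  fix k
  have "real_of_int \<lfloor>2 * (2 ^ k * t)\<rfloor> \<le> real_of_int (2 * \<lfloor>2 ^ k * t\<rfloor> + 1)"
    by (rule of_int_le_iff[THEN iffD2, OF floor_double_le])
  then show "dyadic_above (Suc k) t \<le> dyadic_above k t"
    unfolding dyadic_above_def
    using mult_left_mono[of _ _ "2 ^ k :: real"] by (fastforce simp: field_simps)
qed

text \<open>A bound for deterministic thresholds extends to thresholds measurable in the conditioning
  algebra, by approximating the threshold from above by countably many values.\<close>

lemma (in finite_measure) random_threshold:
  fixes S W H :: "_ \<Rightarrow> real"
  assumes N: "space N = space M" "sets N \<subseteq> sets M"
    and B: "B \<in> sets N" and W: "W \<in> borel_measurable N"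
    and S [measurable]: "S \<in> borel_measurable M"
    and H: "antimono H" and c: "0 \<le> c"
    and le: "\<And>B' y. B' \<in> sets N \<Longrightarrow> B' \<subseteq> B \<Longrightarrow>
      measure M (B' \<inter> {\<omega> \<in> space M. y < S \<omega>}) \<le> c * H y * measure M B'"
  shows "emeasure M (B \<inter> {\<omega> \<in> space M. W \<omega> < S \<omega>}) \<le> ennreal c * (\<integral>\<^sup>+\<omega>\<in>B. ennreal (H (W \<omega>)) \<partial>M)"
proof -
  have BM [measurable]: "B \<in> sets M" using B N by auto
  have WM [measurable]: "W \<in> borel_measurable M"
    using measurable_mono[of borel borel N M] N W by auto
  have [measurable]: "H \<in> borel_measurable borel"
  proof -
    have "mono (\<lambda>x. - H x)" using H by (auto simp: mono_def antimono_def)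
    then have "(\<lambda>x. - (- H x)) \<in> borel_measurable borel"
      by (intro borel_measurable_uminus borel_measurable_mono)
    then show ?thesis by simp
  qed
  \<comment> \<open>Weighting \<open>M\<close> by the bound turns the right-hand side into a
    measure, so estimates on disjoint pieces add up by countable additivity.\<close>
  define D where "D = density M (\<lambda>\<omega>. ennreal (H (W \<omega>)))"
  have eD: "emeasure D B' = (\<integral>\<^sup>+\<omega>\<in>B'. ennreal (H (W \<omega>)) \<partial>M)" if "B' \<in> sets M" for B'
    using that by (simp add: D_def emeasure_density)
  have *: "emeasure M (B \<inter> {\<omega> \<in> space M. dyadic_above k (W \<omega>) < S \<omega>}) \<le> ennreal c * emeasure D B" for k
  proof -
    \<comment> \<open>On each piece the rounded threshold is the constant \<open>v m\<close>, and
      the piece lies in \<open>N\<close> because \<open>W\<close> is \<open>N\<close>-measurable; so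
      the assumption on deterministic thresholds applies to it.\<close>
    define Bm where "Bm m = B \<inter> {\<omega> \<in> space N. \<lfloor>2 ^ k * W \<omega>\<rfloor> = m}" for m :: int
    define v where "v m = (of_int m + 1) / (2 ^ k :: real)" for m :: int
    have BmN: "Bm m \<in> sets N" for m
      unfolding Bm_def using B W by measurable
    then have BmM [measurable]: "Bm m \<in> sets M" for m using N by auto
    have disj: "disjoint_family Bm" by (auto simp: disjoint_family_on_def Bm_def)
    have BU: "B = (\<Union>m. Bm m)" using sets.sets_into_space[OF B] by (auto simp: Bm_def)
    have eq: "B \<inter> {\<omega> \<in> space M. dyadic_above k (W \<omega>) < S \<omega>} =
        (\<Union>m. Bm m \<inter> {\<omega> \<in> space M. v m < S \<omega>})"
      using N by (auto simp: Bm_def v_def dyadic_above_def)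
    have each: "emeasure M (Bm m \<inter> {\<omega> \<in> space M. v m < S \<omega>}) \<le> ennreal c * emeasure D (Bm m)" for m
    proof -
      have "emeasure M (Bm m \<inter> {\<omega> \<in> space M. v m < S \<omega>}) \<le> ennreal (c * H (v m) * measure M (Bm m))"
        unfolding emeasure_eq_measure by (intro ennreal_leI le BmN) (auto simp: Bm_def)
      also have "\<dots> \<le> ennreal c * (ennreal (H (v m)) * emeasure M (Bm m))"
        using c by (cases "0 \<le> H (v m)")
          (auto simp: emeasure_eq_measure ennreal_mult ennreal_neg mult.assoc mult_nonpos_nonneg mult_nonneg_nonpos)
      also have "ennreal (H (v m)) * emeasure M (Bm m) = (\<integral>\<^sup>+\<omega>\<in>Bm m. ennreal (H (v m)) \<partial>M)"
        by (simp add: nn_integral_cmult_indicator)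
      also have "\<dots> \<le> emeasure D (Bm m)"
        unfolding eD[OF BmM]
      proof (intro nn_integral_mono)
        fix \<omega>
        have "H (v m) \<le> H (W \<omega>)" if "\<omega> \<in> Bm m"
          using that less_imp_le[OF dyadic_above_gt[of "W \<omega>" k]]
          by (intro antimonoD[OF H]) (auto simp: Bm_def v_def dyadic_above_def)
        then show "ennreal (H (v m)) * indicator (Bm m) \<omega> \<le> ennreal (H (W \<omega>)) * indicator (Bm m) \<omega>"
          by (auto simp: indicator_def intro!: ennreal_leI)
      qed
      finally show ?thesis by (simp add: mult_left_mono)
    qed
    have "emeasure M (B \<inter> {\<omega> \<in> space M. dyadic_above k (W \<omega>) < S \<omega>})
        = (\<integral>\<^sup>+m. emeasure M (Bm m \<inter> {\<omega> \<in> space M. v m < S \<omega>}) \<partial>count_space UNIV)"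
      unfolding eq using disj by (intro emeasure_UN_countable) (auto simp: disjoint_family_on_def)
    also have "\<dots> \<le> (\<integral>\<^sup>+m. ennreal c * emeasure D (Bm m) \<partial>count_space UNIV)"
      by (intro nn_integral_mono each)
    also have "\<dots> = ennreal c * (\<integral>\<^sup>+m. emeasure D (Bm m) \<partial>count_space UNIV)"
      by (rule nn_integral_cmult) auto
    also have "(\<integral>\<^sup>+m. emeasure D (Bm m) \<partial>count_space UNIV) = emeasure D (\<Union>m. Bm m)"
      using disj by (intro emeasure_UN_countable[symmetric]) (auto simp: D_def)
    finally show ?thesis by (simp flip: BU)
  qed
  \<comment> \<open>The rounded thresholds decrease to \<open>W\<close>, so the events increase and
    continuity from below gives the limit.\<close>
  have "incseq (\<lambda>k. B \<inter> {\<omega> \<in> space M. dyadic_above k (W \<omega>) < S \<omega>})"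
    using dyadic_above_decseq by (fastforce simp: incseq_def decseq_def intro: le_less_trans)
  moreover have "range (\<lambda>k. B \<inter> {\<omega> \<in> space M. dyadic_above k (W \<omega>) < S \<omega>}) \<subseteq> sets M"
    unfolding dyadic_above_def by auto
  ultimately have "(SUP k. emeasure M (B \<inter> {\<omega> \<in> space M. dyadic_above k (W \<omega>) < S \<omega>}))
      = emeasure M (\<Union>k. B \<inter> {\<omega> \<in> space M. dyadic_above k (W \<omega>) < S \<omega>})"
    by (intro SUP_emeasure_incseq)
  also have "(\<Union>k. B \<inter> {\<omega> \<in> space M. dyadic_above k (W \<omega>) < S \<omega>})
      = B \<inter> {\<omega> \<in> space M. W \<omega> < S \<omega>}"
  proof -
    have "\<exists>k. dyadic_above k w < s" if "w < s" for w s
      using eventually_happens[OF order_tendstoD(2)[OF dyadic_above_tendsto that]] by auto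
    then show ?thesis
      using dyadic_above_gt less_trans by (auto; blast)
  qed
  finally have "emeasure M (B \<inter> {\<omega> \<in> space M. W \<omega> < S \<omega>}) =
      (SUP k. emeasure M (B \<inter> {\<omega> \<in> space M. dyadic_above k (W \<omega>) < S \<omega>}))" by simp
  also have "\<dots> \<le> ennreal c * emeasure D B"
    by (intro SUP_least *)
  finally show ?thesis by (simp add: eD)
qed

section \<open>Sums of regression dependent claims\<close>

text \<open>Regression dependence is kept integrated over events of the conditioning algebra, which
  avoids versions of conditional probabilities. Thanks to \<open>K_ge_1\<close> it includes empty
  \<open>J\<close>, where it only concerns the law of a single claim.\<close>

locale regression_dependent_seq = M: prob_space M + law: subexponential_law G
  for M :: "'a measure" and G +
  fixes Y :: "nat \<Rightarrow> 'a \<Rightarrow> real" and x0 K :: real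
  assumes Y_measurable [measurable]: "1 \<le> i \<Longrightarrow> Y i \<in> borel_measurable M"
    and Y_distr: "1 \<le> i \<Longrightarrow> distr M borel (Y i) = G"
    and K_ge_1: "1 \<le> K"
    and rd: "finite J \<Longrightarrow> J \<subseteq> {1..} \<Longrightarrow> 1 \<le> i \<Longrightarrow> i \<notin> J \<Longrightarrow> x0 < y \<Longrightarrow>
      B \<in> sets (process_algebra M J borel Y) \<Longrightarrow> B \<subseteq> {\<omega>. \<forall>j\<in>J. x0 < Y j \<omega>} \<Longrightarrow>
      measure M (B \<inter> {\<omega> \<in> space M. y < Y i \<omega>}) \<le> K * tail G y * measure M B"
begin

lemma Y_AE_nonneg:
  assumes "1 \<le> i" shows "AE \<omega> in M. 0 \<le> Y i \<omega>"
proof -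
  have "AE x in distr M borel (Y i). 0 \<le> x"
    unfolding Y_distr[OF assms] by (rule law.AE_nonneg)
  then show ?thesis using assms by (subst (asm) AE_distr_iff) auto
qed

lemma AE_all_nonneg: "AE \<omega> in M. \<forall>i\<ge>1. 0 \<le> Y i \<omega>"
  using Y_AE_nonneg by (simp add: AE_all_countable)

lemma measure_Y:
  assumes "1 \<le> i" "B \<in> sets borel"
  shows "measure M {\<omega> \<in> space M. Y i \<omega> \<in> B} = measure G B"
  using assms unfolding Y_distr[OF assms(1), symmetric]
  by (subst measure_distr) (auto intro!: arg_cong[of _ _ "measure M"])

lemma prob_Y_gt: "1 \<le> i \<Longrightarrow> measure M {\<omega> \<in> space M. y < Y i \<omega>} = tail G y"
  using measure_Y[of i "{y<..}"] by (simp add: law.tail_alt)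

lemma PA_coord: "j \<in> J \<Longrightarrow> Y j \<in> borel_measurable (process_algebra M J borel Y)"
  by (rule measurable_process_algebra_coord) auto

lemma PA_sub:
  assumes "J \<subseteq> {1..}"
  shows "sets (process_algebra M J borel Y) \<subseteq> sets M"
  using assms by (intro sets_process_algebra_subset) (auto intro!: Y_measurable)

lemma PA_mono:
  assumes "J \<subseteq> J'"
  shows "sets (process_algebra M J borel Y) \<subseteq> sets (process_algebra M J' borel Y)"
  using assms by (intro sets_process_algebra_subset PA_coord) auto

text \<open>The analogue of \<open>rd\<close> for a sum in place of a single claim. It is required
  at every level \<open>y\<close>, so that it can be applied at random thresholds.\<close>

definition bounds :: "nat set \<Rightarrow> ('a \<Rightarrow> real) \<Rightarrow> real \<Rightarrow> bool" where
  "bounds J S c \<longleftrightarrow> (\<forall>B y. B \<in> sets (process_algebra M J borel Y) \<longrightarrow> B \<subseteq> {\<omega>. \<forall>j\<in>J. x0 < Y j \<omega>} \<longrightarrow>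
     measure M (B \<inter> {\<omega> \<in> space M. y < S \<omega>}) \<le> c * tail G y * measure M B)"

text \<open>Two decouplings. Conditioning on \<open>J\<close> and \<open>Y i\<close> replaces
  \<open>S\<close> by an independent variable of law \<open>G\<close>, at cost \<open>c\<close>;
  Fubini then fixes that variable, and conditioning on \<open>J\<close> alone replaces
  \<open>Y i\<close>, at cost \<open>K\<close>.\<close>

lemma both_large_bound:
  assumes J: "finite J" "J \<subseteq> {1..}" "1 \<le> i" "i \<notin> J"
    and S [measurable]: "S \<in> borel_measurable M"
    and c: "0 \<le> c" "bounds (insert i J) S c" and a: "x0 < a"
    and B: "B \<in> sets (process_algebra M J borel Y)" "B \<subseteq> {\<omega>. \<forall>j\<in>J. x0 < Y j \<omega>}"
  shows "measure M (B \<inter> {\<omega> \<in> space M. a < Y i \<omega> \<and> a < S \<omega> \<and> y < S \<omega> + Y i \<omega>})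
    \<le> c * K * joint_tail G a y * measure M B"
proof -
  let ?N = "process_algebra M (insert i J) borel Y"
  have [measurable]: "Y i \<in> borel_measurable M" using J by simp
  have NM: "sets ?N \<subseteq> sets M" using J by (intro PA_sub) auto
  have BM [measurable]: "B \<in> sets M" using B PA_sub[OF J(2)] by auto
  have YN: "Y i \<in> borel_measurable ?N" by (intro PA_coord) auto
  have spN: "space ?N = space M" by simp
  \<comment> \<open>The restriction to \<open>a < Y i\<close> puts \<open>Y i\<close> above
    \<open>x0\<close>, as conditioning on it requires.\<close>
  define B' where "B' = B \<inter> {\<omega> \<in> space M. a < Y i \<omega>}"
  have B'N: "B' \<in> sets ?N"
  proof -
    have "{\<omega> \<in> space ?N. a < Y i \<omega>} \<in> sets ?N" using YN by measurable
    moreover have "B \<in> sets ?N" using B PA_mono[of J "insert i J"] by auto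
    ultimately show ?thesis unfolding B'_def spN by blast
  qed
  have B'M [measurable]: "B' \<in> sets M" using B'N NM by auto
  \<comment> \<open>Given \<open>Y i\<close>, both conditions on \<open>S\<close> amount to
    exceeding this threshold, which is measurable in the conditioning algebra.\<close>
  define W where "W \<omega> = max a (y - Y i \<omega>)" for \<omega>
  have WN: "W \<in> borel_measurable ?N" unfolding W_def using YN by measurable
  have WM [measurable]: "W \<in> borel_measurable M" unfolding W_def by measurable
  have eq: "B \<inter> {\<omega> \<in> space M. a < Y i \<omega> \<and> a < S \<omega> \<and> y < S \<omega> + Y i \<omega>}
      = B' \<inter> {\<omega> \<in> space M. W \<omega> < S \<omega>}"
    by (auto simp: B'_def W_def)
  have 1: "emeasure M (B' \<inter> {\<omega> \<in> space M. W \<omega> < S \<omega>})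
      \<le> ennreal c * (\<integral>\<^sup>+\<omega>\<in>B'. ennreal (tail G (W \<omega>)) \<partial>M)"
  proof (rule M.random_threshold[OF spN NM B'N WN S _ c(1)])
    show "antimono (tail G)" by (auto simp: antimono_def law.tail_mono)
    fix C y assume C: "C \<in> sets ?N" "C \<subseteq> B'"
    then have "C \<subseteq> {\<omega>. \<forall>j\<in>insert i J. x0 < Y j \<omega>}"
      using B(2) a by (auto simp: B'_def)
    then show "measure M (C \<inter> {\<omega> \<in> space M. y < S \<omega>}) \<le> c * tail G y * measure M C"
      using c(2) C by (auto simp: bounds_def)
  qed
  have 2: "(\<integral>\<^sup>+\<omega>\<in>B'. ennreal (tail G (W \<omega>)) \<partial>M) \<le> ennreal (K * joint_tail G a y * measure M B)"
  proof -
    \<comment> \<open>The second coordinate is the independent copy that has replaced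
      \<open>S\<close>.\<close>
    let ?E = "{p \<in> space (M \<Otimes>\<^sub>M G). fst p \<in> B' \<and> W (fst p) < snd p}"
    have E [measurable]: "?E \<in> sets (M \<Otimes>\<^sub>M G)" by measurable
    interpret MG: pair_sigma_finite M G ..
    have "(\<integral>\<^sup>+\<omega>\<in>B'. ennreal (tail G (W \<omega>)) \<partial>M) = (\<integral>\<^sup>+\<omega>. emeasure G (Pair \<omega> -` ?E) \<partial>M)"
    proof (intro nn_integral_cong)
      fix \<omega> assume "\<omega> \<in> space M"
      then have "Pair \<omega> -` ?E = (if \<omega> \<in> B' then {W \<omega><..} else {})"
        by (auto simp: space_pair_measure)
      then show "ennreal (tail G (W \<omega>)) * indicator B' \<omega> = emeasure G (Pair \<omega> -` ?E)"
        by (simp add: law.tail_alt law.emeasure_eq_measure)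
    qed
    also have "\<dots> = emeasure (M \<Otimes>\<^sub>M G) ?E"
      by (rule law.emeasure_pair_measure_alt[symmetric]) fact
    also have "\<dots> = (\<integral>\<^sup>+z. emeasure M ((\<lambda>\<omega>. (\<omega>, z)) -` ?E) \<partial>G)"
      by (rule MG.emeasure_pair_measure_alt2) fact
    also have "\<dots> \<le> (\<integral>\<^sup>+z. ennreal (K * measure M B) *
        emeasure G (Pair z -` {p. a < fst p \<and> a < snd p \<and> y < fst p + snd p}) \<partial>G)"
    proof (intro nn_integral_mono)
      fix z
      have e1: "(\<lambda>\<omega>. (\<omega>, z)) -` ?E \<subseteq> (if a < z then B \<inter> {\<omega> \<in> space M. max a (y - z) < Y i \<omega>} else {})"
        by (auto simp: space_pair_measure B'_def W_def)
      have e2: "Pair z -` {p. a < fst p \<and> a < snd p \<and> y < fst p + snd p}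
          = (if a < z then {max a (y - z)<..} else {})" by auto
      show "emeasure M ((\<lambda>\<omega>. (\<omega>, z)) -` ?E) \<le> ennreal (K * measure M B) *
          emeasure G (Pair z -` {p. a < fst p \<and> a < snd p \<and> y < fst p + snd p})"
      proof (cases "a < z")
        case True
        have "emeasure M ((\<lambda>\<omega>. (\<omega>, z)) -` ?E) \<le> emeasure M (B \<inter> {\<omega> \<in> space M. max a (y - z) < Y i \<omega>})"
          using e1 True by (intro emeasure_mono) auto
        also have "\<dots> \<le> ennreal (K * tail G (max a (y - z)) * measure M B)"
          unfolding M.emeasure_eq_measure
          using rd[OF J(1,2,3,4) _ B, of "max a (y - z)"] a by (intro ennreal_leI) auto
        also have "\<dots> = ennreal (K * measure M B) * ennreal (tail G (max a (y - z)))"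
          using K_ge_1 law.tail_nonneg by (simp add: ennreal_mult[symmetric] mult_ac)
        finally show ?thesis unfolding e2 using True by (simp add: law.tail_alt law.emeasure_eq_measure)
      next
        case False
        then have "(\<lambda>\<omega>. (\<omega>, z)) -` ?E = {}" using e1 by auto
        then show ?thesis by (simp only: emeasure_empty zero_le)
      qed
    qed
    also have "\<dots> = ennreal (K * measure M B) * (\<integral>\<^sup>+z.
        emeasure G (Pair z -` {p. a < fst p \<and> a < snd p \<and> y < fst p + snd p}) \<partial>G)"
      by (intro nn_integral_cmult law.measurable_emeasure_Pair) auto
    also have "(\<integral>\<^sup>+z. emeasure G (Pair z -` {p. a < fst p \<and> a < snd p \<and> y < fst p + snd p}) \<partial>G)
        = emeasure (G \<Otimes>\<^sub>M G) {p. a < fst p \<and> a < snd p \<and> y < fst p + snd p}"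
      by (intro law.emeasure_pair_measure_alt[symmetric]) auto
    also have "\<dots> = ennreal (joint_tail G a y)"
      by (simp add: joint_tail_def law.GG.P.emeasure_eq_measure)
    also have "ennreal (K * measure M B) * ennreal (joint_tail G a y) = ennreal (K * joint_tail G a y * measure M B)"
      using K_ge_1 law.joint_tail_nonneg by (simp add: ennreal_mult[symmetric] mult_ac)
    finally show ?thesis .
  qed
  have "ennreal (measure M (B' \<inter> {\<omega> \<in> space M. W \<omega> < S \<omega>})) \<le> ennreal c * ennreal (K * joint_tail G a y * measure M B)"
    using order_trans[OF 1 mult_left_mono[OF 2]] by (simp add: M.emeasure_eq_measure)
  also have "\<dots> = ennreal (c * K * joint_tail G a y * measure M B)"
    using c K_ge_1 law.joint_tail_nonneg by (simp add: ennreal_mult[symmetric] mult_ac)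
  finally show ?thesis
    unfolding eq using c K_ge_1 law.joint_tail_nonneg by (simp add: ennreal_le_iff)
qed

section \<open>Kesten's bound for unweighted sums\<close>

definition partial_sum :: "nat \<Rightarrow> 'a \<Rightarrow> real" where
  "partial_sum n \<omega> = (\<Sum>i=1..n. Y i \<omega>)"

lemma partial_sum_measurable [measurable]: "partial_sum n \<in> borel_measurable M"
  unfolding partial_sum_def [abs_def] by (intro borel_measurable_sum Y_measurable) auto

lemma partial_sum_Suc: "partial_sum (Suc n) \<omega> = partial_sum n \<omega> + Y (Suc n) \<omega>"
  by (simp add: partial_sum_def)

text \<open>The bound is proved conditionally on any finite set of later claims exceeding \<open>x0\<close>, since
  the induction step conditions on the last summand.\<close>

theorem kesten:
  assumes e: "0 < e" "e \<le> 1"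
  obtains C where "0 < C"
    "\<And>n J. finite J \<Longrightarrow> J \<subseteq> {Suc n..} \<Longrightarrow> bounds J (partial_sum n) (C * (1 + 2 * e) ^ n)"
proof -
  \<comment> \<open>The level \<open>e / K\<close> absorbs the factor \<open>K\<close> of
    \<open>both_large_bound\<close>.\<close>
  obtain a where a: "x0 < a" "0 < a" "\<forall>\<^sub>F y in at_top. joint_tail G a y \<le> (e / K) * tail G y"
    using law.joint_tail_small[of "e / K" "max x0 0"] e K_ge_1 by auto
  have "\<forall>\<^sub>F y in at_top. joint_tail G a y \<le> (e / K) * tail G y \<and> tail G (y - a) \<le> (1 + e) * tail G y"
    using a(3) law.long_tail_le[of a e] a e by (auto elim: eventually_elim2)
  then obtain y1' where "\<forall>y\<ge>y1'. joint_tail G a y \<le> (e / K) * tail G y \<and> tail G (y - a) \<le> (1 + e) * tail G y"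
    by (auto simp: eventually_at_top_linorder)
  then obtain y1 where y1: "0 < y1" "a + x0 < y1"
    "\<And>y. y1 \<le> y \<Longrightarrow> joint_tail G a y \<le> (e / K) * tail G y"
    "\<And>y. y1 \<le> y \<Longrightarrow> tail G (y - a) \<le> (1 + e) * tail G y"
    by (intro that[of "max y1' (max 1 (a + x0 + 1))"]) auto
  \<comment> \<open>\<open>al\<close> solves the recursion \<open>al_Suc\<close>, whose fixed point
    is \<open>- K / e\<close>, with initial value \<open>1 / tail G y1\<close>. This value makes the
    claim trivial at levels \<open>y \<le> y1\<close>, where the asymptotic estimates say
    nothing.\<close>
  define C where "C = 1 / tail G y1 + K / e"
  define al where "al n = C * (1 + 2 * e) ^ n - K / e" for n
  have C: "0 < C" using law.tail_pos[of y1] e K_ge_1 by (auto simp: C_def intro!: add_pos_nonneg)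
  have al_ge: "1 / tail G y1 \<le> al n" for n
  proof -
    have "C * 1 \<le> C * (1 + 2 * e) ^ n"
      using C e by (intro mult_left_mono one_le_power) auto
    then show ?thesis by (simp add: al_def C_def)
  qed
  have al_nn: "0 \<le> al n" for n
    using al_ge[of n] law.tail_nonneg[of y1] order_trans[of 0 "1 / tail G y1"] by simp
  have al_Suc: "(1 + 2 * e) * al n + 2 * K = al (Suc n)" for n
    using e by (simp add: al_def field_simps)
  have small: "measure M (B \<inter> {\<omega> \<in> space M. y < S \<omega>}) \<le> al n * tail G y * measure M B"
    if "y \<le> y1" "B \<in> sets M" for S B y n
  proof -
    have "1 \<le> al n * tail G y"
    proof -
      have "1 = (1 / tail G y1) * tail G y1" using law.tail_pos[of y1] by simp
      also have "\<dots> \<le> al n * tail G y"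
        using al_ge al_nn law.tail_mono that law.tail_nonneg by (intro mult_mono) auto
      finally show ?thesis .
    qed
    then have "1 * measure M B \<le> al n * tail G y * measure M B"
      by (intro mult_right_mono) auto
    moreover have "measure M (B \<inter> {\<omega> \<in> space M. y < S \<omega>}) \<le> measure M B"
      using that by (intro M.finite_measure_mono) auto
    ultimately show ?thesis by simp
  qed
  have main: "bounds J (partial_sum n) (al n)" if "finite J" "J \<subseteq> {Suc n..}" for n J
    using that
  proof (induction n arbitrary: J)
    case 0
    have "B \<in> sets (process_algebra M J borel Y) \<Longrightarrow> B \<in> sets M" for B
      using PA_sub[of J] 0 by auto
    then show ?case
      unfolding bounds_def
    proof (intro allI impI)
      fix B y assume "B \<in> sets (process_algebra M J borel Y)"
        and *: "\<And>B. B \<in> sets (process_algebra M J borel Y) \<Longrightarrow> B \<in> sets M"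
      then have "B \<in> sets M" by auto
      then show "measure M (B \<inter> {\<omega> \<in> space M. y < partial_sum 0 \<omega>}) \<le> al 0 * tail G y * measure M B"
        using small[of y B "partial_sum 0" 0] y1 al_nn[of 0] law.tail_nonneg[of y]
        by (cases "y \<le> y1") (auto simp: partial_sum_def)
    qed
  next
    case (Suc n)
    let ?i = "Suc n"
    have J: "finite J" "J \<subseteq> {1..}" "1 \<le> ?i" "?i \<notin> J" using Suc.prems by auto
    show ?case
      unfolding bounds_def
    proof (intro allI impI)
      fix B y assume B: "B \<in> sets (process_algebra M J borel Y)" "B \<subseteq> {\<omega>. \<forall>j\<in>J. x0 < Y j \<omega>}"
      have BM [measurable]: "B \<in> sets M" using B PA_sub[OF J(2)] by auto
      have [measurable]: "Y ?i \<in> borel_measurable M" by simp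
      show "measure M (B \<inter> {\<omega> \<in> space M. y < partial_sum (Suc n) \<omega>}) \<le> al (Suc n) * tail G y * measure M B"
      proof (cases "y \<le> y1")
        case False
        \<comment> \<open>If neither the new claim nor the old sum exceeds \<open>y - a\<close>,
          each must exceed \<open>a\<close> for the total to exceed \<open>y\<close>.\<close>
        let ?E1 = "B \<inter> {\<omega> \<in> space M. y - a < Y ?i \<omega>}"
          and ?E2 = "B \<inter> {\<omega> \<in> space M. y - a < partial_sum n \<omega>}"
          and ?E3 = "B \<inter> {\<omega> \<in> space M. a < Y ?i \<omega> \<and> a < partial_sum n \<omega> \<and> y < partial_sum n \<omega> + Y ?i \<omega>}"
        have "measure M ?E1 \<le> K * tail G (y - a) * measure M B"
          using False y1 by (intro rd[OF J _ B]) auto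
        also have "\<dots> \<le> K * ((1 + e) * tail G y) * measure M B"
          using False y1(4)[of y] K_ge_1 by (intro mult_right_mono mult_left_mono) auto
        finally have 1: "measure M ?E1 \<le> K * ((1 + e) * tail G y) * measure M B" .
        have "measure M ?E2 \<le> al n * tail G (y - a) * measure M B"
          using Suc.IH[of J] Suc.prems B unfolding bounds_def by (auto simp: atLeast_Suc)
        also have "\<dots> \<le> al n * ((1 + e) * tail G y) * measure M B"
          using False y1(4)[of y] al_nn by (intro mult_right_mono mult_left_mono) auto
        finally have 2: "measure M ?E2 \<le> al n * ((1 + e) * tail G y) * measure M B" .
        \<comment> \<open>Here the induction hypothesis is used with the new claim among the
          conditions.\<close>
        have "bounds (insert ?i J) (partial_sum n) (al n)"
          using Suc.prems by (intro Suc.IH) (auto simp: atLeast_Suc)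
        then have "measure M ?E3 \<le> al n * K * joint_tail G a y * measure M B"
          using a by (intro both_large_bound[OF J _ al_nn _ _ B]) auto
        also have "\<dots> \<le> al n * K * ((e / K) * tail G y) * measure M B"
          using False y1(3)[of y] al_nn K_ge_1 by (intro mult_right_mono mult_left_mono) auto
        also have "\<dots> = al n * e * tail G y * measure M B"
          using K_ge_1 by simp
        finally have 3: "measure M ?E3 \<le> al n * e * tail G y * measure M B" .
        have "measure M (B \<inter> {\<omega> \<in> space M. y < partial_sum (Suc n) \<omega>}) \<le> measure M (?E1 \<union> ?E2 \<union> ?E3)"
          by (intro M.finite_measure_mono) (auto simp: partial_sum_Suc)
        also have "\<dots> \<le> measure M (?E1 \<union> ?E2) + measure M ?E3"
          by (intro measure_Un_le) auto
        also have "\<dots> \<le> measure M ?E1 + measure M ?E2 + measure M ?E3"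
          by (intro add_right_mono measure_Un_le) auto
        also have "\<dots> \<le> (K * (1 + e) + al n * (1 + e) + al n * e) * tail G y * measure M B"
          using 1 2 3 by (simp add: algebra_simps)
        also have "\<dots> \<le> al (Suc n) * tail G y * measure M B"
        proof -
          \<comment> \<open>The term \<open>2 * K\<close> of the recursion dominates the share
            \<open>K * (1 + e)\<close> of the new claim.\<close>
          have "K * e \<le> K * 1" using e K_ge_1 by (intro mult_left_mono) auto
          then have "K * (1 + e) + al n * (1 + e) + al n * e \<le> al (Suc n)"
            unfolding al_Suc[symmetric] by (simp add: algebra_simps)
          then show ?thesis using law.tail_nonneg by (intro mult_right_mono) auto
        qed
        finally show ?thesis .
      qed (use small BM in auto)
    qed
  qed
  have "bounds J (partial_sum n) (C * (1 + 2 * e) ^ n)" if "finite J" "J \<subseteq> {Suc n..}" for n J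
  proof -
    have "al n \<le> C * (1 + 2 * e) ^ n" using e K_ge_1 by (simp add: al_def)
    then have "al n * tail G y * measure M B \<le> C * (1 + 2 * e) ^ n * tail G y * measure M B" for y B
      using law.tail_nonneg by (intro mult_right_mono) auto
    then show ?thesis using main[OF that] unfolding bounds_def by (meson order_trans)
  qed
  with C show thesis by (rule that)
qed

section \<open>Sums and maxima with deterministic weights\<close>

lemma prob_scaled: "1 \<le> i \<Longrightarrow> measure M {\<omega> \<in> space M. x < w * Y i \<omega>} = law.scaled_tail w x"
  using measure_Y[of i "{z. x < w * z}"] by (simp add: law.scaled_tail_def)

lemma bounds_empty:
  assumes "bounds {} S c"
  shows "measure M {\<omega> \<in> space M. y < S \<omega>} \<le> c * tail G y"
proof -
  have "space M \<in> sets (process_algebra M {} borel Y)"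
    using sets.top[of "process_algebra M {} borel Y"] by simp
  then have "measure M (space M \<inter> {\<omega> \<in> space M. y < S \<omega>}) \<le> c * tail G y * measure M (space M)"
    using assms by (auto simp: bounds_def)
  then show ?thesis by (simp add: M.prob_space Int_absorb1 Collect_restrict)
qed

lemma weighted_sum_measurable [measurable]:
  "(\<lambda>\<omega>. \<Sum>i=1..n. w i * Y i \<omega>) \<in> borel_measurable M"
  by (intro borel_measurable_sum borel_measurable_times) auto

lemma weighted_sum_le:
  assumes w: "\<And>i. i \<in> {1..n} \<Longrightarrow> w i \<le> w 1" and Y: "\<forall>i\<ge>1. 0 \<le> Y i \<omega>"
  shows "(\<Sum>i=1..n. w i * Y i \<omega>) \<le> w 1 * partial_sum n \<omega>"
  unfolding partial_sum_def sum_distrib_left using Y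
  by (intro sum_mono mult_right_mono w) auto

text \<open>All weights are replaced by the largest, \<open>w 1\<close>, which then only rescales
  the level. If it vanishes, or there is no term, the sum is 0.\<close>

lemma weighted_kesten:
  assumes c: "bounds {} (partial_sum n) c" "0 \<le> c" and x: "0 \<le> x"
    and w: "\<And>i. i \<in> {1..n} \<Longrightarrow> 0 \<le> w i" "\<And>i. i \<in> {1..n} \<Longrightarrow> w i \<le> w 1"
  shows "measure M {\<omega> \<in> space M. x < (\<Sum>i=1..n. w i * Y i \<omega>)} \<le> c * law.scaled_tail (w 1) x"
proof (cases "1 \<le> n \<and> 0 < w 1")
  case True
  have "measure M {\<omega> \<in> space M. x < (\<Sum>i=1..n. w i * Y i \<omega>)}
      \<le> measure M {\<omega> \<in> space M. x / w 1 < partial_sum n \<omega>}"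
  proof (intro M.finite_measure_mono_AE)
    show "AE \<omega> in M. \<omega> \<in> {\<omega> \<in> space M. x < (\<Sum>i=1..n. w i * Y i \<omega>)} \<longrightarrow>
        \<omega> \<in> {\<omega> \<in> space M. x / w 1 < partial_sum n \<omega>}"
      using AE_all_nonneg
    proof eventually_elim
      case (elim \<omega>)
      show ?case
        using weighted_sum_le[of n w, OF w(2) elim] True by (auto simp: field_simps)
    qed
  qed measurable
  also have "\<dots> \<le> c * tail G (x / w 1)" by (rule bounds_empty[OF c(1)])
  finally show ?thesis using True by (simp add: law.scaled_tail_eq)
next
  case False
  then have "\<And>i. i \<in> {1..n} \<Longrightarrow> w i = 0"
    using w by (metis antisym atLeastAtMost_iff not_le order_trans)
  then have "(\<Sum>i=1..n. w i * Y i \<omega>) = 0" for \<omega> by (intro sum.neutral) auto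
  then show ?thesis using x c law.scaled_tail_nonneg by simp
qed

text \<open>The three-way split of \<open>kesten\<close>, with the level lowered by \<open>a\<close>
  at each step. Where both parts are large the weights are discarded: as they are at most 1, the
  unweighted parts exceed \<open>a\<close> too, and the total exceeds \<open>u / w 1\<close> because
  \<open>w 1\<close> is the largest weight.\<close>

lemma weighted_sum_bound:
  assumes c: "0 \<le> c" "\<And>m J. m < n \<Longrightarrow> finite J \<Longrightarrow> J \<subseteq> {Suc m..} \<Longrightarrow> bounds J (partial_sum m) c"
    and a: "x0 < a" "0 \<le> a"
    and w: "0 < w 1" "w 1 \<le> 1" "\<And>i. i \<in> {1..n} \<Longrightarrow> 0 \<le> w i" "\<And>i. i \<in> {1..n} \<Longrightarrow> w i \<le> w 1"
    and m: "1 \<le> m" "m \<le> n"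
  shows "measure M {\<omega> \<in> space M. u < (\<Sum>i=1..m. w i * Y i \<omega>)} \<le>
    (\<Sum>i=1..m. law.scaled_tail (w i) (u - m * a)) + m * (c * K * joint_tail G a ((u - m * a) / w 1))"
  using m
proof (induction m arbitrary: u rule: dec_induct)
  case base
  have "measure M {\<omega> \<in> space M. u < (\<Sum>i=1..1. w i * Y i \<omega>)} = law.scaled_tail (w 1) u"
    by (simp add: prob_scaled)
  also have "\<dots> \<le> law.scaled_tail (w 1) (u - real 1 * a)"
    using a by (intro law.scaled_tail_antimono) auto
  finally show ?case
    using c K_ge_1 law.joint_tail_nonneg by (simp add: add_increasing2)
next
  case (step m)
  let ?S = "\<lambda>\<omega>. \<Sum>i=1..m. w i * Y i \<omega>" and ?i = "Suc m"
  let ?u = "u - real (Suc m) * a"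
  have [measurable]: "Y ?i \<in> borel_measurable M" by simp
  let ?E1 = "{\<omega> \<in> space M. u - a < w ?i * Y ?i \<omega>}"
    and ?E2 = "{\<omega> \<in> space M. u - a < ?S \<omega>}"
    and ?E3 = "{\<omega> \<in> space M. a < w ?i * Y ?i \<omega> \<and> a < ?S \<omega> \<and> u < ?S \<omega> + w ?i * Y ?i \<omega>}"
    and ?E4 = "{\<omega> \<in> space M. a < Y ?i \<omega> \<and> a < partial_sum m \<omega> \<and> u / w 1 < partial_sum m \<omega> + Y ?i \<omega>}"
  have 1: "measure M ?E1 \<le> law.scaled_tail (w ?i) ?u"
    using a by (simp add: prob_scaled) (intro law.scaled_tail_antimono, simp add: algebra_simps)
  have uu: "u - a - real m * a = ?u" by (simp add: algebra_simps)
  have 2: "measure M ?E2 \<le> (\<Sum>i=1..m. law.scaled_tail (w i) ?u) + m * (c * K * joint_tail G a (?u / w 1))"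
    using step.IH[of "u - a"] step.prems unfolding uu by simp
  have "measure M ?E3 \<le> measure M ?E4"
  proof (intro M.finite_measure_mono_AE)
    show "AE \<omega> in M. \<omega> \<in> ?E3 \<longrightarrow> \<omega> \<in> ?E4"
      using AE_all_nonneg
    proof eventually_elim
      case (elim \<omega>)
      have s: "?S \<omega> \<le> w 1 * partial_sum m \<omega>"
        using step.prems by (intro weighted_sum_le w elim) auto
      have p: "0 \<le> partial_sum m \<omega>" unfolding partial_sum_def using elim by (intro sum_nonneg) auto
      have "w 1 * partial_sum m \<omega> \<le> partial_sum m \<omega>" using p w by (simp add: mult_left_le_one_le)
      moreover have y: "w ?i * Y ?i \<omega> \<le> w 1 * Y ?i \<omega>" using elim w step.prems by (intro mult_right_mono) auto
      moreover have "w 1 * Y ?i \<omega> \<le> Y ?i \<omega>" using elim w by (simp add: mult_left_le_one_le)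
      ultimately show ?case using s w(1) by (auto simp: field_simps)
    qed
  qed measurable
  also have "\<dots> \<le> c * K * joint_tail G a (u / w 1)"
  proof -
    have "{} \<subseteq> {1::nat..}" "finite ({} :: nat set)" "?i \<notin> {}" by auto
    moreover have "bounds (insert ?i {}) (partial_sum m) c"
      using step by (intro c) auto
    moreover have "space M \<in> sets (process_algebra M {} borel Y)"
      using sets.top[of "process_algebra M {} borel Y"] by simp
    ultimately have "measure M (space M \<inter> ?E4) \<le> c * K * joint_tail G a (u / w 1) * measure M (space M)"
      using c(1) a by (intro both_large_bound) auto
    then show ?thesis by (simp add: M.prob_space Int_absorb1 Collect_restrict)
  qed
  also have "\<dots> \<le> c * K * joint_tail G a (?u / w 1)"
    using a c K_ge_1 w by (intro mult_left_mono law.joint_tail_mono divide_right_mono) auto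
  finally have 3: "measure M ?E3 \<le> c * K * joint_tail G a (?u / w 1)" .
  have "measure M {\<omega> \<in> space M. u < (\<Sum>i=1..Suc m. w i * Y i \<omega>)} \<le> measure M (?E1 \<union> ?E2 \<union> ?E3)"
    by (intro M.finite_measure_mono) auto
  also have "\<dots> \<le> measure M (?E1 \<union> ?E2) + measure M ?E3"
    by (intro measure_Un_le) measurable
  also have "\<dots> \<le> measure M ?E1 + measure M ?E2 + measure M ?E3"
    by (intro add_right_mono measure_Un_le) measurable
  finally show ?case using 1 2 3 by (simp add: algebra_simps)
qed

text \<open>\<open>L\<close> and \<open>X\<close> do not depend on the weights. The shift by
  \<open>L\<close> stays in the bound and is removed only after averaging over random
  weights.\<close>

lemma weighted_sum_upper:
  assumes e: "0 < e"
  obtains L X where "0 \<le> L" "L \<le> X"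
    "\<And>w x. 0 \<le> w 1 \<Longrightarrow> w 1 \<le> 1 \<Longrightarrow> (\<And>i. i \<in> {1..n} \<Longrightarrow> 0 \<le> w i) \<Longrightarrow> (\<And>i. i \<in> {1..n} \<Longrightarrow> w i \<le> w 1) \<Longrightarrow>
      X \<le> x \<Longrightarrow> measure M {\<omega> \<in> space M. x < (\<Sum>i=1..n. w i * Y i \<omega>)}
        \<le> (1 + e) * (\<Sum>i=1..n. law.scaled_tail (w i) (x - L))"
proof -
  \<comment> \<open>With \<open>n\<close> fixed, any growth rate of Kesten's constant will do, so
    \<open>e\<close> is taken to be 1.\<close>
  obtain C where C: "0 < C" "\<And>n J. finite J \<Longrightarrow> J \<subseteq> {Suc n..} \<Longrightarrow> bounds J (partial_sum n) (C * (1 + 2 * 1) ^ n)"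
    by (rule kesten[OF zero_less_one order_refl]) (rule that)
  define c where "c = C * 3 ^ n"
  have c: "0 < c" using C by (simp add: c_def)
  have b: "bounds J (partial_sum m) c" if "m < n" "finite J" "J \<subseteq> {Suc m..}" for m J
  proof -
    have "C * 3 ^ m \<le> c"
      using C that unfolding c_def by (intro mult_left_mono power_increasing) auto
    then have "C * 3 ^ m * tail G y * measure M B \<le> c * tail G y * measure M B" for y B
      using law.tail_nonneg by (intro mult_right_mono) auto
    then show ?thesis using C(2)[OF that(2,3)] unfolding bounds_def by (simp, meson order_trans)
  qed
  \<comment> \<open>Chosen so that \<open>n\<close> joint terms, each with factor
    \<open>c * K\<close>, total at most \<open>e\<close> times the first scaled tail;
    \<open>n + 1\<close> avoids division by zero.\<close>
  define d where "d = e / ((real n + 1) * c * K)"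
  have d: "0 < d" using e c K_ge_1 by (simp add: d_def)
  obtain a where a: "max x0 0 < a" "\<forall>\<^sub>F y in at_top. joint_tail G a y \<le> d * tail G y"
    using law.joint_tail_small[OF d, of "max x0 0"] by blast
  obtain y1 where y1: "\<And>y. y1 \<le> y \<Longrightarrow> joint_tail G a y \<le> d * tail G y"
    using a(2) by (auto simp: eventually_at_top_linorder)
  define L where "L = real n * a"
  have L: "0 \<le> L" using a by (simp add: L_def)
  show thesis
  proof (rule that[of L "L + max 0 y1"])
    fix w :: "nat \<Rightarrow> real" and x
    assume w: "0 \<le> w 1" "w 1 \<le> 1" "\<And>i. i \<in> {1..n} \<Longrightarrow> 0 \<le> w i" "\<And>i. i \<in> {1..n} \<Longrightarrow> w i \<le> w 1"
      and x: "L + max 0 y1 \<le> x"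
    have sn: "0 \<le> (\<Sum>i=1..n. law.scaled_tail (w i) (x - L))"
      using law.scaled_tail_nonneg by (intro sum_nonneg) auto
    show "measure M {\<omega> \<in> space M. x < (\<Sum>i=1..n. w i * Y i \<omega>)}
        \<le> (1 + e) * (\<Sum>i=1..n. law.scaled_tail (w i) (x - L))"
    proof (cases "1 \<le> n \<and> 0 < w 1")
      case True
      have "max 0 y1 \<le> x - L" using x by linarith
      \<comment> \<open>A first weight at most 1 only raises the level, so one \<open>y1\<close>
        serves all weights.\<close>
      also have "x - L \<le> (x - L) / w 1"
        using x True w by (simp add: pos_le_divide_eq mult_left_le)
      finally have jt: "joint_tail G a ((x - L) / w 1) \<le> d * tail G ((x - L) / w 1)"
        by (intro y1) auto
      have "measure M {\<omega> \<in> space M. x < (\<Sum>i=1..n. w i * Y i \<omega>)} \<le>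
          (\<Sum>i=1..n. law.scaled_tail (w i) (x - real n * a)) + n * (c * K * joint_tail G a ((x - real n * a) / w 1))"
        using True a w by (intro weighted_sum_bound[OF less_imp_le[OF c] b]) auto
      also have "n * (c * K * joint_tail G a ((x - real n * a) / w 1)) \<le> n * (c * K * (d * tail G ((x - L) / w 1)))"
        using jt c K_ge_1 by (intro mult_left_mono) (auto simp: L_def)
      also have "\<dots> = (real n * c * K * d) * law.scaled_tail (w 1) (x - L)"
        using True by (simp add: law.scaled_tail_eq)
      also have "\<dots> \<le> e * law.scaled_tail (w 1) (x - L)"
      proof (rule mult_right_mono)
        have "real n * c * K * d = (real n / (real n + 1)) * e"
          using c K_ge_1 by (simp add: d_def)
        also have "\<dots> \<le> 1 * e" using e by (intro mult_right_mono) auto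
        finally show "real n * c * K * d \<le> e" by simp
      qed (rule law.scaled_tail_nonneg)
      also have "law.scaled_tail (w 1) (x - L) \<le> (\<Sum>i=1..n. law.scaled_tail (w i) (x - L))"
        using True law.scaled_tail_nonneg
        by (intro member_le_sum[of 1 "{1..n}" "\<lambda>i. law.scaled_tail (w i) (x - L)"]) auto
      finally show ?thesis using e by (simp add: L_def algebra_simps)
    next
      case False
      then have "\<And>i. i \<in> {1..n} \<Longrightarrow> w i = 0"
        using w by (metis antisym atLeastAtMost_iff not_le order_trans)
      then have "(\<Sum>i=1..n. w i * Y i \<omega>) = 0" for \<omega> by (intro sum.neutral) auto
      moreover have "0 \<le> x" using x L by linarith
      ultimately show ?thesis using sn e by simp
    qed
  qed (use L in auto)
qed

text \<open>One claim keeps its scaled tail; for the other, \<open>v \<le> 1\<close> raises the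
  level to at least \<open>x\<close>, which gives a small factor independent of the weights.\<close>

lemma pair_bound:
  assumes ij: "1 \<le> i" "1 \<le> j" "i \<noteq> j" and x: "x0 < x" "0 \<le> x"
    and w: "0 \<le> v" "v \<le> 1" "0 \<le> w" "w \<le> 1"
  shows "measure M {\<omega> \<in> space M. x < v * Y i \<omega> \<and> x < w * Y j \<omega>}
    \<le> K * tail G x * law.scaled_tail w x"
proof (cases "0 < v \<and> 0 < w")
  case True
  have le: "x \<le> x / v" "x \<le> x / w" using True w x by (auto simp: pos_le_divide_eq mult_left_le)
  define B where "B = {\<omega> \<in> space M. x / w < Y j \<omega>}"
  have "Y j \<in> borel_measurable (process_algebra M {j} borel Y)" by (rule PA_coord) simp
  then have "{\<omega> \<in> space (process_algebra M {j} borel Y). x / w < Y j \<omega>} \<in> sets (process_algebra M {j} borel Y)"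
    by measurable
  then have B: "B \<in> sets (process_algebra M {j} borel Y)" by (simp add: B_def)
  have "measure M (B \<inter> {\<omega> \<in> space M. x / v < Y i \<omega>}) \<le> K * tail G (x / v) * measure M B"
    using ij le x by (intro rd[OF _ _ _ _ _ B]) (auto simp: B_def)
  also have "measure M B = law.scaled_tail w x"
    using True ij by (simp add: B_def prob_Y_gt law.scaled_tail_eq)
  also have "K * tail G (x / v) * law.scaled_tail w x \<le> K * tail G x * law.scaled_tail w x"
    using le K_ge_1 law.scaled_tail_nonneg by (intro mult_right_mono mult_left_mono law.tail_mono) auto
  also have "B \<inter> {\<omega> \<in> space M. x / v < Y i \<omega>} = {\<omega> \<in> space M. x < v * Y i \<omega> \<and> x < w * Y j \<omega>}"
    using True by (auto simp: B_def field_simps)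
  finally show ?thesis .
next
  case False
  then have "v = 0 \<or> w = 0" using w by auto
  then have e: "{\<omega> \<in> space M. x < v * Y i \<omega> \<and> x < w * Y j \<omega>} = {}" using x by auto
  show ?thesis unfolding e using K_ge_1 law.tail_nonneg law.scaled_tail_nonneg by simp
qed

text \<open>Inclusion-exclusion one claim at a time: by \<open>pair_bound\<close> the overlap of a
  new event with the earlier ones is at most the fraction \<open>n * K * tail G x\<close> of its
  probability.\<close>

lemma weighted_max_lower:
  assumes x: "x0 < x" "0 \<le> x" and w: "\<And>i. i \<in> {1..n} \<Longrightarrow> 0 \<le> w i" "\<And>i. i \<in> {1..n} \<Longrightarrow> w i \<le> 1"
  shows "(1 - n * K * tail G x) * (\<Sum>i=1..n. law.scaled_tail (w i) x)
    \<le> measure M {\<omega> \<in> space M. \<exists>i\<in>{1..n}. x < w i * Y i \<omega>}"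
proof -
  have "(1 - n * K * tail G x) * (\<Sum>i=1..m. law.scaled_tail (w i) x)
    \<le> measure M {\<omega> \<in> space M. \<exists>i\<in>{1..m}. x < w i * Y i \<omega>}" if "m \<le> n" for m
    using that
  proof (induction m)
    case (Suc m)
    let ?U = "{\<omega> \<in> space M. \<exists>i\<in>{1..m}. x < w i * Y i \<omega>}" and ?A = "{\<omega> \<in> space M. x < w (Suc m) * Y (Suc m) \<omega>}"
    let ?s = "law.scaled_tail (w (Suc m)) x"
    have Um: "?U \<in> sets M"
      by (intro sets.sets_Collect_finite_Ex) (auto intro!: borel_measurable_less)
    have Am: "?A \<in> sets M" by measurable
    have "measure M (?U \<inter> ?A) \<le> measure M (\<Union>i\<in>{1..m}. {\<omega> \<in> space M. x < w i * Y i \<omega> \<and> x < w (Suc m) * Y (Suc m) \<omega>})"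
      by (intro M.finite_measure_mono sets.finite_UN) auto
    also have "\<dots> \<le> (\<Sum>i=1..m. measure M {\<omega> \<in> space M. x < w i * Y i \<omega> \<and> x < w (Suc m) * Y (Suc m) \<omega>})"
      by (intro measure_UNION_le) auto
    also have "\<dots> \<le> (\<Sum>i=1..m. K * tail G x * ?s)"
      using Suc.prems by (intro sum_mono pair_bound x w) auto
    also have "\<dots> \<le> n * K * tail G x * ?s"
    proof -
      have "real m * (K * tail G x * ?s) \<le> real n * (K * tail G x * ?s)"
        using Suc.prems K_ge_1 law.tail_nonneg law.scaled_tail_nonneg by (intro mult_right_mono) auto
      then show ?thesis by (simp add: mult.assoc)
    qed
    finally have 1: "measure M (?U \<inter> ?A) \<le> n * K * tail G x * ?s" .
    have "{\<omega> \<in> space M. \<exists>i\<in>{1..Suc m}. x < w i * Y i \<omega>} = ?U \<union> ?A"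
      by (auto simp: atLeastAtMostSuc_conv)
    then have "measure M {\<omega> \<in> space M. \<exists>i\<in>{1..Suc m}. x < w i * Y i \<omega>}
        = measure M ?U + measure M ?A - measure M (?U \<inter> ?A)"
      using M.finite_measure_Union'[OF Um Am] M.finite_measure_Diff'[OF Am Um]
      by (simp add: Int_commute)
    then show ?case using 1 Suc.IH Suc.prems by (simp add: prob_scaled algebra_simps)
  qed simp
  then show ?thesis by simp
qed

end

section \<open>Independent sub-algebras\<close>

lemma measurable_ident_subalgebra:
  assumes "space N = space M" "sets N \<subseteq> sets M"
  shows "(\<lambda>\<omega>. \<omega>) \<in> measurable M N"
proof (rule measurableI)
  fix C assume C: "C \<in> sets N"
  have "(\<lambda>\<omega>. \<omega>) -` C \<inter> space M = C"
    using sets.sets_into_space[OF C] assms(1) by auto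
  then show "(\<lambda>\<omega>. \<omega>) -` C \<inter> space M \<in> sets M" using C assms(2) by auto
qed (use assms in simp)

text \<open>Independence makes the image of \<open>M\<close> under the diagonal map into
  \<open>A \<Otimes>\<^sub>M B\<close> a product measure. One copy of the sample point can then be
  frozen while the other is averaged, without introducing path spaces.\<close>

lemma (in prob_space)
  assumes A: "space A = space M" "sets A \<subseteq> events" and B: "space B = space M" "sets B \<subseteq> events"
    and ind: "indep_set (sets A) (sets B)"
    and P: "Measurable.pred (A \<Otimes>\<^sub>M B) (\<lambda>p. P (fst p) (snd p))"
  shows indep_diagonal: "prob {\<omega> \<in> space M. P \<omega> \<omega>} = (\<integral>\<omega>. prob {\<omega>' \<in> space M. P \<omega> \<omega>'} \<partial>M)"
    and indep_diagonal_measurable: "(\<lambda>\<omega>. prob {\<omega>' \<in> space M. P \<omega> \<omega>'}) \<in> borel_measurable A"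
proof -
  define R where "R = {p \<in> space (A \<Otimes>\<^sub>M B). P (fst p) (snd p)}"
  have R: "R \<in> sets (A \<Otimes>\<^sub>M B)" unfolding R_def using P by (rule predE)
  have RP: "(\<omega>, \<omega>') \<in> R \<longleftrightarrow> P \<omega> \<omega>'" if "\<omega> \<in> space M" "\<omega>' \<in> space M" for \<omega> \<omega>'
    using that A(1) B(1) by (simp add: R_def space_pair_measure)
  have rvA: "(\<lambda>\<omega>. \<omega>) \<in> measurable M A" and rvB: "(\<lambda>\<omega>. \<omega>) \<in> measurable M B"
    using A B by (auto intro: measurable_ident_subalgebra)
  have s: "sigma_sets (space M) {(\<lambda>\<omega>. \<omega>) -` C \<inter> space M |C. C \<in> sets N} = sets N"
    if N: "space N = space M" for N :: "'a measure"
  proof -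
    have "(\<lambda>\<omega>. \<omega>) -` C \<inter> space M = C" if "C \<in> sets N" for C
      using sets.sets_into_space[OF that] N by auto
    then have "(\<lambda>C. (\<lambda>\<omega>. \<omega>) -` C \<inter> space M) ` sets N = (\<lambda>C. C) ` sets N"
      by (rule image_cong[OF refl])
    then have "{(\<lambda>\<omega>. \<omega>) -` C \<inter> space M |C. C \<in> sets N} = sets N"
      by (simp add: Setcompr_eq_image)
    then show ?thesis using sets.sigma_sets_eq[of N] N by simp
  qed
  have "indep_var A (\<lambda>\<omega>. \<omega>) B (\<lambda>\<omega>. \<omega>)"
    unfolding indep_var_eq s[OF A(1)] s[OF B(1)] using rvA rvB ind by simp
  then have eq: "distr M A (\<lambda>\<omega>. \<omega>) \<Otimes>\<^sub>M distr M B (\<lambda>\<omega>. \<omega>) = distr M (A \<Otimes>\<^sub>M B) (\<lambda>\<omega>. (\<omega>, \<omega>))"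
    by (simp add: indep_var_distribution_eq)
  have pair: "(\<lambda>\<omega>. (\<omega>, \<omega>)) \<in> measurable M (A \<Otimes>\<^sub>M B)"
    using rvA rvB by (rule measurable_Pair)
  interpret B': prob_space "distr M B (\<lambda>\<omega>. \<omega>)" using rvB by (rule prob_space_distr)
  have RD: "R \<in> sets (A \<Otimes>\<^sub>M distr M B (\<lambda>\<omega>. \<omega>))" "R \<in> sets (distr M A (\<lambda>\<omega>. \<omega>) \<Otimes>\<^sub>M distr M B (\<lambda>\<omega>. \<omega>))"
    using R by auto
  have sect: "Pair \<omega> -` R \<in> sets B" for \<omega>
    using R by (rule sets_Pair1)
  have fe: "emeasure (distr M B (\<lambda>\<omega>. \<omega>)) (Pair \<omega> -` R) = ennreal (prob {\<omega>' \<in> space M. (\<omega>, \<omega>') \<in> R})" for \<omega>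
    using rvB sect[of \<omega>]
    by (subst emeasure_distr) (auto simp: emeasure_eq_measure intro!: arg_cong[of _ _ prob])
  have "(\<lambda>\<omega>. emeasure (distr M B (\<lambda>\<omega>. \<omega>)) (Pair \<omega> -` R)) \<in> borel_measurable A"
    by (rule B'.measurable_emeasure_Pair[OF RD(1)])
  then have "(\<lambda>\<omega>. enn2real (ennreal (prob {\<omega>' \<in> space M. (\<omega>, \<omega>') \<in> R}))) \<in> borel_measurable A"
    unfolding fe by (rule borel_measurable_enn2real)
  then have mA: "(\<lambda>\<omega>. prob {\<omega>' \<in> space M. (\<omega>, \<omega>') \<in> R}) \<in> borel_measurable A" by simp
  have mM: "(\<lambda>\<omega>. prob {\<omega>' \<in> space M. (\<omega>, \<omega>') \<in> R}) \<in> borel_measurable M"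
    using measurable_compose[OF rvA mA] .
  have "ennreal (prob {\<omega> \<in> space M. (\<omega>, \<omega>) \<in> R}) = emeasure (distr M (A \<Otimes>\<^sub>M B) (\<lambda>\<omega>. (\<omega>, \<omega>))) R"
    using pair R
    by (subst emeasure_distr) (auto simp: emeasure_eq_measure intro!: arg_cong[of _ _ prob])
  also have "\<dots> = (\<integral>\<^sup>+\<omega>. emeasure (distr M B (\<lambda>\<omega>. \<omega>)) (Pair \<omega> -` R) \<partial>distr M A (\<lambda>\<omega>. \<omega>))"
    unfolding eq[symmetric] by (rule B'.emeasure_pair_measure_alt[OF RD(2)])
  also have "\<dots> = (\<integral>\<^sup>+\<omega>. ennreal (prob {\<omega>' \<in> space M. (\<omega>, \<omega>') \<in> R}) \<partial>M)"
    unfolding fe by (rule nn_integral_distr[OF rvA]) (use mA in measurable)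
  also have "\<dots> = ennreal (\<integral>\<omega>. prob {\<omega>' \<in> space M. (\<omega>, \<omega>') \<in> R} \<partial>M)"
    using mM by (intro nn_integral_eq_integral integrable_const_bound[where B = 1]) auto
  finally have eq: "prob {\<omega> \<in> space M. (\<omega>, \<omega>) \<in> R} = (\<integral>\<omega>. prob {\<omega>' \<in> space M. (\<omega>, \<omega>') \<in> R} \<partial>M)"
    by (subst (asm) ennreal_inj) (auto intro!: integral_nonneg_AE)
  have c1: "prob {\<omega>' \<in> space M. (\<omega>, \<omega>') \<in> R} = prob {\<omega>' \<in> space M. P \<omega> \<omega>'}" if "\<omega> \<in> space M" for \<omega>
    using RP that by (intro arg_cong[of _ _ prob]) auto
  have "prob {\<omega> \<in> space M. P \<omega> \<omega>} = prob {\<omega> \<in> space M. (\<omega>, \<omega>) \<in> R}"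
    using RP by (intro arg_cong[of _ _ prob]) auto
  also have "\<dots> = (\<integral>\<omega>. prob {\<omega>' \<in> space M. P \<omega> \<omega>'} \<partial>M)"
    unfolding eq using c1 by (intro Bochner_Integration.integral_cong) auto
  finally show "prob {\<omega> \<in> space M. P \<omega> \<omega>} = (\<integral>\<omega>. prob {\<omega>' \<in> space M. P \<omega> \<omega>'} \<partial>M)" .
  show "(\<lambda>\<omega>. prob {\<omega>' \<in> space M. P \<omega> \<omega>'}) \<in> borel_measurable A"
    using mA c1 A(1) by (subst measurable_cong[of A, OF c1[symmetric]]) auto
qed

text \<open>With \<open>a\<close>, \<open>b\<close>, \<open>c\<close> standing for claims, arrivals
  and discounting, these are the groupings used later: arrivals with discounting against claims, and
  arrivals against claims with discounting.\<close>

lemma (in prob_space)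
  assumes ind: "indep_sets (\<lambda>k. [sets a, sets b, sets c] ! k) {..<3}"
    and a: "space a = space M" and b: "space b = space M" and c: "space c = space M"
  shows indep_join_12_0: "indep_set (sigma_sets (space M) (sets b \<union> sets c)) (sets a)"
    and indep_join_1_02: "indep_set (sets b) (sigma_sets (space M) (sets a \<union> sets c))"
proof -
  let ?E = "\<lambda>k. [sets a, sets b, sets c] ! k"
  have st: "Int_stable (?E k)" if "k \<in> {0, 1, 2}" for k
    using that sets.Int_stable by auto
  have *: "indep_sets (\<lambda>j. sigma_sets (space M) (\<Union>i\<in>I j. ?E i)) UNIV"
    if "disjoint_family I" "I True \<union> I False = {0, 1, 2}" for I :: "bool \<Rightarrow> nat set"
  proof -
    have "(\<Union>j. I j) = I False \<union> I True" unfolding UNIV_bool by blast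
    also have "\<dots> = {0, 1, 2}" using that(2) by (simp only: Un_commute)
    also have "{0, 1, 2} = {..<3 :: nat}" by auto
    finally have U: "(\<Union>j. I j) = {..<3}" .
    have 1: "indep_sets ?E (\<Union>j. I j)" by (subst U) (rule ind)
    have "I j \<subseteq> {0, 1, 2}" for j
      using that(2)[symmetric] by (cases j) simp_all
    then have 2: "Int_stable (?E i)" if "i \<in> I j" for i j
      using that st by blast
    show ?thesis using 1 2 that(1) by (rule indep_sets_collect_sigma[where E = ?E and I = I and J = UNIV])
  qed
  have sa: "sigma_sets (space M) (sets a) = sets a" and sb: "sigma_sets (space M) (sets b) = sets b"
    using sets.sigma_sets_eq[of a] sets.sigma_sets_eq[of b] a b by simp_all
  have e1: "(\<lambda>j. sigma_sets (space M) (\<Union>i\<in>(if j then {1, 2} else {0}). ?E i)) =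
      case_bool (sigma_sets (space M) (sets b \<union> sets c)) (sets a)"
    by (rule ext) (simp add: sa split: bool.split)
  have "disjoint_family (\<lambda>j. if j then {1, 2} else {0 :: nat})"
    by (auto simp: disjoint_family_on_def)
  from *[OF this] show "indep_set (sigma_sets (space M) (sets b \<union> sets c)) (sets a)"
    unfolding indep_set_def e1 by (simp add: insert_commute)
  have e2: "(\<lambda>j. sigma_sets (space M) (\<Union>i\<in>(if j then {1} else {0, 2}). ?E i)) =
      case_bool (sets b) (sigma_sets (space M) (sets a \<union> sets c))"
    by (rule ext) (simp add: sb split: bool.split)
  have "disjoint_family (\<lambda>j. if j then {1} else {0, 2 :: nat})"
    by (auto simp: disjoint_family_on_def)
  from *[OF this] show "indep_set (sets b) (sigma_sets (space M) (sets a \<union> sets c))"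
    unfolding indep_set_def e2 by (simp add: insert_commute)
qed

text \<open>Campbell's formula for the arrival times; it extends from indicators by linearity and
  monotone limits.\<close>

lemma nn_integral_renewal_measure:
  assumes th: "\<And>i. arrival \<theta> (Suc i) \<in> borel_measurable M" and f: "f \<in> borel_measurable borel"
  shows "(\<integral>\<^sup>+s. f s \<partial>renewal_measure M \<theta>) = (\<Sum>i. \<integral>\<^sup>+\<omega>. f (arrival \<theta> (Suc i) \<omega>) \<partial>M)"
proof -
  have "(\<integral>\<^sup>+s. f s \<partial>renewal_measure M \<theta>) = (\<Sum>i. \<integral>\<^sup>+s. f s \<partial>distr M borel (arrival \<theta> (Suc i)))"
    using f
  proof (induction rule: borel_measurable_induct)
    case (cong f g)
    then have "f = g" by (intro ext) simp
    with cong show ?case by simp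
  next
    case (set A)
    then show ?case by (simp add: emeasure_renewal_measure)
  next
    case (mult u c)
    then show ?case by (simp add: nn_integral_cmult ennreal_suminf_cmult)
  next
    case (add u v)
    then show ?case by (simp add: nn_integral_add suminf_add[symmetric])
  next
    case (seq U)
    have "(\<integral>\<^sup>+s. (SUP i. U i) s \<partial>renewal_measure M \<theta>) = (SUP j. \<integral>\<^sup>+s. U j s \<partial>renewal_measure M \<theta>)"
      using seq by (simp add: image_comp nn_integral_monotone_convergence_SUP)
    also have "\<dots> = (SUP j. \<Sum>i. \<integral>\<^sup>+s. U j s \<partial>distr M borel (arrival \<theta> (Suc i)))"
      using seq by simp
    also have "\<dots> = (\<Sum>i. SUP j. \<integral>\<^sup>+s. U j s \<partial>distr M borel (arrival \<theta> (Suc i)))"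
      using seq by (intro ennreal_suminf_SUP_eq[symmetric])
        (auto simp: incseq_def le_fun_def intro!: nn_integral_mono)
    also have "\<dots> = (\<Sum>i. \<integral>\<^sup>+s. (SUP j. U j) s \<partial>distr M borel (arrival \<theta> (Suc i)))"
      using seq by (simp add: image_comp nn_integral_monotone_convergence_SUP)
    finally show ?case .
  qed
  then show ?thesis using th f by (simp add: nn_integral_distr)
qed

lemma (in prob_space) process_algebra_empty:
  assumes "B \<in> sets (process_algebra M {} S Y)"
  shows "B = {} \<or> B = space M"
proof -
  have "sets (process_algebra M {} S Y) =
      {(\<lambda>\<omega>. \<lambda>i\<in>{}. Y i \<omega>) -` C \<inter> space M | C. C \<in> sets (Pi\<^sub>M {} (\<lambda>_. S))}"
    unfolding process_algebra_def by (rule sets_vimage_algebra2) (auto simp: space_PiM)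
  then show ?thesis using assms by (auto simp: sets_PiM_empty)
qed

text \<open>For nonempty \<open>J\<close> the almost sure bound is integrated over \<open>B\<close>
  by the defining property of conditional expectation. For empty \<open>J\<close> the events are
  trivial, and a constant at least 1 suffices.\<close>

lemma regression_dependentE:
  assumes M: "prob_space M" and rd: "regression_dependent M {1..} Z"
    and Z: "\<And>i. 1 \<le> i \<Longrightarrow> Z i \<in> borel_measurable M"
    and G: "\<And>i. 1 \<le> i \<Longrightarrow> distr M borel (Z i) = G" and sub: "subexponential G"
  obtains x0 K where "regression_dependent_seq M G Z x0 K"
proof -
  interpret prob_space M by fact
  interpret law: subexponential_law G by standard fact
  obtain x0 K where x0: "0 < x0" "0 < K" and
    rd: "\<forall>i\<in>{1..}. \<forall>J. J \<noteq> {} \<longrightarrow> J \<subset> {1..} - {i} \<longrightarrow>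
      (\<forall>y>x0. AE \<omega> in M. (\<forall>j\<in>J. x0 < Z j \<omega>) \<longrightarrow>
        real_cond_exp M (process_algebra M J borel Z) (indicator {\<omega> \<in> space M. y < Z i \<omega>}) \<omega>
          \<le> K * tail (distr M borel (Z i)) y)"
    using rd unfolding regression_dependent_def by (elim exE conjE)
  have "regression_dependent_seq M G Z x0 (max 1 K)"
  proof (unfold_locales)
    fix J i y B
    assume J: "finite J" "J \<subseteq> {1..}" "1 \<le> (i::nat)" "i \<notin> J" and y: "x0 < (y::real)"
      and B: "B \<in> sets (process_algebra M J borel Z)" "B \<subseteq> {\<omega>. \<forall>j\<in>J. x0 < Z j \<omega>}"
    have [measurable]: "Z i \<in> borel_measurable M" using Z J by simp
    have "tail G y = measure (distr M borel (Z i)) {y<..}"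
      using law.tail_alt G[OF J(3)] by simp
    also have "\<dots> = prob {\<omega> \<in> space M. y < Z i \<omega>}"
      by (subst measure_distr) (auto intro!: arg_cong[of _ _ prob])
    finally have tl: "tail G y = prob {\<omega> \<in> space M. y < Z i \<omega>}" .
    show "prob (B \<inter> {\<omega> \<in> space M. y < Z i \<omega>}) \<le> max 1 K * tail G y * prob B"
    proof (cases "J = {}")
      case True
      have "tail G y \<le> max 1 K * tail G y"
        using law.tail_nonneg mult_right_mono[of 1 "max 1 K" "tail G y"] by simp
      then show ?thesis
        using process_algebra_empty[of B borel Z] B True
        by (auto simp: tl prob_space Int_absorb1 Collect_restrict)
    next
      case False
      let ?N = "process_algebra M J borel Z" and ?f = "indicator {\<omega> \<in> space M. y < Z i \<omega>} :: _ \<Rightarrow> real"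
      have sN: "sets ?N \<subseteq> events" using J by (intro sets_process_algebra_subset Z) auto
      interpret N: finite_measure_subalgebra M ?N
        by unfold_locales (use sN in \<open>auto simp: subalgebra_def\<close>)
      have BM [measurable]: "B \<in> events" using B sN by auto
      have fint: "integrable M ?f" by (intro integrable_real_indicator) (auto simp: emeasure_eq_measure)
      have rint: "integrable M (real_cond_exp M ?N ?f)" by (rule N.real_cond_exp_int(1)[OF fint])
      \<comment> \<open>A finite \<open>J\<close> cannot exhaust the infinite index set, so it
        qualifies as a proper subset.\<close>
      have Jp: "J \<subset> {1..} - {i}"
      proof -
        have "infinite ({1..} - {i})" by (intro Diff_infinite_finite infinite_Ici) simp
        then have "J \<noteq> {1..} - {i}" using J(1) by metis
        then show ?thesis using J by auto
      qed
      have "prob (B \<inter> {\<omega> \<in> space M. y < Z i \<omega>}) = (\<integral>\<omega>. indicator (B \<inter> {\<omega> \<in> space M. y < Z i \<omega>}) \<omega> \<partial>M)"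
        by simp
      also have "\<dots> = (\<integral>\<omega>\<in>B. ?f \<omega> \<partial>M)"
        unfolding set_lebesgue_integral_def by (intro Bochner_Integration.integral_cong) (auto simp: indicator_def)
      also have "\<dots> = (\<integral>\<omega>\<in>B. real_cond_exp M ?N ?f \<omega> \<partial>M)"
        by (rule N.real_cond_exp_intA[OF fint B(1)])
      also have "\<dots> \<le> (\<integral>\<omega>\<in>B. K * tail G y \<partial>M)"
        unfolding set_lebesgue_integral_def
      proof (rule integral_mono_AE)
        show "integrable M (\<lambda>\<omega>. indicator B \<omega> *\<^sub>R real_cond_exp M ?N ?f \<omega>)"
          using integrable_mult_indicator[OF BM rint] by simp
        show "integrable M (\<lambda>\<omega>. indicator B \<omega> *\<^sub>R (K * tail G y))"
          by (intro integrable_scaleR_left integrable_real_indicator) (auto simp: emeasure_eq_measure)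
        show "AE \<omega> in M. indicator B \<omega> *\<^sub>R real_cond_exp M ?N ?f \<omega> \<le> indicator B \<omega> *\<^sub>R (K * tail G y)"
          using rd[rule_format, OF _ False Jp y] J(3) B(2) unfolding G[OF J(3)]
          by (auto simp: indicator_def elim!: eventually_mono)
      qed
      also have "\<dots> = K * tail G y * prob B"
        by (simp add: set_lebesgue_integral_def)
      also have "\<dots> \<le> max 1 K * tail G y * prob B"
        using law.tail_nonneg by (intro mult_right_mono) auto
      finally show ?thesis .
    qed
  qed (use Z G in auto)
  then show thesis by (rule that)
qed

section \<open>The risk model\<close>

lemma dyadic_above_nat:
  assumes "0 \<le> t"
  shows "dyadic_above k t = (real (nat \<lfloor>2 ^ k * t\<rfloor>) + 1) / 2 ^ k"
  using assms by (simp add: dyadic_above_def)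

locale risk_model = prob_space M for M :: "'a measure" +
  fixes A :: "(real ^ 'd) set" and F :: "(real ^ 'd) measure"
    and X :: "nat \<Rightarrow> 'a \<Rightarrow> real ^ 'd" and \<theta> :: "nat \<Rightarrow> 'a \<Rightarrow> real"
    and \<xi> :: "real \<Rightarrow> 'a \<Rightarrow> real" and T :: real
  assumes A: "A \<in> ruin_sets"
    and X_measurable: "1 \<le> i \<Longrightarrow> X i \<in> borel_measurable M"
    and X_distr: "1 \<le> i \<Longrightarrow> distr M borel (X i) = F"
    and F_nonneg: "AE z in F. \<forall>k. 0 \<le> z $ k"
    and renewal: "renewal_interarrivals M \<theta>"
    and cadlag: "cadlag_process M \<xi>"
    and indep: "mutually_independent M
           (process_algebra M {1..} borel X)
           (process_algebra M {0..} (count_space UNIV) (counting \<theta>))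
           (process_algebra M {0..} borel \<xi>)"
    and \<xi>_mono: "\<omega> \<in> space M \<Longrightarrow> mono_on {0..} (\<lambda>t. \<xi> t \<omega>)"
    and T: "0 \<le> T" "0 < renewal_function M \<theta> T"
begin

definition "claims_alg = process_algebra M {1..} borel X"
definition "count_alg = process_algebra M {0..} (count_space UNIV) (counting \<theta>)"
definition "disc_alg = process_algebra M {0..} borel \<xi>"
text \<open>The weights are measurable in this join; the next one serves when the arrivals alone are
  frozen.\<close>

definition "count_disc_alg = sigma (space M) (sets count_alg \<union> sets disc_alg)"
definition "claims_disc_alg = sigma (space M) (sets claims_alg \<union> sets disc_alg)"

abbreviation \<tau> :: "nat \<Rightarrow> 'a \<Rightarrow> real" where "\<tau> i \<omega> \<equiv> arrival \<theta> i \<omega>"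
abbreviation Y :: "nat \<Rightarrow> 'a \<Rightarrow> real" where "Y i \<omega> \<equiv> radial A (X i \<omega>)"

lemma space_algs [simp]: "space claims_alg = space M" "space count_alg = space M" "space disc_alg = space M"
  "space count_disc_alg = space M" "space claims_disc_alg = space M"
  by (simp_all only: claims_alg_def count_alg_def disc_alg_def count_disc_alg_def claims_disc_alg_def
      space_process_algebra space_measure_of_conv)

lemma sets_count_disc: "sets count_disc_alg = sigma_sets (space M) (sets count_alg \<union> sets disc_alg)"
  unfolding count_disc_alg_def using sets.sets_into_space[of _ count_alg] sets.sets_into_space[of _ disc_alg]
  by (intro sets_measure_of) auto

lemma sets_claims_disc: "sets claims_disc_alg = sigma_sets (space M) (sets claims_alg \<union> sets disc_alg)"
  unfolding claims_disc_alg_def using sets.sets_into_space[of _ claims_alg] sets.sets_into_space[of _ disc_alg]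
  by (intro sets_measure_of) auto

lemma indep_algs: "indep_sets (\<lambda>k. [sets claims_alg, sets count_alg, sets disc_alg] ! k) {..<3}"
  using indep by (simp add: mutually_independent_def claims_alg_def count_alg_def disc_alg_def)

lemma indep_count_disc_claims: "indep_set (sets count_disc_alg) (sets claims_alg)"
  unfolding sets_count_disc by (rule indep_join_12_0[OF indep_algs]) simp_all

lemma indep_count_claims_disc: "indep_set (sets count_alg) (sets claims_disc_alg)"
  unfolding sets_claims_disc by (rule indep_join_1_02[OF indep_algs]) simp_all

lemma sets_algs: "sets claims_alg \<subseteq> events" "sets count_alg \<subseteq> events"
    "sets count_disc_alg \<subseteq> events" "sets claims_disc_alg \<subseteq> events"
  using indep_count_disc_claims indep_count_claims_disc
  by (simp_all add: indep_sets2_eq)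

lemma sub_algs: "sets count_alg \<subseteq> sets count_disc_alg" "sets disc_alg \<subseteq> sets count_disc_alg"
    "sets claims_alg \<subseteq> sets claims_disc_alg" "sets disc_alg \<subseteq> sets claims_disc_alg"
  unfolding sets_count_disc sets_claims_disc by (blast intro: sigma_sets.Basic)+

lemma ident_measurable:
  "(\<lambda>\<omega>. \<omega>) \<in> measurable count_disc_alg count_alg" "(\<lambda>\<omega>. \<omega>) \<in> measurable count_disc_alg disc_alg"
  "(\<lambda>\<omega>. \<omega>) \<in> measurable claims_disc_alg claims_alg" "(\<lambda>\<omega>. \<omega>) \<in> measurable claims_disc_alg disc_alg"
  "(\<lambda>\<omega>. \<omega>) \<in> measurable M count_disc_alg" "(\<lambda>\<omega>. \<omega>) \<in> measurable M count_alg"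
  by (simp_all only: measurable_ident_subalgebra space_algs sub_algs sets_algs)

lemma Y_claims: "1 \<le> i \<Longrightarrow> Y i \<in> borel_measurable claims_alg"
  unfolding claims_alg_def
  by (rule measurable_compose[OF measurable_process_algebra_coord measurable_radial[OF A]]) auto

lemma \<theta>_indep: "indep_vars (\<lambda>_. borel) \<theta> {1..}"
  and \<theta>_distr: "1 \<le> i \<Longrightarrow> distr M borel (\<theta> i) = distr M borel (\<theta> 1)"
  and \<theta>_nonneg: "1 \<le> i \<Longrightarrow> \<omega> \<in> space M \<Longrightarrow> 0 \<le> \<theta> i \<omega>"
  and \<theta>_nonzero: "\<not> (AE \<omega> in M. \<theta> 1 \<omega> = 0)"
  using renewal unfolding renewal_interarrivals_def by blast+

lemma \<theta>_measurable: "1 \<le> i \<Longrightarrow> \<theta> i \<in> borel_measurable M"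
  using \<theta>_indep unfolding indep_vars_def by blast

lemma arrival_measurable: "\<tau> i \<in> borel_measurable M"
  unfolding arrival_def [abs_def] by (intro borel_measurable_sum \<theta>_measurable) auto

lemma arrival_mono: "i \<le> j \<Longrightarrow> \<omega> \<in> space M \<Longrightarrow> \<tau> i \<omega> \<le> \<tau> j \<omega>"
  unfolding arrival_def by (intro sum_mono2) (auto intro: \<theta>_nonneg)

lemma arrival_nonneg: "\<omega> \<in> space M \<Longrightarrow> 0 \<le> \<tau> i \<omega>"
  unfolding arrival_def by (intro sum_nonneg) (auto intro: \<theta>_nonneg)

text \<open>Nonnegative inter-arrival times make the indices of arrivals up to time \<open>t\<close>
  an initial segment. This duality recovers the arrival times from the counting process.\<close>

lemma le_counting_iff:
  assumes i: "1 \<le> i" and \<omega>: "\<omega> \<in> space M"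
  shows "enat i \<le> counting \<theta> t \<omega> \<longleftrightarrow> \<tau> i \<omega> \<le> t"
proof
  assume le: "enat i \<le> counting \<theta> t \<omega>"
  show "\<tau> i \<omega> \<le> t"
  proof (rule ccontr)
    assume "\<not> \<tau> i \<omega> \<le> t"
    then have "j < i" if "\<tau> j \<omega> \<le> t" for j
      using arrival_mono[OF _ \<omega>, of i j] that by force
    then have "counting \<theta> t \<omega> \<le> enat (i - 1)"
      unfolding counting_def by (intro Sup_least) force
    then have "enat i \<le> enat (i - 1)" using le by (rule order_trans[rotated])
    then show False using i by simp
  qed
qed (use i in \<open>auto simp: counting_def intro!: Sup_upper\<close>)

text \<open>Independence is assumed of the counting process, not of the inter-arrival times, so the
  arrival times have to be measurable with respect to the former.\<close>

lemma arrival_count_alg: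
  assumes i: "1 \<le> i"
  shows "\<tau> i \<in> borel_measurable count_alg"
  unfolding borel_measurable_iff_le
proof
  fix t
  show "{\<omega> \<in> space count_alg. \<tau> i \<omega> \<le> t} \<in> sets count_alg"
  proof (cases "0 \<le> t")
    case True
    have "counting \<theta> t \<in> measurable count_alg (count_space UNIV)"
      unfolding count_alg_def using True by (intro measurable_process_algebra_coord) auto
    then have "counting \<theta> t -` {enat i..} \<inter> space count_alg \<in> sets count_alg"
      by (rule measurable_sets) simp
    also have "counting \<theta> t -` {enat i..} \<inter> space count_alg = {\<omega> \<in> space count_alg. \<tau> i \<omega> \<le> t}"
      using le_counting_iff[OF i] by auto
    finally show ?thesis .
  next
    case False
    then have "{\<omega> \<in> space count_alg. \<tau> i \<omega> \<le> t} = {}"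
      using arrival_nonneg[of _ i] by force
    then show ?thesis by (simp only: sets.empty_sets)
  qed
qed

lemma \<xi>_at_0: "\<omega> \<in> space M \<Longrightarrow> \<xi> 0 \<omega> = 0"
  using cadlag by (auto simp: cadlag_process_def)

lemma \<xi>_nonneg: "\<omega> \<in> space M \<Longrightarrow> 0 \<le> t \<Longrightarrow> 0 \<le> \<xi> t \<omega>"
  using mono_onD[OF \<xi>_mono, of \<omega> 0 t] \<xi>_at_0 by simp

lemma \<xi>_le: "\<omega> \<in> space M \<Longrightarrow> 0 \<le> s \<Longrightarrow> s \<le> t \<Longrightarrow> \<xi> s \<omega> \<le> \<xi> t \<omega>"
  using mono_onD[OF \<xi>_mono, of \<omega> s t] by simp

lemma \<xi>_disc_alg: "0 \<le> t \<Longrightarrow> \<xi> t \<in> borel_measurable disc_alg"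
  unfolding disc_alg_def by (intro measurable_process_algebra_coord) auto

lemma \<xi>_measurable: "0 \<le> t \<Longrightarrow> \<xi> t \<in> borel_measurable M"
  using cadlag by (auto simp: cadlag_process_def)

text \<open>Right-continuity makes \<open>\<xi>\<close> at an arrival time a limit of its values at dyadic times,
  hence jointly measurable although \<open>disc_alg\<close> is generated by uncountably many coordinates.\<close>

lemma \<xi>_arrival_joint:
  assumes i: "1 \<le> i"
  shows "(\<lambda>p. \<xi> (\<tau> i (fst p)) (snd p)) \<in> borel_measurable (count_alg \<Otimes>\<^sub>M disc_alg)"
proof (rule borel_measurable_LIMSEQ_real)
  have [measurable]: "\<tau> i \<in> borel_measurable count_alg" using i by (rule arrival_count_alg)
  fix k :: nat
  have [measurable]: "(\<lambda>p. nat \<lfloor>2 ^ k * \<tau> i (fst p)\<rfloor>) \<in> measurable (count_alg \<Otimes>\<^sub>M disc_alg) (count_space UNIV)"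
    by measurable
  have "(\<lambda>p. \<xi> ((real (nat \<lfloor>2 ^ k * \<tau> i (fst p)\<rfloor>) + 1) / 2 ^ k) (snd p)) \<in> borel_measurable (count_alg \<Otimes>\<^sub>M disc_alg)"
  proof (rule measurable_compose_countable[where f = "\<lambda>m p. \<xi> ((real m + 1) / 2 ^ k) (snd p)"])
    fix m :: nat
    show "(\<lambda>p. \<xi> ((real m + 1) / 2 ^ k) (snd p)) \<in> borel_measurable (count_alg \<Otimes>\<^sub>M disc_alg)"
      by (rule measurable_compose[OF measurable_snd \<xi>_disc_alg]) simp
  qed measurable
  then show "(\<lambda>p. \<xi> (dyadic_above k (\<tau> i (fst p))) (snd p)) \<in> borel_measurable (count_alg \<Otimes>\<^sub>M disc_alg)"
    by (rule measurable_cong[THEN iffD1, rotated])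
      (auto simp: space_pair_measure dyadic_above_nat arrival_nonneg)
next
  fix p assume "p \<in> space (count_alg \<Otimes>\<^sub>M disc_alg)"
  then have p: "fst p \<in> space M" "snd p \<in> space M" by (auto simp: space_pair_measure)
  let ?t = "\<tau> i (fst p)"
  have "((\<lambda>t. \<xi> t (snd p)) \<longlongrightarrow> \<xi> ?t (snd p)) (at_right ?t)"
    using cadlag p arrival_nonneg[OF p(1), of i]
    by (auto simp: cadlag_process_def cadlag_def continuous_within)
  moreover have "filterlim (\<lambda>k. dyadic_above k ?t) (at_right ?t) sequentially"
    using dyadic_above_gt[of ?t] less_imp_neq[OF dyadic_above_gt[of ?t], symmetric]
    by (simp add: filterlim_at dyadic_above_tendsto)
  ultimately show "(\<lambda>k. \<xi> (dyadic_above k ?t) (snd p)) \<longlonglongrightarrow> \<xi> ?t (snd p)"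
    by (rule filterlim_compose)
qed

text \<open>The value 0 after \<open>T\<close> lets the random number of terms be replaced by any
  larger fixed number, and keeps the first weight the largest.\<close>

definition w :: "nat \<Rightarrow> 'a \<Rightarrow> real" where
  "w i \<omega> = (if \<tau> i \<omega> \<le> T then exp (- \<xi> (\<tau> i \<omega>) \<omega>) else 0)"

lemma w_measurable:
  assumes i: "1 \<le> i"
  shows "w i \<in> borel_measurable count_disc_alg"
proof -
  have "(\<lambda>\<omega>. (\<omega>, \<omega>)) \<in> measurable count_disc_alg (count_alg \<Otimes>\<^sub>M disc_alg)"
    using ident_measurable by (intro measurable_Pair) auto
  from measurable_compose[OF this \<xi>_arrival_joint[OF i]]
  have [measurable]: "(\<lambda>\<omega>. \<xi> (\<tau> i \<omega>) \<omega>) \<in> borel_measurable count_disc_alg" by simp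
  have [measurable]: "\<tau> i \<in> borel_measurable count_disc_alg"
    using measurable_compose[OF ident_measurable(1) arrival_count_alg[OF i]] .
  show ?thesis unfolding w_def by measurable
qed

lemma w_measurable_M: "1 \<le> i \<Longrightarrow> w i \<in> borel_measurable M"
  using measurable_compose[OF ident_measurable(5) w_measurable] .

lemma w_nonneg: "0 \<le> w i \<omega>"
  by (simp add: w_def)

lemma w_le_1: "\<omega> \<in> space M \<Longrightarrow> w i \<omega> \<le> 1"
  using \<xi>_nonneg arrival_nonneg by (simp add: w_def)

lemma w_le_first: "1 \<le> i \<Longrightarrow> \<omega> \<in> space M \<Longrightarrow> w i \<omega> \<le> w 1 \<omega>"
  using \<xi>_le[of \<omega> "\<tau> 1 \<omega>" "\<tau> i \<omega>"] arrival_nonneg[of \<omega> 1] arrival_mono[of 1 i \<omega>]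
  by (auto simp: w_def)

end

section \<open>Averaging over random weights and arrival times\<close>

locale risk_model_rd = risk_model + S: regression_dependent_seq M "distr F borel (radial A)" Y x0 K
  for x0 K
begin

abbreviation sc :: "real \<Rightarrow> real \<Rightarrow> real" where "sc \<equiv> S.law.scaled_tail"
abbreviation Fbar :: "real \<Rightarrow> real" where "Fbar \<equiv> tail (distr F borel (radial A))"

text \<open>The first argument of \<open>P\<close> carries arrivals and discounting, the second the
  claims.\<close>

lemma weighted_prob:
  assumes P: "Measurable.pred (count_disc_alg \<Otimes>\<^sub>M claims_alg) (\<lambda>p. P (fst p) (snd p))"
  shows "prob {\<omega> \<in> space M. P \<omega> \<omega>} = (\<integral>\<omega>. prob {\<omega>' \<in> space M. P \<omega> \<omega>'} \<partial>M)"
    and "(\<lambda>\<omega>. prob {\<omega>' \<in> space M. P \<omega> \<omega>'}) \<in> borel_measurable M"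
proof -
  show "prob {\<omega> \<in> space M. P \<omega> \<omega>} = (\<integral>\<omega>. prob {\<omega>' \<in> space M. P \<omega> \<omega>'} \<partial>M)"
    by (rule indep_diagonal[where A = count_disc_alg and B = claims_alg])
      (use sets_algs indep_count_disc_claims P in auto)
  have "(\<lambda>\<omega>. prob {\<omega>' \<in> space M. P \<omega> \<omega>'}) \<in> borel_measurable count_disc_alg"
    by (rule indep_diagonal_measurable[where A = count_disc_alg and B = claims_alg])
      (use sets_algs indep_count_disc_claims P in auto)
  from measurable_compose[OF ident_measurable(5) this]
  show "(\<lambda>\<omega>. prob {\<omega>' \<in> space M. P \<omega> \<omega>'}) \<in> borel_measurable M" .
qed

lemma prob_scaled_claim:
  assumes i: "1 \<le> i" and v: "v \<in> borel_measurable count_disc_alg"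
  shows "prob {\<omega> \<in> space M. x < v \<omega> * Y i \<omega>} = (\<integral>\<omega>. sc (v \<omega>) x \<partial>M)"
proof -
  note [measurable] = v Y_claims[OF i]
  have "prob {\<omega> \<in> space M. x < v \<omega> * Y i \<omega>} = (\<integral>\<omega>. prob {\<omega>' \<in> space M. x < v \<omega> * Y i \<omega>'} \<partial>M)"
    by (rule weighted_prob) measurable
  then show ?thesis by (simp add: S.prob_scaled[OF i])
qed

lemma sc_integrable:
  assumes "v \<in> borel_measurable M" shows "integrable M (\<lambda>\<omega>. sc (v \<omega>) x)"
  using assms S.law.scaled_tail_nonneg S.law.scaled_tail_le_1
  by (intro integrable_const_bound[where B = 1] AE_I2) auto

text \<open>By \<open>h_alt\<close> this is the probability that the \<open>i\<close>-th discounted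
  claim exceeds \<open>x\<close>; the averaged form is the one in which estimates for deterministic
  weights enter.\<close>

definition h :: "nat \<Rightarrow> real \<Rightarrow> real" where
  "h i x = (\<integral>\<omega>. sc (w i \<omega>) x \<partial>M)"

text \<open>For \<open>x > 0\<close> the integrand of the denominator, extended by 0 outside the
  interval from 0 to \<open>T\<close>.\<close>

definition psi :: "real \<Rightarrow> real \<Rightarrow> real" where
  "psi x s = (if 0 \<le> s \<and> s \<le> T then \<integral>\<omega>. sc (exp (- \<xi> s \<omega>)) x \<partial>M else 0)"

lemma psi_nonneg: "0 \<le> psi x s"
  using S.law.scaled_tail_nonneg by (auto simp: psi_def intro!: integral_nonneg_AE)

lemma psi_le_1: "psi x s \<le> 1"
proof (cases "0 \<le> s \<and> s \<le> T")
  case True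
  have "(\<integral>\<omega>. sc (exp (- \<xi> s \<omega>)) x \<partial>M) \<le> (\<integral>\<omega>. 1 \<partial>M)"
    using True \<xi>_measurable[of s] S.law.scaled_tail_le_1 by (intro integral_mono sc_integrable) auto
  then show ?thesis using True by (simp add: psi_def prob_space)
qed (auto simp: psi_def)

lemma psi_measurable [measurable]: "psi x \<in> borel_measurable borel"
proof -
  \<comment> \<open>\<open>\<xi>\<close> is monotone only from time 0 on; clamping there makes
    \<open>g\<close> antitone on the whole line, hence Borel.\<close>
  define g where "g s = (\<integral>\<omega>. sc (exp (- \<xi> (max 0 s) \<omega>)) x \<partial>M)" for s
  have "mono (\<lambda>s. - g s)"
    unfolding mono_def g_def using \<xi>_measurable \<xi>_le
    by (auto intro!: integral_mono sc_integrable S.law.scaled_tail_mono)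
  then have "(\<lambda>s. - (- g s)) \<in> borel_measurable borel"
    by (intro borel_measurable_uminus borel_measurable_mono)
  then have [measurable]: "g \<in> borel_measurable borel" by simp
  have "psi x = (\<lambda>s. indicator {0..T} s * g s)"
    by (auto simp: fun_eq_iff psi_def g_def indicator_def max_def)
  then show ?thesis by simp
qed

text \<open>Only the arrivals are frozen: at a fixed arrival time, discounting and claim are
  averaged, which gives \<open>psi\<close>. The event \<open>E\<close> is carried along in order to
  impose at least \<open>n\<close> arrivals by \<open>T\<close>.\<close>

lemma arrival_prob:
  assumes i: "1 \<le> i" and x: "0 \<le> x" and E: "E \<in> sets count_alg"
  shows "prob {\<omega> \<in> space M. \<omega> \<in> E \<and> x < w i \<omega> * Y i \<omega>} = (\<integral>\<omega>. indicator E \<omega> * psi x (\<tau> i \<omega>) \<partial>M)"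
proof -
  define P where "P \<omega> \<omega>' \<longleftrightarrow> \<omega> \<in> E \<and> \<tau> i \<omega> \<le> T \<and> x < exp (- \<xi> (\<tau> i \<omega>) \<omega>') * Y i \<omega>'" for \<omega> \<omega>'
  have [measurable]: "(\<lambda>p. \<xi> (\<tau> i (fst p)) (snd p)) \<in> borel_measurable (count_alg \<Otimes>\<^sub>M claims_disc_alg)"
    using measurable_compose[OF measurable_Pair[OF measurable_fst
        measurable_compose[OF measurable_snd ident_measurable(4)]] \<xi>_arrival_joint[OF i]] by simp
  have [measurable]: "Y i \<in> borel_measurable claims_disc_alg"
    using measurable_compose[OF ident_measurable(3) Y_claims[OF i]] .
  note [measurable] = arrival_count_alg[OF i] E
  have PM: "Measurable.pred (count_alg \<Otimes>\<^sub>M claims_disc_alg) (\<lambda>p. P (fst p) (snd p))"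
    unfolding P_def by measurable
  have "prob {\<omega> \<in> space M. \<omega> \<in> E \<and> x < w i \<omega> * Y i \<omega>} = prob {\<omega> \<in> space M. P \<omega> \<omega>}"
    using x by (intro arg_cong[of _ _ prob]) (auto simp: P_def w_def)
  also have "\<dots> = (\<integral>\<omega>. prob {\<omega>' \<in> space M. P \<omega> \<omega>'} \<partial>M)"
    by (rule indep_diagonal[where A = count_alg and B = claims_disc_alg])
      (use sets_algs indep_count_claims_disc PM in auto)
  also have "\<dots> = (\<integral>\<omega>. indicator E \<omega> * psi x (\<tau> i \<omega>) \<partial>M)"
  proof (rule Bochner_Integration.integral_cong[OF refl])
    fix \<omega> assume \<omega>: "\<omega> \<in> space M"
    show "prob {\<omega>' \<in> space M. P \<omega> \<omega>'} = indicator E \<omega> * psi x (\<tau> i \<omega>)"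
    proof (cases "\<omega> \<in> E \<and> \<tau> i \<omega> \<le> T")
      case True
      have "(\<lambda>\<omega>'. exp (- \<xi> (\<tau> i \<omega>) \<omega>')) \<in> borel_measurable count_disc_alg"
        using measurable_compose[OF ident_measurable(2) \<xi>_disc_alg[OF arrival_nonneg[OF \<omega>, of i]]]
        by measurable
      then have "prob {\<omega>' \<in> space M. x < exp (- \<xi> (\<tau> i \<omega>) \<omega>') * Y i \<omega>'} = psi x (\<tau> i \<omega>)"
        using True arrival_nonneg[OF \<omega>, of i] by (simp add: psi_def prob_scaled_claim[OF i])
      then show ?thesis using True by (simp add: P_def)
    next
      case False
      then have "{\<omega>' \<in> space M. P \<omega> \<omega>'} = {}" "indicator E \<omega> * psi x (\<tau> i \<omega>) = 0"
        by (auto simp: P_def psi_def)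
      then show ?thesis by (simp only: measure_empty)
    qed
  qed
  finally show ?thesis .
qed

lemma h_alt: "1 \<le> i \<Longrightarrow> h i x = prob {\<omega> \<in> space M. x < w i \<omega> * Y i \<omega>}"
  unfolding h_def by (rule prob_scaled_claim[symmetric]) (auto intro: w_measurable)

lemma h_eq:
  assumes "1 \<le> i" "0 \<le> x"
  shows "h i x = (\<integral>\<omega>. psi x (\<tau> i \<omega>) \<partial>M)"
proof -
  have "space M \<in> sets count_alg" using sets.top[of count_alg] by simp
  from arrival_prob[OF assms this] show ?thesis
    unfolding h_alt[OF assms(1)] by (simp cong: Bochner_Integration.integral_cong)
qed

lemma h_nonneg: "0 \<le> h i x"
  unfolding h_def using S.law.scaled_tail_nonneg by (intro integral_nonneg_AE) auto

end

section \<open>Geometric decay of arrival probabilities, and the aggregate claims as a finite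
  sum\<close>

context risk_model
begin

text \<open>The Laplace transform of the inter-arrival law at 1. It is below 1 because these times
  are nonnegative and not almost surely 0, and it is the rate in all geometric estimates on
  arrivals.\<close>

definition rho :: real where "rho = expectation (\<lambda>\<omega>. exp (- \<theta> 1 \<omega>))"

lemma exp_\<theta>_integrable: "1 \<le> i \<Longrightarrow> integrable M (\<lambda>\<omega>. exp (- \<theta> i \<omega>))"
  using \<theta>_measurable[of i] \<theta>_nonneg[of i] by (intro integrable_const_bound[where B = 1] AE_I2) auto

lemma expectation_exp_\<theta>:
  assumes i: "1 \<le> i" shows "expectation (\<lambda>\<omega>. exp (- \<theta> i \<omega>)) = rho"
proof -
  have "expectation (\<lambda>\<omega>. exp (- \<theta> j \<omega>)) = (\<integral>s. exp (- s) \<partial>distr M borel (\<theta> j))" if "1 \<le> j" for j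
    using \<theta>_measurable[OF that] by (intro integral_distr[symmetric]) auto
  then show ?thesis using \<theta>_distr[OF i] i by (simp add: rho_def)
qed

lemma rho_nonneg: "0 \<le> rho"
  unfolding rho_def by (intro integral_nonneg_AE) auto

lemma rho_less_1: "rho < 1"
proof -
  have int: "integrable M (\<lambda>\<omega>. 1 - exp (- \<theta> 1 \<omega>))"
    using exp_\<theta>_integrable[of 1] by auto
  have nn: "AE \<omega> in M. 0 \<le> 1 - exp (- \<theta> 1 \<omega>)"
    using \<theta>_nonneg[of 1] by (intro AE_I2) auto
  have eq: "(\<integral>\<omega>. 1 - exp (- \<theta> 1 \<omega>) \<partial>M) = 1 - rho"
    using exp_\<theta>_integrable[of 1] by (simp add: rho_def prob_space)
  have "0 \<le> 1 - rho" unfolding eq[symmetric] using nn by (rule integral_nonneg_AE)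
  moreover have "1 - rho \<noteq> 0"
  proof
    assume "1 - rho = 0"
    then have "AE \<omega> in M. 1 - exp (- \<theta> 1 \<omega>) = 0"
      using integral_nonneg_eq_0_iff_AE[OF int nn] eq by simp
    then show False using \<theta>_nonzero by simp
  qed
  ultimately show ?thesis by simp
qed

text \<open>Chernoff's bound with exponent 1, keeping the first inter-arrival time.\<close>

lemma renewal_bound:
  assumes n: "1 \<le> n" and f [measurable]: "f \<in> borel_measurable borel" and f01: "\<And>s. 0 \<le> f s" "\<And>s. f s \<le> 1"
  shows "(\<integral>\<omega>. indicator {\<omega> \<in> space M. \<tau> n \<omega> \<le> T} \<omega> * f (\<tau> 1 \<omega>) \<partial>M)
    \<le> exp T * rho ^ (n - 1) * (\<integral>\<omega>. f (\<tau> 1 \<omega>) \<partial>M)"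
proof -
  \<comment> \<open>The first factor is reserved for \<open>f\<close>, so independence keeps the
    expectation of \<open>f (\<tau> 1)\<close> and yields \<open>n - 1\<close> factors
    \<open>rho\<close>.\<close>
  define g :: "nat \<Rightarrow> real \<Rightarrow> real" where "g i = (if i = 1 then f else (\<lambda>s. exp (- s)))" for i
  have \<tau>1: "\<tau> 1 \<omega> = \<theta> 1 \<omega>" for \<omega> by (simp add: arrival_def)
  have [measurable]: "\<tau> i \<in> borel_measurable M" "\<theta> 1 \<in> borel_measurable M" for i
    by (rule arrival_measurable, rule \<theta>_measurable) simp
  have f_meas: "(\<lambda>\<omega>. f (\<theta> 1 \<omega>)) \<in> borel_measurable M" by measurable
  have f_int: "integrable M (\<lambda>\<omega>. f (\<theta> 1 \<omega>))"
    using f01 f_meas by (intro integrable_const_bound[where B = 1] AE_I2) simp_all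
  have ind: "indep_vars (\<lambda>_. borel) (\<lambda>i \<omega>. g i (\<theta> i \<omega>)) {1..n}"
    by (rule indep_vars_compose2[OF indep_vars_subset[OF \<theta>_indep]]) (auto simp: g_def)
  have gi: "integrable M (\<lambda>\<omega>. g i (\<theta> i \<omega>))" if "i \<in> {1..n}" for i
    using that f_int exp_\<theta>_integrable[of i] by (simp add: g_def)
  have split: "(\<Prod>i=1..n. u i) = u 1 * (\<Prod>i=Suc 1..n. u i)" for u :: "nat \<Rightarrow> real"
    using n by (rule prod.atLeast_Suc_atMost)
  have "(\<integral>\<omega>. (\<Prod>i=1..n. g i (\<theta> i \<omega>)) \<partial>M) = (\<Prod>i=1..n. \<integral>\<omega>. g i (\<theta> i \<omega>) \<partial>M)"
    by (rule indep_vars_lebesgue_integral[OF _ ind gi]) simp_all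
  also have "\<dots> = (\<integral>\<omega>. f (\<theta> 1 \<omega>) \<partial>M) * (\<Prod>i=Suc 1..n. \<integral>\<omega>. g i (\<theta> i \<omega>) \<partial>M)"
    unfolding split by (simp add: g_def)
  also have "(\<Prod>i=Suc 1..n. \<integral>\<omega>. g i (\<theta> i \<omega>) \<partial>M) = (\<Prod>i=Suc 1..n. rho)"
    by (rule prod.cong) (auto simp: g_def expectation_exp_\<theta>)
  finally have eq: "(\<integral>\<omega>. (\<Prod>i=1..n. g i (\<theta> i \<omega>)) \<partial>M) = rho ^ (n - 1) * (\<integral>\<omega>. f (\<tau> 1 \<omega>) \<partial>M)"
    unfolding \<tau>1 by (simp add: mult.commute)
  have "(\<integral>\<omega>. indicator {\<omega> \<in> space M. \<tau> n \<omega> \<le> T} \<omega> * f (\<tau> 1 \<omega>) \<partial>M)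
      \<le> (\<integral>\<omega>. exp T * (\<Prod>i=1..n. g i (\<theta> i \<omega>)) \<partial>M)"
  proof (rule integral_mono)
    show "integrable M (\<lambda>\<omega>. indicator {\<omega> \<in> space M. \<tau> n \<omega> \<le> T} \<omega> * f (\<tau> 1 \<omega>))"
      using f01 by (intro integrable_const_bound[where B = 1] AE_I2) (auto simp: indicator_def)
    show "integrable M (\<lambda>\<omega>. exp T * (\<Prod>i=1..n. g i (\<theta> i \<omega>)))"
      by (intro integrable_mult_right indep_vars_integrable[OF _ ind gi]) auto
    fix \<omega> assume \<omega>: "\<omega> \<in> space M"
    have "(\<Prod>i=1..n. g i (\<theta> i \<omega>)) = f (\<tau> 1 \<omega>) * (\<Prod>i=Suc 1..n. exp (- \<theta> i \<omega>))"
      unfolding split \<tau>1 by (intro arg_cong2[of _ _ _ _ "(*)"] prod.cong) (auto simp: g_def)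
    also have "(\<Prod>i=Suc 1..n. exp (- \<theta> i \<omega>)) = exp (- (\<Sum>i=Suc 1..n. \<theta> i \<omega>))"
      by (simp add: exp_sum sum_negf[symmetric])
    finally have e: "exp T * (\<Prod>i=1..n. g i (\<theta> i \<omega>)) = exp (T - (\<Sum>i=Suc 1..n. \<theta> i \<omega>)) * f (\<tau> 1 \<omega>)"
      by (simp add: exp_diff exp_minus field_simps)
    \<comment> \<open>On the event, the sum without the first inter-arrival time is still at most
      \<open>T\<close>, so the exponential is at least 1.\<close>
    have "(\<Sum>i=Suc 1..n. \<theta> i \<omega>) \<le> \<tau> n \<omega>"
      unfolding arrival_def using \<omega> by (intro sum_mono2) (auto intro: \<theta>_nonneg)
    then have "indicator {\<omega> \<in> space M. \<tau> n \<omega> \<le> T} \<omega> \<le> exp (T - (\<Sum>i=Suc 1..n. \<theta> i \<omega>))"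
      by (auto simp: indicator_def)
    then show "indicator {\<omega> \<in> space M. \<tau> n \<omega> \<le> T} \<omega> * f (\<tau> 1 \<omega>) \<le> exp T * (\<Prod>i=1..n. g i (\<theta> i \<omega>))"
      unfolding e using f01 by (intro mult_right_mono) auto
  qed
  then show ?thesis by (simp add: eq mult.assoc del: One_nat_def)
qed

lemma prob_arrival_le: "1 \<le> n \<Longrightarrow> prob {\<omega> \<in> space M. \<tau> n \<omega> \<le> T} \<le> exp T * rho ^ (n - 1)"
  using renewal_bound[of n "\<lambda>_. 1"]
  by (simp add: prob_space Int_absorb2 Collect_restrict)

lemma AE_arrival_exceeds: "AE \<omega> in M. \<exists>n\<ge>1. T < \<tau> n \<omega>"
proof -
  let ?E = "{\<omega> \<in> space M. \<forall>n\<ge>1. \<tau> n \<omega> \<le> T}"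
  have [measurable]: "\<tau> i \<in> borel_measurable M" for i by (rule arrival_measurable)
  have E: "?E \<in> events" by measurable
  have "prob ?E \<le> exp T * rho ^ n" for n
  proof -
    have "prob ?E \<le> prob {\<omega> \<in> space M. \<tau> (Suc n) \<omega> \<le> T}"
      by (intro finite_measure_mono) auto
    also have "\<dots> \<le> exp T * rho ^ n" using prob_arrival_le[of "Suc n"] by simp
    finally show ?thesis .
  qed
  moreover have "(\<lambda>n. exp T * rho ^ n) \<longlonglongrightarrow> exp T * 0"
    using rho_nonneg rho_less_1 by (intro tendsto_intros LIMSEQ_realpow_zero)
  ultimately have "prob ?E \<le> exp T * 0"
    by (intro LIMSEQ_le_const[where X = "\<lambda>n. exp T * rho ^ n"]) blast+
  then have "prob ?E = 0" by (simp add: measure_le_0_iff del: One_nat_def)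
  then have "AE \<omega> in M. \<omega> \<notin> ?E"
    using E by (simp add: prob_eq_0)
  then show ?thesis by (auto elim!: AE_mp intro!: AE_I2 simp: not_le)
qed

text \<open>Otherwise the number of arrivals by \<open>T\<close> vanishes almost surely, and with it
  the renewal function.\<close>

lemma prob_first_arrival_pos: "0 < prob {\<omega> \<in> space M. \<tau> 1 \<omega> \<le> T}"
proof (rule ccontr)
  have [measurable]: "\<tau> i \<in> borel_measurable M" for i by (rule arrival_measurable)
  assume "\<not> ?thesis"
  then have "prob {\<omega> \<in> space M. \<tau> 1 \<omega> \<le> T} = 0" by (simp add: zero_less_measure_iff)
  then have "AE \<omega> in M. \<omega> \<notin> {\<omega> \<in> space M. \<tau> 1 \<omega> \<le> T}"
    by (subst (asm) prob_eq_0) simp_all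
  then have "AE \<omega> in M. ennreal_of_enat (counting \<theta> T \<omega>) = 0"
  proof (rule AE_mp, intro AE_I2 impI)
    fix \<omega> assume \<omega>: "\<omega> \<in> space M" "\<omega> \<notin> {\<omega> \<in> space M. \<tau> 1 \<omega> \<le> T}"
    then have "\<not> enat 1 \<le> counting \<theta> T \<omega>" using le_counting_iff[of 1 \<omega> T] by simp
    then have "counting \<theta> T \<omega> = 0"
      by (cases "counting \<theta> T \<omega>") (auto simp: zero_enat_def)
    then show "ennreal_of_enat (counting \<theta> T \<omega>) = 0" by simp
  qed
  then have "renewal_function M \<theta> T = (\<integral>\<^sup>+\<omega>. 0 \<partial>M)"
    unfolding renewal_function_def by (rule nn_integral_cong_AE)
  then show False using T by simp
qed

lemma AE_claims_nonneg: "AE \<omega> in M. \<forall>i\<ge>1. \<forall>k. 0 \<le> X i \<omega> $ k"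
proof -
  have "AE \<omega> in M. \<forall>k. 0 \<le> X i \<omega> $ k" if i: "1 \<le> i" for i
  proof -
    have "AE z in distr M borel (X i). \<forall>k. 0 \<le> z $ k"
      unfolding X_distr[OF i] by (rule F_nonneg)
    then show ?thesis using X_measurable[OF i] by (subst (asm) AE_distr_iff) auto
  qed
  then show ?thesis by (simp add: AE_all_countable)
qed

text \<open>A natural-number version of \<open>counting \<theta> T\<close>, set to 0 on the null
  event of infinitely many arrivals, where \<open>aggregate_claims\<close> is 0 as well.\<close>

definition num :: "'a \<Rightarrow> nat" where
  "num \<omega> = (if \<forall>n. \<tau> n \<omega> \<le> T then 0 else LEAST n. T < \<tau> (Suc n) \<omega>)"

lemma le_num_iff:
  assumes \<omega>: "\<omega> \<in> space M" "\<exists>n\<ge>1. T < \<tau> n \<omega>" and i: "1 \<le> i"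
  shows "i \<le> num \<omega> \<longleftrightarrow> \<tau> i \<omega> \<le> T"
proof -
  obtain n where n: "T < \<tau> (Suc n) \<omega>" using \<omega>(2) by (metis Suc_pred' less_eq_Suc_le One_nat_def)
  have nm: "num \<omega> = (LEAST n. T < \<tau> (Suc n) \<omega>)" using n unfolding num_def by (meson not_le)
  show ?thesis
  proof
    assume "i \<le> num \<omega>"
    then have "\<not> T < \<tau> (Suc (i - 1)) \<omega>" unfolding nm using i by (intro not_less_Least) linarith
    then show "\<tau> i \<omega> \<le> T" using i by simp
  next
    assume le: "\<tau> i \<omega> \<le> T"
    show "i \<le> num \<omega>"
    proof (rule ccontr)
      assume "\<not> i \<le> num \<omega>"
      then have "\<tau> (Suc (num \<omega>)) \<omega> \<le> \<tau> i \<omega>" using \<omega> by (intro arrival_mono) auto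
      moreover have "T < \<tau> (Suc (num \<omega>)) \<omega>" unfolding nm using n by (rule LeastI)
      ultimately show False using le by simp
    qed
  qed
qed

lemma aggregate_claims_eq:
  assumes \<omega>: "\<omega> \<in> space M"
  shows "aggregate_claims X \<theta> \<xi> T \<omega> = (\<Sum>i=1..num \<omega>. w i \<omega> *\<^sub>R X i \<omega>)"
proof -
  let ?I = "{i. 1 \<le> i \<and> enat i \<le> counting \<theta> T \<omega>}"
  have I: "?I = {i. 1 \<le> i \<and> \<tau> i \<omega> \<le> T}"
    using le_counting_iff[OF _ \<omega>] by auto
  show ?thesis
  proof (cases "\<exists>n\<ge>1. T < \<tau> n \<omega>")
    case True
    then have "?I = {1..num \<omega>}" unfolding I using le_num_iff[OF \<omega>] by auto
    then show ?thesis
      unfolding aggregate_claims_def using le_num_iff[OF \<omega> True] by (auto simp: w_def intro!: sum.cong)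
  next
    case False
    then have le: "\<tau> n \<omega> \<le> T" for n
      using T by (cases n) (auto simp: arrival_def not_less)
    then have "?I = {1..}" unfolding I by auto
    then have "infinite ?I" using infinite_Ici[of "1::nat"] by simp
    then have "aggregate_claims X \<theta> \<xi> T \<omega> = 0" unfolding aggregate_claims_def by (rule sum.infinite)
    moreover have "num \<omega> = 0" using le by (simp add: num_def)
    ultimately show ?thesis by simp
  qed
qed

lemma aggregate_claims_measurable: "aggregate_claims X \<theta> \<xi> T \<in> borel_measurable M"
proof -
  have [measurable]: "\<tau> i \<in> borel_measurable M" for i by (rule arrival_measurable)
  have num [measurable]: "num \<in> measurable M (count_space UNIV)"
    unfolding num_def [abs_def] by measurable
  have "(\<lambda>\<omega>. \<Sum>i=1..n. w i \<omega> *\<^sub>R X i \<omega>) \<in> borel_measurable M" for n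
    using w_measurable_M X_measurable by (intro borel_measurable_sum borel_measurable_scaleR) auto
  then have "(\<lambda>\<omega>. \<Sum>i=1..num \<omega>. w i \<omega> *\<^sub>R X i \<omega>) \<in> borel_measurable M"
    by (rule measurable_compose_countable[OF _ num])
  then show ?thesis
    by (rule measurable_cong[THEN iffD1, rotated]) (simp add: aggregate_claims_eq)
qed

text \<open>A single summand is coordinatewise below the total because all are nonnegative, and
  \<open>radial A\<close> is monotone.\<close>

lemma claim_le_aggregate:
  assumes \<omega>: "\<omega> \<in> space M" "\<exists>n\<ge>1. T < \<tau> n \<omega>" and nn: "\<forall>i\<ge>1. \<forall>k. 0 \<le> X i \<omega> $ k"
    and x: "0 < x" and i: "1 \<le> i" "x < w i \<omega> * Y i \<omega>"
  shows "aggregate_claims X \<theta> \<xi> T \<omega> \<in> (*\<^sub>R) x ` A"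
proof -
  have w: "0 < w i \<omega>" using i x w_nonneg[of i \<omega>] by (cases "w i \<omega> = 0") auto
  then have le: "i \<le> num \<omega>" using le_num_iff[OF \<omega> i(1)] by (auto simp: w_def split: if_splits)
  let ?D = "\<Sum>j=1..num \<omega>. w j \<omega> *\<^sub>R X j \<omega>"
  have term_nn: "0 \<le> (w j \<omega> *\<^sub>R X j \<omega>) $ k" if "j \<in> {1..num \<omega>}" for j k
    using nn w_nonneg that by simp
  have "x < radial A (w i \<omega> *\<^sub>R X i \<omega>)"
    using i nn w by (simp add: radial_scaleR[OF A])
  also have "\<dots> \<le> radial A ?D"
  proof (rule radial_mono[OF A])
    show "0 \<le> (w i \<omega> *\<^sub>R X i \<omega>) $ k" for k using nn w i by simp
    show "(w i \<omega> *\<^sub>R X i \<omega>) $ k \<le> ?D $ k" for k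
      unfolding sum_component using term_nn le i by (intro member_le_sum) auto
  qed
  finally show ?thesis
    unfolding aggregate_claims_eq[OF \<omega>(1)]
    using term_nn by (subst less_radial_iff[OF A x, symmetric]) (auto simp: sum_component intro!: sum_nonneg)
qed

lemma aggregate_le_claims:
  assumes \<omega>: "\<omega> \<in> space M" and nn: "\<forall>i\<ge>1. \<forall>k. 0 \<le> X i \<omega> $ k"
    and x: "0 < x" and D: "aggregate_claims X \<theta> \<xi> T \<omega> \<in> (*\<^sub>R) x ` A"
  shows "x < (\<Sum>i=1..num \<omega>. w i \<omega> * Y i \<omega>)"
proof -
  let ?D = "\<Sum>j=1..num \<omega>. w j \<omega> *\<^sub>R X j \<omega>"
  have term_nn: "0 \<le> (w j \<omega> *\<^sub>R X j \<omega>) $ k" if "j \<in> {1..num \<omega>}" for j k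
    using nn w_nonneg that by simp
  have "x < radial A ?D"
    using D unfolding aggregate_claims_eq[OF \<omega>]
    using term_nn by (subst less_radial_iff[OF A x]) (auto simp: sum_component intro!: sum_nonneg)
  also have "\<dots> \<le> (\<Sum>i=1..num \<omega>. radial A (w i \<omega> *\<^sub>R X i \<omega>))"
    by (intro radial_sum_le[OF A] term_nn)
  also have "\<dots> = (\<Sum>i=1..num \<omega>. w i \<omega> * Y i \<omega>)"
  proof (rule sum.cong[OF refl])
    fix i assume "i \<in> {1..num \<omega>}"
    then show "radial A (w i \<omega> *\<^sub>R X i \<omega>) = w i \<omega> * Y i \<omega>"
      using nn w_nonneg[of i \<omega>] by (cases "w i \<omega> = 0") (auto simp: radial_scaleR[OF A] radial_zero[OF A])
  qed
  finally show ?thesis .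
qed

end

section \<open>Tails of the discounted claims\<close>

context risk_model_rd
begin

text \<open>The tail of the first discounted claim on the event of at least \<open>n\<close>
  arrivals by \<open>T\<close>. It dominates \<open>h n\<close> and, up to Kesten's constant, the
  tail on that event of the sum of the first \<open>n\<close> discounted claims.\<close>

definition k :: "nat \<Rightarrow> real \<Rightarrow> real" where
  "k n x = (\<integral>\<omega>. indicator {\<omega> \<in> space M. \<tau> n \<omega> \<le> T} \<omega> * sc (w 1 \<omega>) x \<partial>M)"

lemma k_integrable: "integrable M (\<lambda>\<omega>. indicator {\<omega> \<in> space M. \<tau> n \<omega> \<le> T} \<omega> * sc (w 1 \<omega>) x)"
proof -
  have [measurable]: "\<tau> n \<in> borel_measurable M" "w 1 \<in> borel_measurable M"
    by (rule arrival_measurable, rule w_measurable_M) simp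
  have "integrable M (\<lambda>\<omega>. sc (w 1 \<omega>) x)" by (rule sc_integrable) measurable
  then have "integrable M (\<lambda>\<omega>. indicator {\<omega> \<in> space M. \<tau> n \<omega> \<le> T} \<omega> *\<^sub>R sc (w 1 \<omega>) x)"
    by (intro integrable_mult_indicator) simp_all
  then show ?thesis by simp
qed

text \<open>Since \<open>\<xi>\<close> is non-decreasing, \<open>w 1\<close> is the largest weight and depends on the arrivals only
  through the first one; this is what compares claim \<open>n\<close> with the first claim.\<close>

lemma k_le:
  assumes n: "1 \<le> n" and x: "0 \<le> x"
  shows "k n x \<le> exp T * rho ^ (n - 1) * h 1 x"
proof -
  let ?E = "{\<omega> \<in> space M. \<tau> n \<omega> \<le> T}"
  note [measurable] = arrival_count_alg[OF n]
  have "{\<omega> \<in> space count_alg. \<tau> n \<omega> \<le> T} \<in> sets count_alg" by measurable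
  then have E: "?E \<in> sets count_alg" by simp
  have E': "?E \<in> sets count_disc_alg" using E sub_algs by blast
  have v: "(\<lambda>\<omega>. indicator ?E \<omega> * w 1 \<omega>) \<in> borel_measurable count_disc_alg"
    using E' w_measurable[of 1] by (intro borel_measurable_times borel_measurable_indicator) auto
  \<comment> \<open>The indicator can move into the weight because a zero weight has zero tail at
    levels \<open>x \<ge> 0\<close>.\<close>
  have "k n x = (\<integral>\<omega>. sc (indicator ?E \<omega> * w 1 \<omega>) x \<partial>M)"
    unfolding k_def using x
    by (intro Bochner_Integration.integral_cong) (auto simp: indicator_def S.law.scaled_tail_zero)
  also have "\<dots> = prob {\<omega> \<in> space M. x < indicator ?E \<omega> * w 1 \<omega> * Y 1 \<omega>}"
    by (rule prob_scaled_claim[OF order_refl v, symmetric])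
  also have "{\<omega> \<in> space M. x < indicator ?E \<omega> * w 1 \<omega> * Y 1 \<omega>} = {\<omega> \<in> space M. \<omega> \<in> ?E \<and> x < w 1 \<omega> * Y 1 \<omega>}"
    using x by (auto simp: indicator_def)
  also have "prob \<dots> = (\<integral>\<omega>. indicator ?E \<omega> * psi x (\<tau> 1 \<omega>) \<partial>M)"
    by (rule arrival_prob[OF order_refl x E])
  also have "\<dots> \<le> exp T * rho ^ (n - 1) * (\<integral>\<omega>. psi x (\<tau> 1 \<omega>) \<partial>M)"
    by (rule renewal_bound[OF n psi_measurable psi_nonneg psi_le_1])
  also have "(\<integral>\<omega>. psi x (\<tau> 1 \<omega>) \<partial>M) = h 1 x"
    by (rule h_eq[OF order_refl x, symmetric])
  finally show ?thesis .
qed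

lemma h_le:
  assumes i: "1 \<le> i" and x: "0 \<le> x"
  shows "h i x \<le> exp T * rho ^ (i - 1) * h 1 x"
proof -
  have "h i x \<le> k i x"
    unfolding h_def k_def
  proof (rule integral_mono[OF sc_integrable[OF w_measurable_M[OF i]] k_integrable])
    fix \<omega> assume \<omega>: "\<omega> \<in> space M"
    show "sc (w i \<omega>) x \<le> indicator {\<omega> \<in> space M. \<tau> i \<omega> \<le> T} \<omega> * sc (w 1 \<omega>) x"
    proof (cases "\<tau> i \<omega> \<le> T")
      case True
      then show ?thesis using \<omega> w_le_first[OF i \<omega>] by (simp add: S.law.scaled_tail_mono)
    next
      case False
      then show ?thesis using x by (simp add: w_def S.law.scaled_tail_zero)
    qed
  qed
  also have "\<dots> \<le> exp T * rho ^ (i - 1) * h 1 x" by (rule k_le[OF i x])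
  finally show ?thesis .
qed

lemma h_first_pos:
  assumes x: "0 \<le> x"
  shows "0 < h 1 x"
proof -
  have nn: "AE \<omega> in M. 0 \<le> sc (w 1 \<omega>) x" using S.law.scaled_tail_nonneg by simp
  have "h 1 x \<noteq> 0"
  proof
    assume "h 1 x = 0"
    then have "AE \<omega> in M. sc (w 1 \<omega>) x = 0"
      using integral_nonneg_eq_0_iff_AE[OF sc_integrable[OF w_measurable_M[OF order_refl]] nn] by (simp add: h_def)
    then have "AE \<omega> in M. \<not> \<tau> 1 \<omega> \<le> T"
    proof (rule AE_mp, intro AE_I2 impI notI)
      fix \<omega> assume 0: "sc (w 1 \<omega>) x = 0" and le: "\<tau> 1 \<omega> \<le> T"
      have "0 < w 1 \<omega>" using le by (simp add: w_def)
      then show False using 0 S.law.tail_pos[of "x / w 1 \<omega>"] by (simp add: S.law.scaled_tail_eq)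
    qed
    moreover have "{\<omega> \<in> space M. \<tau> 1 \<omega> \<le> T} \<in> events"
      using arrival_measurable[of 1] by measurable
    ultimately have "prob {\<omega> \<in> space M. \<tau> 1 \<omega> \<le> T} = 0"
      by (subst prob_eq_0) (auto elim: eventually_mono)
    then show False using prob_first_arrival_pos by simp
  qed
  then show ?thesis using h_nonneg[of 1 x] by simp
qed

lemma geometric_bound_summable: "summable (\<lambda>i. exp T * rho ^ i * h 1 x)"
  using rho_nonneg rho_less_1 by (intro summable_mult2 summable_mult summable_geometric) simp

lemma h_summable: "0 \<le> x \<Longrightarrow> summable (\<lambda>i. h (Suc i) x)"
  using h_le[of "Suc _" x] h_nonneg
  by (intro summable_comparison_test'[OF geometric_bound_summable, of 0]) auto

text \<open>The denominator as a series over the claims, by \<open>denominator_eq\<close>.\<close>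

definition H :: "real \<Rightarrow> real" where "H x = (\<Sum>i. h (Suc i) x)"

lemma sum_h_le: "0 \<le> x \<Longrightarrow> (\<Sum>i=1..n. h i x) \<le> H x"
  using sum_le_suminf[OF h_summable, of x "{..<n}"] h_nonneg
  by (simp add: H_def sum.atLeast1_atMost_eq)

lemma h_first_le: "0 \<le> x \<Longrightarrow> h 1 x \<le> H x"
  using sum_h_le[of x 1] by simp

lemma H_pos: "0 \<le> x \<Longrightarrow> 0 < H x"
  using h_first_pos h_first_le by (rule less_le_trans)

text \<open>By \<open>h_le\<close> the remaining terms are dominated by a geometric series relative
  to \<open>h 1 x\<close>; hence the truncation index can be chosen uniformly in
  \<open>x\<close>.\<close>

lemma H_le_sum:
  assumes x: "0 \<le> x"
  shows "H x \<le> (\<Sum>i=1..n. h i x) + exp T * rho ^ n / (1 - rho) * h 1 x"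
proof -
  have "H x = (\<Sum>i. h (Suc (i + n)) x) + (\<Sum>i<n. h (Suc i) x)"
    unfolding H_def by (rule suminf_split_initial_segment[OF h_summable[OF x]])
  also have "(\<Sum>i. h (Suc (i + n)) x) \<le> (\<Sum>i. exp T * rho ^ (i + n) * h 1 x)"
    using summable_ignore_initial_segment[OF h_summable[OF x], of n]
      summable_ignore_initial_segment[OF geometric_bound_summable, of n x]
    using h_le[of "Suc _" x] x by (intro suminf_le) auto
  also have "\<dots> = (\<Sum>i. (exp T * rho ^ n * h 1 x) * rho ^ i)"
    by (simp add: power_add mult_ac)
  also have "\<dots> = exp T * rho ^ n / (1 - rho) * h 1 x"
    using rho_nonneg rho_less_1 by (subst suminf_mult) (auto simp: suminf_geometric summable_geometric)
  finally show ?thesis by (simp add: sum.atLeast1_atMost_eq)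
qed

lemma denominator_eq:
  assumes x: "0 < x"
  shows "(LINT s:{0..T}|renewal_measure M \<theta>. prob {\<omega> \<in> space M. exp (- \<xi> s \<omega>) *\<^sub>R X 1 \<omega> \<in> (*\<^sub>R) x ` A}) = H x"
proof -
  have eq: "prob {\<omega> \<in> space M. exp (- \<xi> s \<omega>) *\<^sub>R X 1 \<omega> \<in> (*\<^sub>R) x ` A} = psi x s" if s: "0 \<le> s" "s \<le> T" for s
  proof -
    have ms: "\<xi> s \<in> borel_measurable M" "X 1 \<in> borel_measurable M"
      using \<xi>_measurable X_measurable s by auto
    note [measurable] = ms
    have v: "(\<lambda>\<omega>. exp (- \<xi> s \<omega>)) \<in> borel_measurable count_disc_alg"
      using measurable_compose[OF ident_measurable(2) \<xi>_disc_alg[OF s(1)]] by measurable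
    have "open ((*\<^sub>R) x ` A)" using x by (intro open_scaling ruin_set_open[OF A]) simp
    then have [measurable]: "(*\<^sub>R) x ` A \<in> sets borel" by simp
    have ra [measurable]: "radial A \<in> borel_measurable borel" by (rule measurable_radial[OF A])
    have "prob {\<omega> \<in> space M. exp (- \<xi> s \<omega>) *\<^sub>R X 1 \<omega> \<in> (*\<^sub>R) x ` A}
        = prob {\<omega> \<in> space M. x < exp (- \<xi> s \<omega>) * Y 1 \<omega>}"
    proof (rule finite_measure_eq_AE)
      show "AE \<omega> in M. \<omega> \<in> {\<omega> \<in> space M. exp (- \<xi> s \<omega>) *\<^sub>R X 1 \<omega> \<in> (*\<^sub>R) x ` A} \<longleftrightarrow>
          \<omega> \<in> {\<omega> \<in> space M. x < exp (- \<xi> s \<omega>) * Y 1 \<omega>}"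
        using AE_claims_nonneg
      proof eventually_elim
        case (elim \<omega>)
        then have "x < radial A (exp (- \<xi> s \<omega>) *\<^sub>R X 1 \<omega>) \<longleftrightarrow> exp (- \<xi> s \<omega>) *\<^sub>R X 1 \<omega> \<in> (*\<^sub>R) x ` A"
          by (intro less_radial_iff[OF A x]) simp
        then show ?case using elim by (simp add: radial_scaleR[OF A])
      qed
    qed measurable
    also have "\<dots> = psi x s"
      using s unfolding prob_scaled_claim[OF order_refl v] by (simp add: psi_def)
    finally show ?thesis .
  qed
  \<comment> \<open>The exchange with the series is made for nonnegative integrals; the finite value
    found then identifies the Lebesgue integral.\<close>
  have nn: "(\<integral>\<^sup>+s. ennreal (psi x s) \<partial>renewal_measure M \<theta>) = ennreal (H x)"
  proof -
    have "(\<integral>\<^sup>+s. ennreal (psi x s) \<partial>renewal_measure M \<theta>) = (\<Sum>i. \<integral>\<^sup>+\<omega>. ennreal (psi x (\<tau> (Suc i) \<omega>)) \<partial>M)"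
      by (rule nn_integral_renewal_measure[OF arrival_measurable]) measurable
    also have "\<dots> = (\<Sum>i. ennreal (h (Suc i) x))"
    proof (rule suminf_cong)
      fix i
      have [measurable]: "\<tau> (Suc i) \<in> borel_measurable M" by (rule arrival_measurable)
      have hi: "h (Suc i) x = (\<integral>\<omega>. psi x (\<tau> (Suc i) \<omega>) \<partial>M)"
        using x by (intro h_eq) auto
      show "(\<integral>\<^sup>+\<omega>. ennreal (psi x (\<tau> (Suc i) \<omega>)) \<partial>M) = ennreal (h (Suc i) x)"
        using psi_nonneg psi_le_1 unfolding hi
        by (intro nn_integral_eq_integral integrable_const_bound[where B = 1] AE_I2) auto
    qed
    also have "\<dots> = ennreal (H x)"
      unfolding H_def using x h_nonneg by (intro suminf_ennreal2 h_summable) auto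
    finally show ?thesis .
  qed
  have "(LINT s:{0..T}|renewal_measure M \<theta>. prob {\<omega> \<in> space M. exp (- \<xi> s \<omega>) *\<^sub>R X 1 \<omega> \<in> (*\<^sub>R) x ` A})
      = (\<integral>s. psi x s \<partial>renewal_measure M \<theta>)"
    unfolding set_lebesgue_integral_def
  proof (rule Bochner_Integration.integral_cong[OF refl])
    fix s
    show "indicator {0..T} s *\<^sub>R prob {\<omega> \<in> space M. exp (- \<xi> s \<omega>) *\<^sub>R X 1 \<omega> \<in> (*\<^sub>R) x ` A} = psi x s"
      using eq[of s] by (cases "0 \<le> s \<and> s \<le> T") (auto simp: psi_def)
  qed
  also have "\<dots> = H x"
    using nn psi_nonneg H_pos[of x] x by (subst integral_eq_nn_integral) auto
  finally show ?thesis .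
qed

text \<open>A random weight \<open>v\<close> bounded by 1 preserves long-tailedness even if it is not bounded away from
  0: by monotonicity, the weights below a small \<open>d\<close> contribute little compared with those above \<open>d\<close>.\<close>

lemma scaled_long_tail:
  assumes v: "v \<in> borel_measurable M" and v01: "\<And>\<omega>. \<omega> \<in> space M \<Longrightarrow> 0 \<le> v \<omega>" "\<And>\<omega>. \<omega> \<in> space M \<Longrightarrow> v \<omega> \<le> 1"
    and L: "0 \<le> L" and e: "0 < e"
  shows "\<forall>\<^sub>F x in at_top. (\<integral>\<omega>. sc (v \<omega>) (x - L) \<partial>M) \<le> (1 + e) * (\<integral>\<omega>. sc (v \<omega>) x \<partial>M)"
proof (cases "prob {\<omega> \<in> space M. 0 < v \<omega>} = 0")
  case True
  note [measurable] = v
  have "AE \<omega> in M. \<omega> \<notin> {\<omega> \<in> space M. 0 < v \<omega>}"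
    using True by (subst (asm) prob_eq_0) auto
  then have v0: "AE \<omega> in M. v \<omega> = 0"
    by (rule AE_mp) (use v01 in \<open>force intro!: AE_I2\<close>)
  show ?thesis
    using eventually_ge_at_top[of L]
  proof eventually_elim
    case (elim x)
    have "(\<integral>\<omega>. sc (v \<omega>) (x - L) \<partial>M) = (\<integral>\<omega>. 0 \<partial>M)"
      by (rule integral_cong_AE) (use v0 elim in \<open>auto simp: S.law.scaled_tail_zero elim!: eventually_mono\<close>)
    moreover have "0 \<le> (\<integral>\<omega>. sc (v \<omega>) x \<partial>M)"
      using S.law.scaled_tail_nonneg by (intro integral_nonneg_AE) auto
    ultimately show ?case using e by simp
  qed
next
  case False
  note [measurable] = v
  define p where "p = prob {\<omega> \<in> space M. 0 < v \<omega>}"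
  have p: "0 < p" using False by (simp add: p_def zero_less_measure_iff)
  \<comment> \<open>Two losses of a factor \<open>1 + c\<close> occur; \<open>c \<le> 1\<close> and
    \<open>3 * c \<le> e\<close> keep their product at most \<open>1 + e\<close>.\<close>
  define c where "c = min 1 (e / 3)"
  have c: "0 < c" "c \<le> 1" "3 * c \<le> e" using e by (auto simp: c_def)
  have "(1 + c)\<^sup>2 = 1 + 2 * c + c * c" by (simp add: power2_eq_square algebra_simps)
  also have "c * c \<le> 1 * c" using c by (intro mult_right_mono) auto
  finally have c2: "(1 + c)\<^sup>2 \<le> 1 + e" using c by simp
  \<comment> \<open>The events of small positive weight shrink to the empty set, so for some cut-off
    \<open>d\<close> the weights below it have at most \<open>c\<close> times the probability of
    those above.\<close>
  let ?S = "\<lambda>n. {\<omega> \<in> space M. 0 < v \<omega> \<and> v \<omega> < 1 / real (Suc n)}"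
  have "(\<lambda>n. prob (?S n)) \<longlonglongrightarrow> prob (\<Inter>n. ?S n)"
  proof (rule finite_Lim_measure_decseq)
    show "decseq ?S"
    proof (rule decseq_SucI, rule subsetI)
      fix n \<omega> assume \<omega>: "\<omega> \<in> ?S (Suc n)"
      have "1 / real (Suc (Suc n)) \<le> 1 / real (Suc n)" by (intro divide_left_mono) auto
      moreover have "v \<omega> < 1 / real (Suc (Suc n))" using \<omega> by blast
      ultimately have "v \<omega> < 1 / real (Suc n)" by linarith
      then show "\<omega> \<in> ?S n" using \<omega> by blast
    qed
  qed auto
  also have "(\<Inter>n. ?S n) = {}"
  proof -
    have False if "\<omega> \<in> (\<Inter>n. ?S n)" for \<omega>
    proof -
      have "0 < v \<omega>" using that by auto
      then obtain n where "inverse (real (Suc n)) < v \<omega>" using reals_Archimedean by blast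
      moreover have "v \<omega> < 1 / real (Suc n)" using that by auto
      ultimately show False by (simp add: inverse_eq_divide)
    qed
    then show ?thesis by auto
  qed
  finally have "(\<lambda>n. prob (?S n)) \<longlonglongrightarrow> 0" by simp
  then have "\<forall>\<^sub>F n in sequentially. prob (?S n) < c * p / 2"
    using c p by (intro order_tendstoD(2)) auto
  then obtain n where n: "prob (?S n) < c * p / 2" by (auto simp: eventually_sequentially)
  define d where "d = 1 / real (Suc n)"
  have d: "0 < d" "d \<le> 1" by (auto simp: d_def)
  let ?B = "{\<omega> \<in> space M. d \<le> v \<omega>}" and ?C = "{\<omega> \<in> space M. 0 < v \<omega> \<and> v \<omega> < d}"
  have BC: "p = prob ?B + prob ?C"
  proof -
    have "{\<omega> \<in> space M. 0 < v \<omega>} = ?B \<union> ?C" using d by auto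
    then show ?thesis unfolding p_def by (simp, intro finite_measure_Union) auto
  qed
  have "c * p / 2 \<le> 1 * p / 2" using c p by (intro divide_right_mono mult_right_mono) auto
  then have "p / 2 \<le> prob ?B" using BC n by (simp add: d_def)
  then have "c * (p / 2) \<le> c * prob ?B" using c by (intro mult_left_mono) auto
  then have C: "prob ?C \<le> c * prob ?B" using n by (simp add: d_def)
  obtain x1 where x1: "\<And>y. x1 \<le> y \<Longrightarrow> Fbar (y - L / d) \<le> (1 + c) * Fbar y"
    using S.law.long_tail_le[of "L / d" c] L d c by (auto simp: eventually_at_top_linorder)
  \<comment> \<open>For weights at least \<open>d\<close> the rescaled level is shifted by at most
    \<open>L / d\<close>, so a single long-tail estimate covers them all.\<close>
  have sc_le: "sc u (x - L) \<le> (1 + c) * sc u x" if u: "d \<le> u" "u \<le> 1" and x: "max 0 x1 \<le> x" for u x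
  proof -
    have u0: "0 < u" using d u by simp
    have "x \<le> x / u" using x u u0 by (simp add: pos_le_divide_eq mult_left_le)
    then have "x1 \<le> x / u" using x by simp
    then have le: "Fbar (x / u - L / d) \<le> (1 + c) * Fbar (x / u)" by (rule x1)
    have "x / u - L / d \<le> (x - L) / u"
      using L d u by (simp add: diff_divide_distrib frac_le)
    then have "Fbar ((x - L) / u) \<le> Fbar (x / u - L / d)" by (rule S.law.tail_mono)
    then show ?thesis using le u0 by (simp add: S.law.scaled_tail_eq)
  qed
  show ?thesis
    using eventually_ge_at_top[of "max 0 x1"] eventually_ge_at_top[of L]
  proof eventually_elim
    case (elim x)
    let ?I = "\<integral>\<omega>. indicator ?B \<omega> * sc (v \<omega>) x \<partial>M"
    have Iint: "integrable M (\<lambda>\<omega>. indicator ?B \<omega> * sc (v \<omega>) x)"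
      using integrable_mult_indicator[OF _ sc_integrable[OF v], of ?B x] by simp
    have Cint: "integrable M (indicator ?C :: _ \<Rightarrow> real)" "integrable M (indicator ?B :: _ \<Rightarrow> real)"
      by (intro integrable_real_indicator; auto simp: emeasure_eq_measure)+
    have "(\<integral>\<omega>. sc (v \<omega>) (x - L) \<partial>M)
        \<le> (\<integral>\<omega>. (1 + c) * (indicator ?B \<omega> * sc (v \<omega>) x) + (1 + c) * sc d x * indicator ?C \<omega> \<partial>M)"
    proof (rule integral_mono)
      show "integrable M (\<lambda>\<omega>. (1 + c) * (indicator ?B \<omega> * sc (v \<omega>) x) + (1 + c) * sc d x * indicator ?C \<omega>)"
        using Iint Cint by auto
      fix \<omega> assume \<omega>: "\<omega> \<in> space M"
      consider "d \<le> v \<omega>" | "0 < v \<omega>" "v \<omega> < d" | "v \<omega> = 0" using v01(1)[OF \<omega>] by linarith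
      then show "sc (v \<omega>) (x - L) \<le> (1 + c) * (indicator ?B \<omega> * sc (v \<omega>) x) + (1 + c) * sc d x * indicator ?C \<omega>"
      proof cases
        case 1
        then show ?thesis using sc_le[of "v \<omega>" x] \<omega> v01(2)[OF \<omega>] elim by simp
      next
        case 2
        have "sc (v \<omega>) (x - L) \<le> sc d (x - L)" using 2 by (intro S.law.scaled_tail_mono) simp
        also have "\<dots> \<le> (1 + c) * sc d x" using sc_le[of d x] d elim by simp
        finally show ?thesis using 2 \<omega> by simp
      next
        case 3
        then show ?thesis using elim \<omega> d by (simp add: S.law.scaled_tail_zero)
      qed
    qed (rule sc_integrable[OF v])
    also have "\<dots> = (1 + c) * ?I + (1 + c) * sc d x * prob ?C"
      using Iint Cint by simp
    \<comment> \<open>The mass of the small weights is charged to \<open>?B\<close>, where every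
      weight has at least the scaled tail of \<open>d\<close>.\<close>
    also have "(1 + c) * sc d x * prob ?C \<le> (1 + c) * sc d x * (c * prob ?B)"
      using C c S.law.scaled_tail_nonneg by (intro mult_left_mono) auto
    also have "\<dots> = (1 + c) * c * (\<integral>\<omega>. indicator ?B \<omega> * sc d x \<partial>M)"
      by simp
    also have "\<dots> \<le> (1 + c) * c * ?I"
    proof (rule mult_left_mono[OF integral_mono])
      show "integrable M (\<lambda>\<omega>. indicator ?B \<omega> * sc d x)" using Cint by auto
      show "indicator ?B \<omega> * sc d x \<le> indicator ?B \<omega> * sc (v \<omega>) x" for \<omega>
        by (cases "\<omega> \<in> ?B") (auto intro: S.law.scaled_tail_mono)
    qed (use Iint c in auto)
    also have "(1 + c) * ?I + (1 + c) * c * ?I = (1 + c)\<^sup>2 * ?I"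
      by (simp add: power2_eq_square algebra_simps)
    also have "\<dots> \<le> (1 + e) * (\<integral>\<omega>. sc (v \<omega>) x \<partial>M)"
    proof (rule mult_mono[OF c2])
      show "?I \<le> (\<integral>\<omega>. sc (v \<omega>) x \<partial>M)"
        using Iint sc_integrable[OF v] S.law.scaled_tail_nonneg
        by (intro integral_mono) (auto simp: indicator_def)
      show "0 \<le> ?I" using S.law.scaled_tail_nonneg by (intro integral_nonneg_AE) auto
    qed (use e in auto)
    finally show ?case by simp
  qed
qed

lemma h_long_tail:
  assumes "1 \<le> i" "0 \<le> L" "0 < e"
  shows "\<forall>\<^sub>F x in at_top. h i (x - L) \<le> (1 + e) * h i x"
  unfolding h_def using assms w_nonneg w_le_1 by (intro scaled_long_tail w_measurable_M) auto

section \<open>The ruin probability\<close>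

abbreviation ruin :: "real \<Rightarrow> real" where
  "ruin x \<equiv> prob {\<omega> \<in> space M. aggregate_claims X \<theta> \<xi> T \<omega> \<in> (*\<^sub>R) x ` A}"

lemma ruin_event:
  assumes "0 < x"
  shows "{\<omega> \<in> space M. aggregate_claims X \<theta> \<xi> T \<omega> \<in> (*\<^sub>R) x ` A} \<in> events"
proof -
  have "open ((*\<^sub>R) x ` A)" using assms by (intro open_scaling ruin_set_open[OF A]) simp
  then have "(*\<^sub>R) x ` A \<in> sets borel" by simp
  from measurable_sets[OF aggregate_claims_measurable this] show ?thesis
    by (simp add: vimage_def Int_def conj_commute)
qed

lemma weighted_sum_pred:
  assumes v: "\<And>i. i \<in> {1..n} \<Longrightarrow> v i \<in> borel_measurable count_disc_alg"
  shows "Measurable.pred (count_disc_alg \<Otimes>\<^sub>M claims_alg) (\<lambda>p. x < (\<Sum>i=1..n. v i (fst p) * Y i (snd p)))"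
proof -
  have "(\<lambda>p. \<Sum>i=1..n. v i (fst p) * Y i (snd p)) \<in> borel_measurable (count_disc_alg \<Otimes>\<^sub>M claims_alg)"
  proof (intro borel_measurable_sum borel_measurable_times)
    fix i assume i: "i \<in> {1..n}"
    show "(\<lambda>p. v i (fst p)) \<in> borel_measurable (count_disc_alg \<Otimes>\<^sub>M claims_alg)"
      by (rule measurable_compose[OF measurable_fst v[OF i]])
    show "(\<lambda>p. Y i (snd p)) \<in> borel_measurable (count_disc_alg \<Otimes>\<^sub>M claims_alg)"
      using i by (intro measurable_compose[OF measurable_snd Y_claims]) auto
  qed
  then show ?thesis by measurable
qed

lemma prob_integrable:
  fixes P :: "'a \<Rightarrow> 'a \<Rightarrow> bool"
  assumes "(\<lambda>\<omega>. prob {\<omega>' \<in> space M. P \<omega> \<omega>'}) \<in> borel_measurable M"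
  shows "integrable M (\<lambda>\<omega>. prob {\<omega>' \<in> space M. P \<omega> \<omega>'})"
  using assms by (intro integrable_const_bound[where B = 1] AE_I2) auto

lemma sc_w_integrable: "i \<in> {1..n} \<Longrightarrow> integrable M (\<lambda>\<omega>. sc (w i \<omega>) x)"
  by (intro sc_integrable w_measurable_M) auto

lemma integral_sum_sc: "(\<integral>\<omega>. (\<Sum>i=1..n. sc (w i \<omega>) x) \<partial>M) = (\<Sum>i=1..n. h i x)"
  unfolding h_def by (rule Bochner_Integration.integral_sum) (rule sc_w_integrable)

text \<open>The bound of \<open>weighted_sum_upper\<close> is averaged first. The shift by
  \<open>L\<close> is then removed from each of finitely many \<open>h i\<close>, which costs the
  second factor \<open>1 + e\<close>.\<close>

lemma early_claims_upper:
  assumes e: "0 < e"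
  shows "\<forall>\<^sub>F x in at_top. prob {\<omega> \<in> space M. x < (\<Sum>i=1..n. w i \<omega> * Y i \<omega>)} \<le> (1 + e)\<^sup>2 * H x"
proof -
  obtain L x1 where L: "0 \<le> L" "L \<le> x1" and
    up: "\<And>v x. 0 \<le> v 1 \<Longrightarrow> v 1 \<le> 1 \<Longrightarrow> (\<And>i. i \<in> {1..n} \<Longrightarrow> 0 \<le> v i) \<Longrightarrow> (\<And>i. i \<in> {1..n} \<Longrightarrow> v i \<le> v 1) \<Longrightarrow>
      x1 \<le> x \<Longrightarrow> prob {\<omega> \<in> space M. x < (\<Sum>i=1..n. v i * Y i \<omega>)} \<le> (1 + e) * (\<Sum>i=1..n. sc (v i) (x - L))"
  proof (rule S.weighted_sum_upper[OF e, of n])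
    fix L x1
    assume "0 \<le> L" "L \<le> x1" and b: "\<And>v x. 0 \<le> v 1 \<Longrightarrow> v 1 \<le> 1 \<Longrightarrow> (\<And>i. i \<in> {1..n} \<Longrightarrow> 0 \<le> v i) \<Longrightarrow>
      (\<And>i. i \<in> {1..n} \<Longrightarrow> v i \<le> v 1) \<Longrightarrow> x1 \<le> x \<Longrightarrow>
      prob {\<omega> \<in> space M. x < (\<Sum>i=1..n. v i * Y i \<omega>)} \<le> (1 + e) * (\<Sum>i=1..n. sc (v i) (x - L))"
    then show thesis by (intro that[of L x1]) auto
  qed
  have "\<forall>\<^sub>F x in at_top. \<forall>i\<in>{1..n}. h i (x - L) \<le> (1 + e) * h i x"
    using L e by (intro eventually_ball_finite ballI h_long_tail) auto
  then show ?thesis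
    using eventually_ge_at_top[of "max 0 x1"]
  proof eventually_elim
    case (elim x)
    have pred: "Measurable.pred (count_disc_alg \<Otimes>\<^sub>M claims_alg) (\<lambda>p. x < (\<Sum>i=1..n. w i (fst p) * Y i (snd p)))"
      by (intro weighted_sum_pred w_measurable) auto
    note W = weighted_prob[where P = "\<lambda>\<omega> \<omega>'. x < (\<Sum>i=1..n. w i \<omega> * Y i \<omega>')", OF pred]
    have "prob {\<omega> \<in> space M. x < (\<Sum>i=1..n. w i \<omega> * Y i \<omega>)}
        = (\<integral>\<omega>. prob {\<omega>' \<in> space M. x < (\<Sum>i=1..n. w i \<omega> * Y i \<omega>')} \<partial>M)"
      by (rule W(1))
    also have "\<dots> \<le> (\<integral>\<omega>. (1 + e) * (\<Sum>i=1..n. sc (w i \<omega>) (x - L)) \<partial>M)"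
      using elim w_nonneg w_le_1 w_le_first
      by (intro integral_mono prob_integrable W(2) integrable_mult_right Bochner_Integration.integrable_sum sc_w_integrable up) auto
    also have "\<dots> = (1 + e) * (\<Sum>i=1..n. h i (x - L))"
      by (simp only: integral_mult_right_zero integral_sum_sc)
    also have "\<dots> \<le> (1 + e) * (\<Sum>i=1..n. (1 + e) * h i x)"
      using elim e by (intro mult_left_mono sum_mono) auto
    also have "\<dots> = (1 + e)\<^sup>2 * (\<Sum>i=1..n. h i x)"
      by (simp add: sum_distrib_left power2_eq_square mult.assoc)
    also have "\<dots> \<le> (1 + e)\<^sup>2 * H x"
      using elim by (intro mult_left_mono sum_h_le) auto
    finally show ?case .
  qed
qed

text \<open>With the indicator folded into the weights, Kesten's bound compares the whole sum with
  the first claim, and \<open>k_le\<close> supplies the decay.\<close>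

lemma late_claims_upper:
  assumes c: "S.bounds {} (S.partial_sum m) c" "0 \<le> c" and x: "0 \<le> x" and m: "1 \<le> m"
  shows "prob {\<omega> \<in> space M. \<tau> m \<omega> \<le> T \<and> x < (\<Sum>i=1..m. w i \<omega> * Y i \<omega>)}
    \<le> c * (exp T * rho ^ (m - 1) * h 1 x)"
proof -
  let ?E = "{\<omega> \<in> space M. \<tau> m \<omega> \<le> T}"
  define v where "v i \<omega> = indicator ?E \<omega> * w i \<omega>" for i \<omega>
  note [measurable] = arrival_count_alg[OF m]
  have "{\<omega> \<in> space count_alg. \<tau> m \<omega> \<le> T} \<in> sets count_alg" by measurable
  then have E: "?E \<in> sets count_disc_alg" using sub_algs by auto
  have v: "v i \<in> borel_measurable count_disc_alg" if "i \<in> {1..m}" for i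
    unfolding v_def using E w_measurable[of i] that
    by (intro borel_measurable_times borel_measurable_indicator) auto
  note W = weighted_prob[where P = "\<lambda>\<omega> \<omega>'. x < (\<Sum>i=1..m. v i \<omega> * Y i \<omega>')", OF weighted_sum_pred[OF v]]
  have vsum: "(\<Sum>i=1..m. v i \<omega> * y i) = indicator ?E \<omega> * (\<Sum>i=1..m. w i \<omega> * y i)" for \<omega> and y :: "nat \<Rightarrow> real"
    by (simp add: v_def sum_distrib_left mult.assoc)
  have "{\<omega> \<in> space M. \<tau> m \<omega> \<le> T \<and> x < (\<Sum>i=1..m. w i \<omega> * Y i \<omega>)}
      = {\<omega> \<in> space M. x < (\<Sum>i=1..m. v i \<omega> * Y i \<omega>)}"
    unfolding vsum using x by (auto simp: indicator_def)
  then have "prob {\<omega> \<in> space M. \<tau> m \<omega> \<le> T \<and> x < (\<Sum>i=1..m. w i \<omega> * Y i \<omega>)}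
      = (\<integral>\<omega>. prob {\<omega>' \<in> space M. x < (\<Sum>i=1..m. v i \<omega> * Y i \<omega>')} \<partial>M)"
    using W(1) by simp
  also have "\<dots> \<le> (\<integral>\<omega>. c * (indicator ?E \<omega> * sc (w 1 \<omega>) x) \<partial>M)"
  proof (intro integral_mono prob_integrable W(2) integrable_mult_right k_integrable)
    fix \<omega> assume \<omega>: "\<omega> \<in> space M"
    have "prob {\<omega>' \<in> space M. x < (\<Sum>i=1..m. v i \<omega> * Y i \<omega>')} \<le> c * sc (v 1 \<omega>) x"
      using w_nonneg w_le_first[OF _ \<omega>] by (intro S.weighted_kesten[OF c x]) (auto simp: v_def intro!: mult_left_mono)
    also have "sc (v 1 \<omega>) x = indicator ?E \<omega> * sc (w 1 \<omega>) x"
      using x by (auto simp: v_def indicator_def S.law.scaled_tail_zero)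
    finally show "prob {\<omega>' \<in> space M. x < (\<Sum>i=1..m. v i \<omega> * Y i \<omega>')} \<le> c * (indicator ?E \<omega> * sc (w 1 \<omega>) x)" .
  qed
  also have "\<dots> = c * k m x" by (simp add: k_def)
  also have "\<dots> \<le> c * (exp T * rho ^ (m - 1) * h 1 x)"
    using c by (intro mult_left_mono k_le m x)
  finally show ?thesis .
qed

lemma ruin_upper:
  assumes e: "0 < e"
  shows "\<forall>\<^sub>F x in at_top. ruin x \<le> ((1 + e)\<^sup>2 + e) * H x"
proof -
  \<comment> \<open>This choice gives \<open>q = (3 - rho) / 2\<close>, for which
    \<open>q * rho < 1\<close> is equivalent to \<open>(1 - rho) * (2 - rho) > 0\<close>.\<close>
  define e' where "e' = (1 - rho) / 4"
  define q where "q = 1 + 2 * e'"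
  have e': "0 < e'" "e' \<le> 1" using rho_nonneg rho_less_1 by (auto simp: e'_def)
  have q: "0 < q" using e' by (simp add: q_def)
  have "0 < (1 - rho) * (2 - rho)" using rho_less_1 by (intro mult_pos_pos) auto
  then have qr: "q * rho < 1" by (simp add: q_def e'_def field_simps)
  have qr0: "0 \<le> q * rho" using q rho_nonneg by simp
  obtain C where C: "0 < C" and
    CS: "\<And>n J. finite J \<Longrightarrow> J \<subseteq> {Suc n..} \<Longrightarrow> S.bounds J (S.partial_sum n) (C * (1 + 2 * e') ^ n)"
    by (rule S.kesten[OF e']) (rule that)
  have CS: "S.bounds {} (S.partial_sum n) (C * q ^ n)" for n
    using CS[of "{}" n] by (simp add: q_def)
  define B where "B = C * q * exp T / (1 - q * rho)"
  have "(\<lambda>n. B * (q * rho) ^ n) \<longlonglongrightarrow> B * 0"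
    using qr qr0 by (intro tendsto_intros LIMSEQ_realpow_zero)
  then have "\<forall>\<^sub>F n in sequentially. B * (q * rho) ^ n < e"
    using e by (intro order_tendstoD(2)) auto
  then obtain n0 where n0: "B * (q * rho) ^ n0 < e" by (auto simp: eventually_sequentially)
  show ?thesis
    using early_claims_upper[OF e, of n0] eventually_gt_at_top[of 0]
  proof eventually_elim
    case (elim x)
    then have x: "0 < x" "0 \<le> x" by auto
    let ?E = "{\<omega> \<in> space M. x < (\<Sum>i=1..n0. w i \<omega> * Y i \<omega>)}"
    \<comment> \<open>If more than \<open>n0\<close> claims arrive, one of these events occurs, with
      \<open>n0 + Suc j\<close> equal to their number. Asking for at least that many arrivals
      enlarges the event but keeps it within reach of \<open>late_claims_upper\<close>.\<close>
    let ?F = "\<lambda>j. {\<omega> \<in> space M. \<tau> (n0 + Suc j) \<omega> \<le> T \<and> x < (\<Sum>i=1..n0 + Suc j. w i \<omega> * Y i \<omega>)}"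
    let ?b = "\<lambda>j. (C * q * exp T * (q * rho) ^ n0 * h 1 x) * (q * rho) ^ j"
    have Ym: "Y i \<in> borel_measurable M" if "1 \<le> i" for i
      using S.Y_measurable[OF that] .
    have sum_m: "(\<lambda>\<omega>. \<Sum>i=1..n. w i \<omega> * Y i \<omega>) \<in> borel_measurable M" for n
      using w_measurable_M Ym by (intro borel_measurable_sum borel_measurable_times) auto
    note [measurable] = sum_m arrival_measurable
    have Em: "?E \<in> events" by measurable
    have Fm: "?F j \<in> events" for j by measurable
    have Fb: "prob (?F j) \<le> ?b j" for j
    proof -
      have "prob (?F j) \<le> C * q ^ (n0 + Suc j) * (exp T * rho ^ (n0 + Suc j - 1) * h 1 x)"
        using C q x by (intro late_claims_upper CS) auto
      also have "\<dots> = ?b j" by (simp add: power_add power_mult_distrib mult_ac)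
      finally show ?thesis .
    qed
    have bs: "summable ?b"
      using qr qr0 by (intro summable_mult summable_geometric) simp
    have Fs: "summable (\<lambda>j. prob (?F j))"
      using Fb by (intro summable_comparison_test'[OF bs, of 0]) auto
    have "ruin x \<le> prob (?E \<union> (\<Union>j. ?F j))"
    proof (intro finite_measure_mono_AE)
      show "AE \<omega> in M. \<omega> \<in> {\<omega> \<in> space M. aggregate_claims X \<theta> \<xi> T \<omega> \<in> (*\<^sub>R) x ` A} \<longrightarrow> \<omega> \<in> ?E \<union> (\<Union>j. ?F j)"
        using AE_claims_nonneg AE_arrival_exceeds
      proof eventually_elim
        case (elim \<omega>)
        show ?case
        proof
          assume "\<omega> \<in> {\<omega> \<in> space M. aggregate_claims X \<theta> \<xi> T \<omega> \<in> (*\<^sub>R) x ` A}"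
          then have \<omega>: "\<omega> \<in> space M" and D: "aggregate_claims X \<theta> \<xi> T \<omega> \<in> (*\<^sub>R) x ` A" by auto
          have less: "x < (\<Sum>i=1..num \<omega>. w i \<omega> * Y i \<omega>)"
            by (rule aggregate_le_claims[OF \<omega> elim(1) x(1) D])
          show "\<omega> \<in> ?E \<union> (\<Union>j. ?F j)"
          proof (cases "num \<omega> \<le> n0")
            case True
            have "(\<Sum>i=1..num \<omega>. w i \<omega> * Y i \<omega>) \<le> (\<Sum>i=1..n0. w i \<omega> * Y i \<omega>)"
              using True elim(1) w_nonneg
              by (intro sum_mono2) (auto intro!: mult_nonneg_nonneg radial_nonneg[OF A])
            then show ?thesis using less \<omega> by auto
          next
            case False
            then obtain j where j: "num \<omega> = n0 + Suc j" using less_imp_Suc_add[of n0 "num \<omega>"] by auto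
            then have "\<tau> (n0 + Suc j) \<omega> \<le> T"
              using le_num_iff[OF \<omega> elim(2), of "n0 + Suc j"] by simp
            then have "\<omega> \<in> ?F j" using less \<omega> unfolding j by blast
            then show ?thesis by blast
          qed
        qed
      qed
      show "?E \<union> (\<Union>j. ?F j) \<in> events" using Em Fm by blast
    qed
    also have "\<dots> \<le> prob ?E + prob (\<Union>j. ?F j)"
      using Em Fm by (intro measure_Un_le) blast+
    also have "prob (\<Union>j. ?F j) \<le> (\<Sum>j. prob (?F j))"
      using Fm Fs by (intro finite_measure_subadditive_countably) auto
    also have "\<dots> \<le> (\<Sum>j. ?b j)"
      by (rule suminf_le[OF Fb Fs bs])
    also have "\<dots> = (B * (q * rho) ^ n0) * h 1 x"
      using qr qr0 by (subst suminf_mult) (auto simp: suminf_geometric summable_geometric B_def)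
    also have "\<dots> \<le> e * h 1 x"
      using n0 h_nonneg by (intro mult_right_mono) auto
    also have "\<dots> \<le> e * H x"
      using e x by (intro mult_left_mono h_first_le) auto
    finally show ?case using elim by (simp add: algebra_simps)
  qed
qed

text \<open>One factor \<open>1 - e\<close> pays for truncating the series to \<open>n\<close>
  claims, the other for the overlaps in \<open>weighted_max_lower\<close>.\<close>

lemma ruin_lower:
  assumes e: "0 < e" "e \<le> 1"
  shows "\<forall>\<^sub>F x in at_top. (1 - e)\<^sup>2 * H x \<le> ruin x"
proof -
  have "(\<lambda>n. exp T / (1 - rho) * rho ^ n) \<longlonglongrightarrow> exp T / (1 - rho) * 0"
    using rho_nonneg rho_less_1 by (intro tendsto_intros LIMSEQ_realpow_zero)
  then have "\<forall>\<^sub>F n in sequentially. exp T / (1 - rho) * rho ^ n < e"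
    using e by (intro order_tendstoD(2)) auto
  then obtain n where n: "exp T / (1 - rho) * rho ^ n < e" by (auto simp: eventually_sequentially)
  have "((\<lambda>x. n * K * Fbar x) \<longlongrightarrow> n * K * 0) at_top"
    by (intro tendsto_intros S.law.tail_tendsto_0)
  then have "\<forall>\<^sub>F x in at_top. n * K * Fbar x < e"
    using e by (intro order_tendstoD(2)) auto
  then show ?thesis
    using eventually_gt_at_top[of "max 0 x0"]
  proof eventually_elim
    case (elim x)
    then have x: "0 < x" "0 \<le> x" "x0 < x" by auto
    have pred: "Measurable.pred (count_disc_alg \<Otimes>\<^sub>M claims_alg) (\<lambda>p. \<exists>i\<in>{1..n}. x < w i (fst p) * Y i (snd p))"
    proof (intro pred_intros_finite)
      fix i assume i: "i \<in> {1..n}"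
      have [measurable]: "(\<lambda>p. w i (fst p)) \<in> borel_measurable (count_disc_alg \<Otimes>\<^sub>M claims_alg)"
        "(\<lambda>p. Y i (snd p)) \<in> borel_measurable (count_disc_alg \<Otimes>\<^sub>M claims_alg)"
        using i by (auto intro!: measurable_compose[OF measurable_fst w_measurable] measurable_compose[OF measurable_snd Y_claims])
      show "Measurable.pred (count_disc_alg \<Otimes>\<^sub>M claims_alg) (\<lambda>p. x < w i (fst p) * Y i (snd p))"
        by measurable
    qed simp
    note W = weighted_prob[where P = "\<lambda>\<omega> \<omega>'. \<exists>i\<in>{1..n}. x < w i \<omega> * Y i \<omega>'", OF pred]
    have "exp T * rho ^ n / (1 - rho) * h 1 x \<le> e * H x"
      using n x by (intro mult_mono h_first_le h_nonneg) (use e in auto)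
    then have "(1 - e) * H x \<le> (\<Sum>i=1..n. h i x)"
      using H_le_sum[OF x(2), of n] by (simp add: algebra_simps)
    then have "(1 - e) * ((1 - e) * H x) \<le> (1 - n * K * Fbar x) * (\<Sum>i=1..n. h i x)"
      using elim e h_nonneg H_pos[OF x(2)] by (intro mult_mono) (auto intro!: sum_nonneg)
    also have "\<dots> = (\<integral>\<omega>. (1 - n * K * Fbar x) * (\<Sum>i=1..n. sc (w i \<omega>) x) \<partial>M)"
      by (simp only: integral_mult_right_zero integral_sum_sc)
    also have "\<dots> \<le> (\<integral>\<omega>. prob {\<omega>' \<in> space M. \<exists>i\<in>{1..n}. x < w i \<omega> * Y i \<omega>'} \<partial>M)"
      using x w_nonneg w_le_1
      by (intro integral_mono prob_integrable W(2) integrable_mult_right Bochner_Integration.integrable_sum sc_w_integrable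
          S.weighted_max_lower) auto
    also have "\<dots> = prob {\<omega> \<in> space M. \<exists>i\<in>{1..n}. x < w i \<omega> * Y i \<omega>}"
      by (rule W(1)[symmetric])
    also have "\<dots> \<le> ruin x"
    proof (rule finite_measure_mono_AE[OF _ ruin_event[OF x(1)]])
      show "AE \<omega> in M. \<omega> \<in> {\<omega> \<in> space M. \<exists>i\<in>{1..n}. x < w i \<omega> * Y i \<omega>} \<longrightarrow>
          \<omega> \<in> {\<omega> \<in> space M. aggregate_claims X \<theta> \<xi> T \<omega> \<in> (*\<^sub>R) x ` A}"
        using AE_claims_nonneg AE_arrival_exceeds
      proof eventually_elim
        case (elim \<omega>)
        then show ?case using claim_le_aggregate[OF _ elim(2,1) x(1)] by auto
      qed
    qed
    finally show ?case by (simp add: power2_eq_square mult.assoc)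
  qed
qed

lemma ruin_asymp: "((\<lambda>x. ruin x / H x) \<longlongrightarrow> 1) at_top"
proof (rule tendstoI)
  fix d :: real assume d: "0 < d"
  \<comment> \<open>With \<open>5 * e \<le> d\<close> and \<open>e \<le> 1\<close>, the upper excess
    \<open>3 * e + e * e\<close> is at most \<open>4 * e < d\<close>, and the lower deficit is below
    \<open>2 * e\<close>.\<close>
  define e where "e = min 1 (d / 5)"
  have e: "0 < e" "e \<le> 1" "5 * e \<le> d" using d by (auto simp: e_def)
  have ee: "e * e \<le> 1 * e" using e by (intro mult_right_mono) auto
  have up: "(1 + e)\<^sup>2 + e < 1 + d" and lo: "1 - d < (1 - e)\<^sup>2"
    using e ee mult_pos_pos[OF e(1) e(1)] by (simp_all add: power2_eq_square algebra_simps)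
  show "\<forall>\<^sub>F x in at_top. dist (ruin x / H x) 1 < d"
    using ruin_upper[OF e(1)] ruin_lower[OF e(1,2)] eventually_ge_at_top[of 0]
  proof eventually_elim
    case (elim x)
    have H: "0 < H x" using elim by (intro H_pos)
    have "ruin x / H x \<le> (1 + e)\<^sup>2 + e" using elim H by (simp add: pos_divide_le_eq)
    moreover have "(1 - e)\<^sup>2 \<le> ruin x / H x" using elim H by (simp add: pos_le_divide_eq)
    ultimately show ?case using up lo by (simp add: dist_real_def abs_less_iff)
  qed
qed

end

theorem theorem3p1:
  fixes M :: "'a measure"
    and A :: "(real ^ 'd) set"
    and F :: "(real ^ 'd) measure"
    and X :: "nat \<Rightarrow> 'a \<Rightarrow> real ^ 'd"
    and \<theta> :: "nat \<Rightarrow> 'a \<Rightarrow> real"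
    and \<xi> :: "real \<Rightarrow> 'a \<Rightarrow> real"
    and T :: real
  assumes "prob_space M"
    and "A \<in> ruin_sets"
    and "\<forall>i\<ge>1. X i \<in> borel_measurable M"
    and "\<forall>i\<ge>1. distr M borel (X i) = F"
    and "AE z in F. (\<forall>k. 0 \<le> z $ k) \<and> z \<noteq> 0"
    and "renewal_interarrivals M \<theta>"
    and "cadlag_process M \<xi>"
    and "mutually_independent M
           (process_algebra M {1..} borel X)
           (process_algebra M {0..} (count_space UNIV) (counting \<theta>))
           (process_algebra M {0..} borel \<xi>)"
    and "regression_dependent_on A M {1..} X"
    and "subexponential_on A F"
    and "\<forall>\<omega>\<in>space M. mono_on {0..} (\<lambda>t. \<xi> t \<omega>)"
    and "0 \<le> T" and "0 < renewal_function M \<theta> T"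
  shows "((\<lambda>x. \<P>(\<omega> in M. aggregate_claims X \<theta> \<xi> T \<omega> \<in> (*\<^sub>R) x ` A) /
            (LINT s:{0..T}|renewal_measure M \<theta>.
               \<P>(\<omega> in M. exp (- \<xi> s \<omega>) *\<^sub>R X 1 \<omega> \<in> (*\<^sub>R) x ` A)))
          \<longlongrightarrow> 1) at_top"
proof -
  interpret prob_space M by fact
  interpret risk_model M A F X \<theta> \<xi> T
    using assms by unfold_locales (auto elim: eventually_mono)
  have Y_distr: "distr M borel (Y i) = distr F borel (radial A)" if "1 \<le> i" for i
    using X_distr[OF that] X_measurable[OF that] distr_distr[OF measurable_radial[OF A], of "X i" M]
    by (simp add: comp_def)
  have "regression_dependent M {1..} Y" "subexponential (distr F borel (radial A))"
    using assms(9,10) by (simp_all add: regression_dependent_on_def subexponential_on_def)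
  then obtain x0 K where "regression_dependent_seq M (distr F borel (radial A)) Y x0 K"
    using regression_dependentE[where Z = Y, OF prob_space_axioms _ measurable_compose[OF X_measurable measurable_radial[OF A]] Y_distr]
    by blast
  then interpret S: regression_dependent_seq M "distr F borel (radial A)" Y x0 K .
  interpret risk_model_rd M A F X \<theta> \<xi> T x0 K ..
  \<comment> \<open>The denominator is identified for positive \<open>x\<close>, which is enough for
    the limit.\<close>
  have "\<forall>\<^sub>F x in at_top. ruin x / H x = ruin x /
      (LINT s:{0..T}|renewal_measure M \<theta>. prob {\<omega> \<in> space M. exp (- \<xi> s \<omega>) *\<^sub>R X 1 \<omega> \<in> (*\<^sub>R) x ` A})"
    using eventually_gt_at_top[of 0] by eventually_elim (simp only: denominator_eq)
  from tendsto_cong[THEN iffD1, OF this ruin_asymp] show ?thesis .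
qed

end
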